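(* Let $q_1,q_2\geq 2$, $m_1,m_2\geq 1$ and $l_1,l_2$ be integers such that $\gcd(q_1,q_2)=1$, $\gcd(m_1,q_1-1)=1$ and $\gcd(m_2,q_2-1)=1$. Let $1<c<18/17$. Then there exists $\varepsilon>0$ such that for $x\geq 1$ \[ \left|\{n\leq x:\ s_{q_1}(\lfloor n^c\rfloor)\equiv l_1 \bmod m_1\ \text{and}\ s_{q_2}(\lfloor n^c\rfloor)\equiv l_2\bmod m_2\}\right|=\frac{x}{m_1m_2}+O\left(x^{1-\varepsilon}\right), \] where $n$ ranges over positive integers.
   Context: For an integer $q\geq 2$, $s_q(n)$ denotes the sum of the digits of the nonnegative integer $n$ in base $q$; $\lfloor\cdot\rfloor$ is the floor function. *)

theory Defs
  imports "HOL-Analysis.Analysis"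
begin

fun digit_sum :: "nat \<Rightarrow> nat \<Rightarrow> nat" where
  "digit_sum q n = (if q < 2 \<or> n = 0 then 0 else n mod q + digit_sum q (n div q))"

end

theory Submission
  imports Defs "HOL-Number_Theory.Cong"
begin

text \<open>
Put \<open>\<gamma> = 1/c\<close> and write \<open>e(t)\<close> for \<open>exp (2 \<pi> i t)\<close>. Residue classes are detected by the functions
\<open>f(m) = e(\<alpha>\<^sub>1 s\<^sub>q\<^sub>1(m) + \<alpha>\<^sub>2 s\<^sub>q\<^sub>2(m))\<close>, so one has to save a power in the sum of \<open>f\<close> over those \<open>m\<close>
for which \<open>[m\<^sup>\<gamma>, (m + 1)\<^sup>\<gamma>)\<close> contains an integer. On a short block this is a condition that the fractional
part of \<open>m\<^sup>\<gamma>\<close> lies in a fixed short interval. A nonnegative trigonometric polynomial almost majorizes the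
indicator of that interval; since the number of \<open>m\<close> satisfying the condition is known, the loss of this
majorization is controlled by the same exponential sums with \<open>f = 1\<close>.

For \<open>h \<ge> 1\<close> the sums of \<open>f(m) e(h m\<^sup>\<gamma>)\<close> are small whatever \<open>f\<close> is: after van der Corput's inequality the
correlation of \<open>f\<close> at distance \<open>r\<close> agrees, up to rare carries, with a function of period
\<open>Q = q\<^sub>1\<^sup>\<lambda>q\<^sub>2\<^sup>\<mu>\<close>, and along each class modulo \<open>Q\<close> the phase \<open>h ((m + r)\<^sup>\<gamma> - m\<^sup>\<gamma>)\<close> varies slowly and
monotonically, so the Kusmin-Landau inequality applies. For \<open>h = 0\<close> the mean of the periodic correlation
factors by the Chinese remainder theorem, and the correlations of a single digit character are small on
average by a recursion on the lag, because \<open>(q - 1) \<alpha>\<close> is not an integer.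
\<close>

section \<open>Exponential sums\<close>

text \<open>Since s_q(n) and n agree modulo q - 1, an integral (q - 1) \<alpha> would make
  e(\<alpha> s_q(n)) equal to e(\<alpha> n), whose correlations all have modulus 1; excluding this
  is the purpose of the hypotheses on q - 1. Otherwise a single carry already changes the phase, and
  that is all the recursion on the lag uses. The bound on c is decided by the frequencies h >= 1.
  For m near a the interval has length about a^(\<gamma> - 1), so the majorant must resolve a
  slightly finer scale a^(-s) with s > 1 - \<gamma>, and the twisted sums must save more than the
  number of frequencies. Nothing is assumed about f there: the saving is paid for by the shift range
  and the periods alone, whose product with h has to stay below a. Blocks have length a^(1 -
  \<epsilon>) because the interval then keeps its length up to a factor 1 + O(a^(-\<epsilon>)). Just
  one of the two characters need be nontrivial; the correlation of the other is bounded by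
  1.\<close>

definition unit_exp :: "real \<Rightarrow> complex" where
  "unit_exp t = cis (2 * pi * t)"

lemma norm_unit_exp [simp]: "norm (unit_exp t) = 1"
  by (simp add: unit_exp_def)

lemma unit_exp_0 [simp]: "unit_exp 0 = 1"
  by (simp add: unit_exp_def)

lemma unit_exp_add: "unit_exp (s + t) = unit_exp s * unit_exp t"
  by (simp add: unit_exp_def cis_mult ring_distribs)

lemma cnj_unit_exp: "cnj (unit_exp t) = unit_exp (- t)"
  by (simp add: unit_exp_def cis_cnj)

lemma unit_exp_diff: "unit_exp (s - t) = unit_exp s * cnj (unit_exp t)"
  using unit_exp_add[of s "-t"] by (simp add: cnj_unit_exp)

lemma unit_exp_of_nat_mult: "unit_exp (real n * t) = unit_exp t ^ n"
  by (simp add: unit_exp_def Complex.DeMoivre mult_ac)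

lemma unit_exp_eq_1_iff: "unit_exp t = 1 \<longleftrightarrow> t \<in> \<int>"
proof
  assume "unit_exp t = 1"
  then have "cos (2 * pi * t) = 1"
    by (metis unit_exp_def cis.sel(1) one_complex.sel(1))
  then obtain n :: int where "2 * pi * t = of_int n * (2 * pi)"
    by (metis cos_one_2pi_int mult.commute mult.left_commute)
  then show "t \<in> \<int>" by simp
next
  assume "t \<in> \<int>"
  then obtain n :: int where "t = of_int n" by (auto elim: Ints_cases)
  then show "unit_exp t = 1"
    by (auto simp: unit_exp_def complex_eq_iff intro: cos_int_2pin sin_int_2pin)
qed

lemma unit_exp_of_int [simp]: "unit_exp (of_int n) = 1"
  by (simp add: unit_exp_eq_1_iff)

lemma unit_exp_add_of_int [simp]: "unit_exp (t + of_int n) = unit_exp t"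
  by (simp add: unit_exp_add)

lemma norm_unit_exp_minus_1: "norm (unit_exp t - 1) = 2 * \<bar>sin (pi * t)\<bar>"
proof -
  have "norm (unit_exp t - 1) ^ 2 = (cos (2 * (pi * t)) - 1)^2 + (sin (2 * (pi * t)))^2"
    by (simp add: unit_exp_def cmod_def mult.assoc)
  also have "\<dots> = (2 * \<bar>sin (pi * t)\<bar>) ^ 2"
    unfolding cos_double_sin sin_double
    using sin_cos_squared_add[of "pi * t"] by (simp add: power2_eq_square) algebra
  finally show ?thesis
    by (metis abs_ge_zero abs_norm_cancel norm_ge_zero power2_eq_iff_nonneg mult_nonneg_nonneg zero_le_numeral)
qed

text \<open>Jordan's inequality: the concave sine lies above its chord on [0, pi/2].\<close>

lemma sin_pi_ge:
  fixes t :: real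
  assumes "0 \<le> t" "t \<le> 1 / 2"
  shows "2 * t \<le> sin (pi * t)"
proof -
  have "concave_on {0..pi/2} sin"
  proof (rule f''_le0_imp_concave)
    show "convex {0..pi/2::real}" by simp
    show "(sin has_real_derivative cos x) (at x)" for x by (rule DERIV_sin)
    show "(cos has_real_derivative - sin x) (at x)" for x by (rule DERIV_cos)
    show "- sin x \<le> 0" if "x \<in> {0..pi/2}" for x :: real
      using that sin_ge_zero[of x] by auto
  qed
  then have "sin ((1 - 2 * t) *\<^sub>R 0 + (2 * t) *\<^sub>R (pi / 2)) \<ge> (1 - 2 * t) * sin 0 + (2 * t) * sin (pi / 2)"
    by (intro concave_onD) (use assms in auto)
  then show ?thesis by (simp add: mult.commute)
qed

lemma norm_unit_exp_minus_1_ge: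
  assumes "0 \<le> t" "t \<le> 1 / 2"
  shows "norm (unit_exp t - 1) \<ge> 4 * t"
  using sin_pi_ge[OF assms] unfolding norm_unit_exp_minus_1 by linarith

lemma norm_unit_exp_diff_le: "norm (unit_exp s - unit_exp t) \<le> 2 * pi * \<bar>s - t\<bar>"
proof -
  have "unit_exp s - unit_exp t = unit_exp t * (unit_exp (s - t) - 1)"
    by (simp add: algebra_simps flip: unit_exp_add)
  then have "norm (unit_exp s - unit_exp t) = 2 * \<bar>sin (pi * (s - t))\<bar>"
    by (simp add: norm_mult norm_unit_exp_minus_1)
  also have "\<dots> \<le> 2 * \<bar>pi * (s - t)\<bar>"
    using abs_sin_x_le_abs_x[of "pi * (s - t)"] by simp
  finally show ?thesis by (simp add: abs_mult)
qed

text \<open>In the matrix of shift pairs a row meets lag 0 once and every other lag at most twice;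
  this collapses the double sum in van der Corput's inequality to a sum over lags.\<close>

lemma sum_abs_diff_le:
  fixes c :: "nat \<Rightarrow> real"
  assumes "\<And>r. c r \<ge> 0" "i < R"
  shows "(\<Sum>j<R. c (if j \<le> i then i - j else j - i)) \<le> c 0 + 2 * (\<Sum>r\<in>{1..<R}. c r)"
proof -
  have "{..<R} = insert i ({..<i} \<union> {i<..<R})" using assms(2) by auto
  then have "(\<Sum>j<R. c (if j \<le> i then i - j else j - i)) =
     c 0 + (\<Sum>j<i. c (i - j)) + (\<Sum>j\<in>{i<..<R}. c (j - i))"
    by (simp add: sum.union_disjoint disjoint_iff)
  also have "(\<Sum>j<i. c (i - j)) = (\<Sum>r\<in>{1..i}. c r)"
    by (rule sum.reindex_bij_witness[of _ "\<lambda>r. i - r" "\<lambda>j. i - j"]) auto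
  also have "\<dots> \<le> (\<Sum>r\<in>{1..<R}. c r)"
    using assms by (intro sum_mono2) auto
  also have "(\<Sum>j\<in>{i<..<R}. c (j - i)) = (\<Sum>r\<in>{1..<R-i}. c r)"
    by (rule sum.reindex_bij_witness[of _ "\<lambda>r. r + i" "\<lambda>j. j - i"]) auto
  also have "\<dots> \<le> (\<Sum>r\<in>{1..<R}. c r)"
    using assms by (intro sum_mono2) auto
  finally show ?thesis by simp
qed

lemma sum_norm_square_le_card_mult:
  fixes f :: "'a \<Rightarrow> complex"
  shows "norm (\<Sum>x\<in>A. f x) ^ 2 \<le> real (card A) * (\<Sum>x\<in>A. norm (f x) ^ 2)"
proof -
  have "norm (\<Sum>x\<in>A. f x) ^ 2 \<le> (\<Sum>x\<in>A. norm (f x)) ^ 2"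
    by (intro power_mono norm_sum) auto
  also have "\<dots> = (\<Sum>x\<in>A. 1 * norm (f x)) ^ 2" by simp
  also have "\<dots> \<le> (\<Sum>x\<in>A. 1 ^ 2) * (\<Sum>x\<in>A. norm (f x) ^ 2)"
    by (rule Cauchy_Schwarz_ineq_sum)
  finally show ?thesis by simp
qed

text \<open>All \<open>R\<close> shifts of the zero-extended sequence have the same sum, so
  \<open>R\<close> times that sum is a sum over window positions of short sums of length
  \<open>R\<close>. Cauchy-Schwarz over the \<open>L + R\<close> positions and expansion of the
  square leave the correlations. One factor \<open>R\<close> stays on the left to avoid
  division.\<close>

lemma van_der_Corput:
  fixes u :: "nat \<Rightarrow> complex"
  shows "real R * norm (\<Sum>m\<in>{a..<a+L}. u m) ^ 2 \<le> real (L + R) *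
    ((\<Sum>m\<in>{a..<a+L}. norm (u m) ^ 2) +
     2 * (\<Sum>r\<in>{1..<R}. norm (\<Sum>m\<in>{a..<a+L-r}. u (m + r) * cnj (u m))))"
proof (cases "R = 0")
  case False
  \<comment> \<open>Moved up by \<open>R\<close>, so that the shifts become additions
    \<open>k + j\<close> over nat; for \<open>j < R\<close> the support in \<open>k\<close> stays
    inside \<open>K\<close>.\<close>
  define U where "U k = (if k \<in> {a+R..<a+R+L} then u (k - R) else 0)" for k
  define S where "S = (\<Sum>m\<in>{a..<a+L}. u m)"
  define K where "K = {a..<a+L+R}"
  define C where "C r = (\<Sum>m\<in>{a..<a+L-r}. u (m + r) * cnj (u m))" for r
  have shift: "(\<Sum>k\<in>K. U (k + j)) = S" if "j < R" for j
  proof -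
    have "(\<Sum>k\<in>K. U (k + j)) = (\<Sum>k\<in>{a+R-j..<a+R+L-j}. U (k + j))"
      using that by (intro sum.mono_neutral_right) (auto simp: U_def K_def)
    also have "\<dots> = S" unfolding S_def
      by (rule sum.reindex_bij_witness[of _ "\<lambda>m. m + R - j" "\<lambda>k. k + j - R"])
         (use that in \<open>auto simp: U_def\<close>)
    finally show ?thesis .
  qed
  have corr: "(\<Sum>k\<in>K. U (k + i) * cnj (U (k + j))) = C (i - j)" if "j \<le> i" "i < R" for i j
  proof -
    have "(\<Sum>k\<in>K. U (k + i) * cnj (U (k + j))) = (\<Sum>k\<in>{a+R-j..<a+R+L-i}. U (k + i) * cnj (U (k + j)))"
      using that by (intro sum.mono_neutral_right) (auto simp: U_def K_def)
    also have "\<dots> = C (i - j)" unfolding C_def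
      by (rule sum.reindex_bij_witness[of _ "\<lambda>m. m + R - j" "\<lambda>k. k + j - R"])
         (use that in \<open>auto simp: U_def\<close>)
    finally show ?thesis .
  qed
  have corr': "norm (\<Sum>k\<in>K. U (k + i) * cnj (U (k + j))) = norm (C (if j \<le> i then i - j else j - i))"
    if "i < R" "j < R" for i j
  proof (cases "j \<le> i")
    case True
    then show ?thesis using corr that by simp
  next
    case False
    have "(\<Sum>k\<in>K. U (k + i) * cnj (U (k + j))) = cnj (\<Sum>k\<in>K. U (k + j) * cnj (U (k + i)))"
      by (simp add: mult.commute)
    then have "norm (\<Sum>k\<in>K. U (k + i) * cnj (U (k + j))) = norm (\<Sum>k\<in>K. U (k + j) * cnj (U (k + i)))"
      by (simp only: complex_mod_cnj)
    then show ?thesis using False corr[of i j] that by simp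
  qed
  have "of_nat R * S = (\<Sum>j<R. \<Sum>k\<in>K. U (k + j))"
    by (simp add: shift)
  also have "\<dots> = (\<Sum>k\<in>K. \<Sum>j<R. U (k + j))"
    by (rule sum.swap)
  finally have "norm (of_nat R * S) = norm (\<Sum>k\<in>K. \<Sum>j<R. U (k + j))"
    by (rule arg_cong)
  then have "(real R * norm S) ^ 2 = norm (\<Sum>k\<in>K. \<Sum>j<R. U (k + j)) ^ 2"
    by (simp only: norm_mult norm_of_nat)
  also have "\<dots> \<le> real (card K) * (\<Sum>k\<in>K. norm (\<Sum>j<R. U (k + j)) ^ 2)"
    by (rule sum_norm_square_le_card_mult)
  finally have CS: "(real R * norm S) ^ 2 \<le> real (L + R) * (\<Sum>k\<in>K. norm (\<Sum>j<R. U (k + j)) ^ 2)"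
    by (simp add: K_def)
  have "(\<Sum>k\<in>K. norm (\<Sum>j<R. U (k + j)) ^ 2) \<le>
      real R * ((\<Sum>m\<in>{a..<a+L}. norm (u m) ^ 2) + 2 * (\<Sum>r\<in>{1..<R}. norm (C r)))"
  proof -
    have "complex_of_real (\<Sum>k\<in>K. norm (\<Sum>j<R. U (k + j)) ^ 2) =
        (\<Sum>k\<in>K. (\<Sum>i<R. U (k + i)) * cnj (\<Sum>j<R. U (k + j)))"
      unfolding of_real_sum by (simp only: complex_norm_square)
    also have "\<dots> = (\<Sum>k\<in>K. \<Sum>i<R. \<Sum>j<R. U (k + i) * cnj (U (k + j)))"
      by (simp add: sum_product)
    also have "\<dots> = (\<Sum>i<R. \<Sum>j<R. \<Sum>k\<in>K. U (k + i) * cnj (U (k + j)))"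
      by (rule trans[OF sum.swap sum.cong[OF refl sum.swap]])
    finally have "norm (complex_of_real (\<Sum>k\<in>K. norm (\<Sum>j<R. U (k + j)) ^ 2)) =
        norm (\<Sum>i<R. \<Sum>j<R. \<Sum>k\<in>K. U (k + i) * cnj (U (k + j)))" by simp
    also have "\<dots> \<le> (\<Sum>i<R. \<Sum>j<R. norm (\<Sum>k\<in>K. U (k + i) * cnj (U (k + j))))"
      by (intro sum_norm_le norm_sum)
    also have "\<dots> = (\<Sum>i<R. \<Sum>j<R. norm (C (if j \<le> i then i - j else j - i)))"
      by (intro sum.cong refl corr') auto
    also have "\<dots> \<le> (\<Sum>i<R. norm (C 0) + 2 * (\<Sum>r\<in>{1..<R}. norm (C r)))"
      by (intro sum_mono sum_abs_diff_le) auto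
    also have "\<dots> = real R * (norm (C 0) + 2 * (\<Sum>r\<in>{1..<R}. norm (C r)))" by simp
    finally have *: "norm (complex_of_real (\<Sum>k\<in>K. norm (\<Sum>j<R. U (k + j)) ^ 2)) \<le>
        real R * (norm (C 0) + 2 * (\<Sum>r\<in>{1..<R}. norm (C r)))" .
    have "C 0 = of_real (\<Sum>m\<in>{a..<a+L}. norm (u m) ^ 2)"
      unfolding of_real_sum C_def by (simp only: complex_norm_square) simp
    then have "norm (C 0) = (\<Sum>m\<in>{a..<a+L}. norm (u m) ^ 2)"
      by (simp only: norm_of_real) (simp add: sum_nonneg)
    then show ?thesis using * by (simp only: norm_of_real)
  qed
  from order_trans[OF CS mult_left_mono[OF this]] have "real R * (real R * norm S ^ 2) \<le> real R * (real (L + R) *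
    ((\<Sum>m\<in>{a..<a+L}. norm (u m) ^ 2) + 2 * (\<Sum>r\<in>{1..<R}. norm (C r))))"
    by (simp add: power2_eq_square mult_ac)
  then show ?thesis
    using False unfolding S_def C_def by (subst (asm) mult_le_cancel_left_pos) auto
qed (simp add: sum_nonneg)

text \<open>Partial summation against \<open>w\<close>, whose total variation telescopes because the
  increments are nonincreasing. The increment bounds extend to \<open>k = n\<close>, one step past
  the last term, because \<open>w n\<close> is the boundary term.\<close>

lemma Kusmin_Landau:
  fixes F :: "nat \<Rightarrow> real"
  assumes mono: "\<And>k. k < n \<Longrightarrow> F (Suc (Suc k)) - F (Suc k) \<le> F (Suc k) - F k"
    and lo: "\<And>k. k \<le> n \<Longrightarrow> d \<le> F (Suc k) - F k" and hi: "\<And>k. k \<le> n \<Longrightarrow> F (Suc k) - F k \<le> 1 / 2"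
    and "d > 0"
  shows "norm (\<Sum>k<n. unit_exp (F k)) \<le> 1 / d"
proof -
  define D where "D k = F (Suc k) - F k" for k
  \<comment> \<open>Chosen so that \<open>unit_exp (F k)\<close> equals \<open>w k\<close> times the
    difference of \<open>unit_exp (F (Suc k))\<close> and \<open>unit_exp (F k)\<close>.\<close>
  define w where "w k = 1 / (unit_exp (D k) - 1)" for k
  have D: "0 < D k" "D k \<le> 1 / 2" "d \<le> D k" if "k \<le> n" for k
    using lo[OF that] hi[OF that] \<open>d > 0\<close> by (auto simp: D_def)
  have ge: "norm (unit_exp (D k) - 1) \<ge> 4 * D k" if "k \<le> n" for k
    using norm_unit_exp_minus_1_ge D[OF that] by auto
  have nz: "unit_exp (D k) - 1 \<noteq> 0" if "k \<le> n" for k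
  proof
    assume "unit_exp (D k) - 1 = 0"
    then have "4 * D k \<le> 0" using ge[OF that] by (metis norm_zero)
    then show False using D(1)[OF that] by simp
  qed
  have w: "norm (w k) \<le> 1 / (4 * D k)" if "k \<le> n" for k
    unfolding w_def norm_divide using ge[OF that] D[OF that] by (auto intro!: divide_left_mono mult_pos_pos)
  have wd: "norm (w k - w (Suc k)) \<le> (1 / 2) * (1 / D (Suc k) - 1 / D k)" if "k < n" for k
  proof -
    have k: "k \<le> n" "Suc k \<le> n" using that by auto
    have "w k - w (Suc k) = (unit_exp (D (Suc k)) - unit_exp (D k)) * (w k * w (Suc k))"
      using nz[OF k(1)] nz[OF k(2)] by (simp add: w_def field_simps)
    then have "norm (w k - w (Suc k)) = norm (unit_exp (D (Suc k)) - unit_exp (D k)) * (norm (w k) * norm (w (Suc k)))"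
      by (simp add: norm_mult)
    also have "\<dots> \<le> (2 * pi * \<bar>D (Suc k) - D k\<bar>) * (1 / (4 * D k) * (1 / (4 * D (Suc k))))"
      by (intro mult_mono norm_unit_exp_diff_le w k) (use D k in \<open>auto intro!: mult_nonneg_nonneg less_imp_le\<close>)
    also have "\<bar>D (Suc k) - D k\<bar> = D k - D (Suc k)"
      using mono[OF that] by (simp add: D_def)
    also have "(2 * pi * (D k - D (Suc k))) * (1 / (4 * D k) * (1 / (4 * D (Suc k)))) =
       (pi / 8) * (1 / D (Suc k) - 1 / D k)"
      using D(1)[OF k(1)] D(1)[OF k(2)] by (simp add: field_simps)
    also have "\<dots> \<le> (1 / 2) * (1 / D (Suc k) - 1 / D k)"
      using pi_less_4 mono[OF that] D(1)[OF k(1)] D(1)[OF k(2)]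
      by (intro mult_right_mono) (auto simp: D_def intro!: divide_left_mono mult_pos_pos)
    finally show ?thesis .
  qed
  \<comment> \<open>The boundary term is kept inside the norm: each induction step then adds exactly
    one difference of \<open>w\<close>, and the bounds on these telescope to
    \<open>1 / D j\<close>.\<close>
  have "norm ((\<Sum>k<j. unit_exp (F k)) - unit_exp (F j) * w j) \<le> (1 / 2) * (1 / D j)" if "j \<le> n" for j
    using that
  proof (induction j)
    case 0
    then show ?case using w[of 0] D[of 0] by (simp add: norm_mult field_simps)
  next
    case (Suc j)
    have "unit_exp (F (Suc j)) = unit_exp (F j) * unit_exp (D j)"
      by (simp add: D_def flip: unit_exp_add)
    then have "unit_exp (F (Suc j)) * w j = unit_exp (F j) + unit_exp (F j) * w j"
      using nz[of j] Suc.prems by (simp add: w_def field_simps)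
    then have "(\<Sum>k<Suc j. unit_exp (F k)) - unit_exp (F (Suc j)) * w (Suc j) =
        ((\<Sum>k<j. unit_exp (F k)) - unit_exp (F j) * w j) + unit_exp (F (Suc j)) * (w j - w (Suc j))"
      by (simp add: algebra_simps)
    also have "norm \<dots> \<le> (1 / 2) * (1 / D j) + (1 / 2) * (1 / D (Suc j) - 1 / D j)"
      using Suc wd[of j] by (intro order_trans[OF norm_triangle_ineq] add_mono) (auto simp: norm_mult)
    finally show ?case by (simp add: algebra_simps)
  qed
  from this[of n] have "norm (\<Sum>k<n. unit_exp (F k)) \<le> (1 / 2) * (1 / D n) + norm (unit_exp (F n) * w n)"
    using norm_triangle_ineq2[of "\<Sum>k<n. unit_exp (F k)" "unit_exp (F n) * w n"] by simp
  also have "\<dots> \<le> (1 / 2) * (1 / D n) + 1 / (4 * D n)"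
    using w[of n] by (simp add: norm_mult)
  also have "\<dots> \<le> 1 / D n" using D[of n] by (simp add: field_simps)
  also have "\<dots> \<le> 1 / d" using D[of n] \<open>d > 0\<close> by (intro divide_left_mono) auto
  finally show ?thesis .
qed

section \<open>Digit sums and their correlations\<close>

declare digit_sum.simps [simp del]

lemma digit_sum_0 [simp]: "digit_sum q 0 = 0"
  by (simp add: digit_sum.simps)

lemma digit_sum_mult_add:
  assumes "q \<ge> 2" "i < q"
  shows "digit_sum q (q * n + i) = digit_sum q n + i"
proof (cases "q * n + i = 0")
  case False
  then show ?thesis using assms by (subst digit_sum.simps) auto
qed (use assms in auto)

lemma digit_sum_power_mult_add:
  assumes "q \<ge> 2" "i < q ^ l"
  shows "digit_sum q (q ^ l * n + i) = digit_sum q n + digit_sum q i"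
  using assms(2)
proof (induction l arbitrary: i)
  case (Suc l)
  have i: "i div q < q ^ l" "i mod q < q"
    using Suc.prems assms(1) by (auto simp: less_mult_imp_div_less mult.commute)
  have "q ^ Suc l * n + i = q * (q ^ l * n + i div q) + i mod q"
    by (simp add: algebra_simps)
  then have "digit_sum q (q ^ Suc l * n + i) = digit_sum q n + (digit_sum q (i div q) + i mod q)"
    using digit_sum_mult_add[OF assms(1) i(2)] Suc.IH[OF i(1)] by simp
  also have "digit_sum q (i div q) + i mod q = digit_sum q (q * (i div q) + i mod q)"
    by (rule digit_sum_mult_add[OF assms(1) i(2), symmetric])
  finally show ?case by simp
qed simp

section \<open>Correlations on a cyclic group and their recursion in the digits\<close>

lemma sum_lessThan_mult:
  fixes g :: "nat \<Rightarrow> 'a::comm_monoid_add"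
  shows "(\<Sum>m<B*P. g m) = (\<Sum>i<B. \<Sum>n<P. g (B * n + i))"
proof (cases "B = 0")
  case False
  have "(\<Sum>i<B. \<Sum>n<P. g (B * n + i)) = (\<Sum>(i,n)\<in>{..<B}\<times>{..<P}. g (B * n + i))"
    by (rule sum.cartesian_product)
  also have "\<dots> = (\<Sum>m<B*P. g m)"
  proof (rule sum.reindex_bij_witness[of _ "\<lambda>m. (m mod B, m div B)" "\<lambda>(i,n). B * n + i"])
    fix p assume "p \<in> {..<B} \<times> {..<P}"
    then obtain i n where p: "p = (i, n)" "i < B" "n < P" by auto
    have "B * n + i < B * Suc n" using p by simp
    also have "\<dots> \<le> B * P" using p by (intro mult_le_mono) auto
    finally show "(case p of (i, n) \<Rightarrow> B * n + i) \<in> {..<B*P}" using p by simp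
    show "((case p of (i, n) \<Rightarrow> B * n + i) mod B, (case p of (i, n) \<Rightarrow> B * n + i) div B) = p"
      using p by simp
    show "g (case p of (i, n) \<Rightarrow> B * n + i) = (case p of (i, n) \<Rightarrow> g (B * n + i))" using p by simp
  qed (use False in \<open>auto simp: less_mult_imp_div_less mult.commute\<close>)
  finally show ?thesis by simp
qed simp

text \<open>The lag wraps around modulo \<open>P\<close>: discarding the carry out of the top digit
  is what makes the digit recursion exact.\<close>

definition cyclic_corr :: "(nat \<Rightarrow> complex) \<Rightarrow> nat \<Rightarrow> nat \<Rightarrow> complex" where
  "cyclic_corr F P r = (\<Sum>m<P. F ((m + r) mod P) * cnj (F m)) / of_nat P"

lemma norm_cyclic_corr_le_1:
  assumes "\<And>n. norm (F n) = 1"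
  shows "norm (cyclic_corr F P r) \<le> 1"
proof -
  have "norm (\<Sum>m<P. F ((m + r) mod P) * cnj (F m)) \<le> (\<Sum>m<P. 1)"
    by (intro sum_norm_le) (simp add: norm_mult assms)
  then show ?thesis
    unfolding cyclic_corr_def norm_divide by (cases "P = 0") (auto simp: divide_simps)
qed

text \<open>With positions written as \<open>B * n + i\<close>, adding \<open>B * r + j\<close>
  carries out of the lowest block for exactly the last \<open>j\<close> values of \<open>i\<close>.
  These see lag \<open>r + 1\<close> in the upper digits, the others lag \<open>r\<close>; the digit
  factor of the carried part is bounded trivially by \<open>j\<close>.\<close>

lemma cyclic_corr_mult_le:
  assumes mult: "\<And>n i. i < B \<Longrightarrow> F (B * n + i) = F n * F i" and one: "\<And>n. norm (F n) = 1"
    and "P > 0" "j < B"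
  shows "real B * norm (cyclic_corr F (B * P) (B * r + j)) \<le>
    norm (\<Sum>i<B-j. F (i + j) * cnj (F i)) * norm (cyclic_corr F P r) + real j * norm (cyclic_corr F P (r + 1))"
proof -
  define S where "S r = (\<Sum>m<P. F ((m + r) mod P) * cnj (F m))" for r
  have S: "norm (S r) = real P * norm (cyclic_corr F P r)" for r
    using assms(3) by (simp add: S_def cyclic_corr_def norm_divide)
  have mod_eq: "(B * x + y) mod (B * P) = B * (x mod P) + y" if "y < B" for x y
    using that by (simp add: mod_mult2_eq)
  have lo: "F ((B * n + i + (B * r + j)) mod (B * P)) * cnj (F (B * n + i)) =
      (F (i + j) * cnj (F i)) * (F ((n + r) mod P) * cnj (F n))" if "i \<in> {..<B-j}" for i n
  proof -
    have "(B * n + i + (B * r + j)) mod (B * P) = (B * (n + r) + (i + j)) mod (B * P)"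
      by (simp add: algebra_simps)
    also have "\<dots> = B * ((n + r) mod P) + (i + j)" using that by (intro mod_eq) auto
    finally show ?thesis using that mult by simp
  qed
  have hi: "F ((B * n + i + (B * r + j)) mod (B * P)) * cnj (F (B * n + i)) =
      (F (i + j - B) * cnj (F i)) * (F ((n + (r + 1)) mod P) * cnj (F n))" if "i \<in> {B-j..<B}" for i n
  proof -
    have "B * n + i + (B * r + j) = B * (n + (r + 1)) + (i + j - B)"
      using that assms(4) by (auto simp: algebra_simps)
    then have "(B * n + i + (B * r + j)) mod (B * P) = (B * (n + (r + 1)) + (i + j - B)) mod (B * P)"
      by simp
    also have "(B * (n + (r + 1)) + (i + j - B)) mod (B * P) = B * ((n + (r + 1)) mod P) + (i + j - B)" using that assms(4) by (intro mod_eq) auto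
    finally have "(B * n + i + (B * r + j)) mod (B * P) = B * ((n + (r + 1)) mod P) + (i + j - B)" .
    moreover have "i + j - B < B" using that assms(4) by auto
    ultimately show ?thesis using that mult[of "i + j - B"] mult[of i n] by simp
  qed
  have split: "{..<B} = {..<B-j} \<union> {B-j..<B}" by auto
  have "(\<Sum>m<B*P. F ((m + (B * r + j)) mod (B * P)) * cnj (F m)) =
     (\<Sum>i<B. \<Sum>n<P. F ((B * n + i + (B * r + j)) mod (B * P)) * cnj (F (B * n + i)))"
    by (rule sum_lessThan_mult)
  also have "\<dots> = (\<Sum>i<B-j. \<Sum>n<P. F ((B * n + i + (B * r + j)) mod (B * P)) * cnj (F (B * n + i))) +
     (\<Sum>i\<in>{B-j..<B}. \<Sum>n<P. F ((B * n + i + (B * r + j)) mod (B * P)) * cnj (F (B * n + i)))"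
    by (subst split, rule sum.union_disjoint) auto
  also have "\<dots> = (\<Sum>i<B-j. F (i + j) * cnj (F i)) * S r + (\<Sum>i\<in>{B-j..<B}. F (i + j - B) * cnj (F i)) * S (r + 1)"
    unfolding S_def sum_product using lo hi by simp
  finally have eq: "(\<Sum>m<B*P. F ((m + (B * r + j)) mod (B * P)) * cnj (F m)) =
      (\<Sum>i<B-j. F (i + j) * cnj (F i)) * S r + (\<Sum>i\<in>{B-j..<B}. F (i + j - B) * cnj (F i)) * S (r + 1)" .
  have "norm (\<Sum>i\<in>{B-j..<B}. F (i + j - B) * cnj (F i)) \<le> (\<Sum>i\<in>{B-j..<B}. 1)"
    by (intro sum_norm_le) (simp add: norm_mult one)
  then have "norm (\<Sum>i\<in>{B-j..<B}. F (i + j - B) * cnj (F i)) \<le> real j" using assms(4) by simp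
  then have "norm (\<Sum>m<B*P. F ((m + (B * r + j)) mod (B * P)) * cnj (F m)) \<le>
      norm (\<Sum>i<B-j. F (i + j) * cnj (F i)) * norm (S r) + real j * norm (S (r + 1))"
    unfolding eq by (intro order_trans[OF norm_triangle_ineq]) (simp add: norm_mult mult_right_mono)
  moreover have "norm (\<Sum>m<B*P. F ((m + (B * r + j)) mod (B * P)) * cnj (F m)) =
      real P * (real B * norm (cyclic_corr F (B * P) (B * r + j)))"
    using assms(3,4) by (simp add: cyclic_corr_def norm_divide norm_mult)
  ultimately have "real P * (real B * norm (cyclic_corr F (B * P) (B * r + j))) \<le>
     real P * (norm (\<Sum>i<B-j. F (i + j) * cnj (F i)) * norm (cyclic_corr F P r) +
      real j * norm (cyclic_corr F P (r + 1)))"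
    by (simp add: S algebra_simps)
  then show ?thesis using assms(3) by (subst (asm) mult_le_cancel_left_pos) auto
qed

text \<open>
One strict gain, at lag \<open>1\<close> in each block of \<open>B\<close> lags, suffices for exponential decay on average.
\<close>

lemma sum_cyclic_corr_le:
  assumes mult: "\<And>n i. i < B \<Longrightarrow> F (B * n + i) = F n * F i" and one: "\<And>n. norm (F n) = 1"
    and "B \<ge> 4" "0 < \<eta>" "\<eta> \<le> 1"
    and gain: "norm (\<Sum>i<B-1. F (i + 1) * cnj (F i)) \<le> real B - 1 - \<eta>"
    and "\<rho> \<le> l"
  defines "\<theta> \<equiv> real B - \<eta> / real B"
  shows "(\<Sum>r<B^\<rho>. norm (cyclic_corr F (B ^ l) r)) \<le> (1 + real B / (\<theta> - 1)) * \<theta> ^ \<rho>"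
proof -
  \<comment> \<open>Solves \<open>\<theta> * D = D + B\<close>, so that adding \<open>D\<close>
    turns the inhomogeneous recursion into multiplication by \<open>\<theta>\<close>.\<close>
  define D where "D = real B / (\<theta> - 1)"
  have "\<eta> / real B \<le> 1" using assms by (simp add: field_simps)
  then have \<theta>: "\<theta> > 1" unfolding \<theta>_def using assms(3) by linarith
  have D: "\<theta> * D = D + real B" "D \<ge> 0" using \<theta> by (auto simp: D_def field_simps)
  \<comment> \<open>The trivial bounds \<open>B - j\<close> by the number of terms, lowered by
    \<open>\<eta>\<close> at the one lag with a gain.\<close>
  define c where "c j = (if j = 1 then real B - 1 - \<eta> else real B - real j)" for j :: nat
  have c: "norm (\<Sum>i<B-j. F (i + j) * cnj (F i)) \<le> c j" if "j < B" for j
  proof (cases "j = 1")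
    case False
    have "norm (\<Sum>i<B-j. F (i + j) * cnj (F i)) \<le> (\<Sum>i<B-j. 1)"
      by (intro sum_norm_le) (simp add: norm_mult one)
    then show ?thesis using False that by (simp add: c_def)
  qed (use gain in \<open>simp add: c_def\<close>)
  \<comment> \<open>Without the gain the total would be \<open>B * B\<close>; after division by
    \<open>B\<close> the deficit is the \<open>\<eta> / B\<close> in
    \<open>\<theta>\<close>.\<close>
  have sumc: "(\<Sum>j<B. c j) + (\<Sum>j<B. real j) = real B * real B - \<eta>"
  proof -
    have "(\<Sum>j<B. c j) + (\<Sum>j<B. real j) = (\<Sum>j<B. real B - (if j = 1 then \<eta> else 0))"
      unfolding sum.distrib[symmetric] by (intro sum.cong) (auto simp: c_def)
    also have "\<dots> = real B * real B - (\<Sum>j<B. if j = 1 then \<eta> else 0)"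
      by (simp add: sum_subtractf)
    also have "(\<Sum>j<B. if j = 1 then \<eta> else 0) = \<eta>"
      using assms(3) by (simp add: sum.delta)
    finally show ?thesis .
  qed
  have "(\<Sum>r<B^\<rho>. norm (cyclic_corr F (B ^ l) r)) + D \<le> (1 + D) * \<theta> ^ \<rho>"
    using \<open>\<rho> \<le> l\<close>
  proof (induction \<rho> arbitrary: l)
    case 0
    have "norm (cyclic_corr F (B ^ l) 0) \<le> 1"
      using norm_cyclic_corr_le_1[of F] one by blast
    then show ?case by simp
  next
    case (Suc \<rho>)
    then obtain k where l: "l = Suc k" "\<rho> \<le> k" by (cases l) auto
    define G where "G r = norm (cyclic_corr F (B ^ k) r)" for r
    define A where "A = (\<Sum>r<B^\<rho>. G r)"
    have A: "A + D \<le> (1 + D) * \<theta> ^ \<rho>" unfolding A_def G_def by (rule Suc.IH[OF l(2)])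
    \<comment> \<open>The lags \<open>r + 1\<close> run one past the range; that extra correlation
      costs 1 and is the source of the additive term in the recursion.\<close>
    have shift: "(\<Sum>r<B^\<rho>. G (r + 1)) \<le> A + 1"
    proof -
      have "G 0 + (\<Sum>r<B^\<rho>. G (r + 1)) = (\<Sum>r<Suc (B^\<rho>). G r)"
        by (subst sum.lessThan_Suc_shift) simp
      also have "\<dots> = A + G (B^\<rho>)" by (simp add: A_def)
      also have "\<dots> \<le> A + 1" unfolding G_def using norm_cyclic_corr_le_1[of F] one by simp
      finally have "G 0 + (\<Sum>r<B^\<rho>. G (r + 1)) \<le> A + 1" .
      moreover have "G 0 \<ge> 0" by (simp add: G_def)
      ultimately show ?thesis by linarith
    qed
    have sj: "0 \<le> (\<Sum>j<B. real j)" "(\<Sum>j<B. real j) \<le> real B * real B"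
    proof -
      have "(\<Sum>j<B. real j) \<le> (\<Sum>j<B. real B)" by (intro sum_mono) auto
      then show "(\<Sum>j<B. real j) \<le> real B * real B" by simp
    qed (simp add: sum_nonneg)
    have "real B * (\<Sum>r<B^Suc \<rho>. norm (cyclic_corr F (B ^ l) r)) =
        (\<Sum>j<B. \<Sum>r<B^\<rho>. real B * norm (cyclic_corr F (B * B ^ k) (B * r + j)))"
      unfolding l power_Suc sum_lessThan_mult by (simp add: sum_distrib_left)
    also have "\<dots> \<le> (\<Sum>j<B. \<Sum>r<B^\<rho>. c j * G r + real j * G (r + 1))"
    proof (intro sum_mono)
      fix j r assume "j \<in> {..<B}"
      then have j: "j < B" by simp
      have "real B * norm (cyclic_corr F (B * B ^ k) (B * r + j)) \<le>
        norm (\<Sum>i<B-j. F (i + j) * cnj (F i)) * norm (cyclic_corr F (B ^ k) r) + real j * norm (cyclic_corr F (B ^ k) (r + 1))"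
        by (rule cyclic_corr_mult_le) (use mult one j in auto)
      also have "\<dots> \<le> c j * G r + real j * G (r + 1)"
        unfolding G_def using c[OF j] by (intro add_mono mult_right_mono) auto
      finally show "real B * norm (cyclic_corr F (B * B ^ k) (B * r + j)) \<le> c j * G r + real j * G (r + 1)" .
    qed
    also have "\<dots> = (\<Sum>j<B. c j) * A + (\<Sum>j<B. real j) * (\<Sum>r<B^\<rho>. G (r + 1))"
      unfolding A_def by (simp add: sum.distrib sum_product)
    also have "\<dots> \<le> (\<Sum>j<B. c j) * A + (\<Sum>j<B. real j) * (A + 1)"
      by (intro add_left_mono mult_left_mono shift sj)
    also have "\<dots> = ((\<Sum>j<B. c j) + (\<Sum>j<B. real j)) * A + (\<Sum>j<B. real j)" by (simp add: algebra_simps)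
    also have "\<dots> \<le> (real B * real B - \<eta>) * A + real B * real B"
      unfolding sumc using sj by simp
    also have "\<dots> = real B * (\<theta> * A + real B)"
      using assms(3) by (simp add: \<theta>_def field_simps)
    finally have "(\<Sum>r<B^Suc \<rho>. norm (cyclic_corr F (B ^ l) r)) \<le> \<theta> * A + real B"
      using assms(3) by (subst (asm) mult_le_cancel_left_pos) auto
    then have "(\<Sum>r<B^Suc \<rho>. norm (cyclic_corr F (B ^ l) r)) + D \<le> \<theta> * (A + D)"
      using D by (simp add: algebra_simps)
    also have "\<dots> \<le> \<theta> * ((1 + D) * \<theta> ^ \<rho>)" using A \<theta> by (intro mult_left_mono) auto
    finally show ?case by (simp add: mult_ac)
  qed
  then show ?thesis using D unfolding D_def by linarith
qed

definition digit_char :: "nat \<Rightarrow> real \<Rightarrow> nat \<Rightarrow> complex" where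
  "digit_char q \<alpha> n = unit_exp (\<alpha> * real (digit_sum q n))"

lemma norm_digit_char [simp]: "norm (digit_char q \<alpha> n) = 1"
  by (simp add: digit_char_def)

lemma digit_char_power_mult_add:
  assumes "q \<ge> 2" "i < q ^ l"
  shows "digit_char q \<alpha> (q ^ l * n + i) = digit_char q \<alpha> n * digit_char q \<alpha> i"
  by (simp add: digit_char_def digit_sum_power_mult_add[OF assms] distrib_left unit_exp_add)

text \<open>Parallelogram law for \<open>1\<close> and \<open>z\<close>.\<close>

lemma norm_1_plus_unit_less_2:
  fixes z :: complex
  assumes "norm z = 1" "z \<noteq> 1"
  shows "norm (1 + z) < 2"
proof (rule ccontr)
  assume "\<not> norm (1 + z) < 2"
  then have "norm (1 + z) ^ 2 \<ge> 2 ^ 2" by (intro power_mono) auto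
  moreover have "norm (1 + z) ^ 2 + norm (1 - z) ^ 2 = 2 * (1 + norm z ^ 2)"
    unfolding cmod_power2 by (simp add: power2_eq_square algebra_simps)
  moreover have "norm (1 - z) ^ 2 > 0" using assms by auto
  ultimately show False using assms(1) by simp
qed

text \<open>A block of one digit shows no gain at lag 1: its neighbouring pairs all have phase
  \<open>unit_exp \<alpha>\<close>. The first carry, from \<open>q - 1\<close> to \<open>q\<close>,
  is visible in a block of two digits, hence the base \<open>q^2\<close>. It contributes
  \<open>unit_exp \<alpha> * z\<close>, and \<open>z\<close> differs from 1 exactly because
  \<open>(q - 1) * \<alpha>\<close> is not an integer.\<close>

lemma sum_digit_char_corr_le:
  assumes "q \<ge> 2" "real (q - 1) * \<alpha> \<notin> \<int>"
  shows "\<exists>\<nu><1. \<exists>C\<ge>0. \<forall>\<rho> l. \<rho> \<le> l \<longrightarrow>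
    (\<Sum>r<(q\<^sup>2)^\<rho>. norm (cyclic_corr (digit_char q \<alpha>) ((q\<^sup>2) ^ l) r)) \<le> C * real ((q\<^sup>2)^\<rho>) powr \<nu>"
proof -
  define F where "F = digit_char q \<alpha>"
  define B where "B = q\<^sup>2"
  define z where "z = unit_exp (- (real (q - 1) * \<alpha>))"
  define \<eta> where "\<eta> = min 1 (2 - norm (1 + z))"
  have "z \<noteq> 1" unfolding z_def unit_exp_eq_1_iff using assms(2) by simp
  then have \<eta>: "0 < \<eta>" "\<eta> \<le> 1" "norm (1 + z) \<le> 2 - \<eta>"
    using norm_1_plus_unit_less_2[of z] by (auto simp: \<eta>_def z_def)
  have B: "B \<ge> 4" using power_mono[OF assms(1), of 2] by (simp add: B_def)
  have qB: "q - 1 < B - 1" using assms(1) by (simp add: B_def power2_eq_square)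
      (metis One_nat_def Suc_1 Suc_leD diff_less_mono less_eq_Suc_le n_less_m_mult_n order_less_le_trans zero_less_one)
  have one: "norm (F n) = 1" for n by (simp add: F_def)
  have gain: "norm (\<Sum>i<B-1. F (i + 1) * cnj (F i)) \<le> real B - 1 - \<eta>"
  proof -
    have F0: "F (0 + 1) * cnj (F 0) = unit_exp \<alpha>"
      using digit_sum_mult_add[of q 1 0] assms(1) by (simp add: F_def digit_char_def)
    have F1: "F (q - 1 + 1) * cnj (F (q - 1)) = unit_exp \<alpha> * z"
    proof -
      have "digit_sum q (q - 1) = q - 1" using digit_sum_mult_add[of q "q - 1" 0] assms(1) by simp
      moreover have "digit_sum q q = 1" using digit_sum_mult_add[of q 0 1] digit_sum_mult_add[of q 1 0] assms(1) by simp
      ultimately show ?thesis using assms(1)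
        by (simp add: F_def digit_char_def cnj_unit_exp z_def mult.commute)
    qed
    \<comment> \<open>The terms at \<open>0\<close> and \<open>q - 1\<close> combine to a multiple
      of \<open>1 + z\<close>; the other \<open>B - 3\<close> are bounded trivially.\<close>
    have sub: "{..<B-1} = insert 0 (insert (q - 1) ({..<B-1} - {0, q - 1}))"
      using qB by auto
    have "(\<Sum>i<B-1. F (i + 1) * cnj (F i)) = unit_exp \<alpha> * (1 + z) +
        (\<Sum>i\<in>{..<B-1} - {0, q - 1}. F (i + 1) * cnj (F i))"
      apply (subst sub)
      apply (subst sum.insert)
        apply simp
       using assms(1) apply simp
      apply (subst sum.insert)
        apply simp
       apply simp
      unfolding F0 F1 by (simp add: algebra_simps)
    also have "norm \<dots> \<le> norm (1 + z) + norm (\<Sum>i\<in>{..<B-1} - {0, q - 1}. F (i + 1) * cnj (F i))"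
      by (rule order_trans[OF norm_triangle_ineq]) (simp add: norm_mult)
    also have "norm (\<Sum>i\<in>{..<B-1} - {0, q - 1}. F (i + 1) * cnj (F i)) \<le> (\<Sum>i\<in>{..<B-1} - {0, q - 1}. 1)"
      by (intro sum_norm_le) (simp add: norm_mult one)
    also have "\<dots> = real (card ({..<B-1} - {0, q - 1}))" by simp
    also have "card ({..<B-1} - {0, q - 1}) = (B - 1) - 2"
      using qB assms(1) by (subst card_Diff_subset) auto
    also have "real (B - 1 - 2) = real B - 3" using B by simp
    finally show ?thesis using \<eta>(3) by linarith
  qed
  define \<theta> where "\<theta> = real B - \<eta> / real B"
  have "\<eta> / real B \<le> 1" using \<eta> B by (simp add: field_simps)
  then have \<theta>: "\<theta> > 1" unfolding \<theta>_def using B by linarith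
  have \<theta>_less: "\<theta> < real B" using B \<eta> by (simp add: \<theta>_def)
  \<comment> \<open>Turns \<open>\<theta> ^ \<rho>\<close> into a power of the number
    \<open>B ^ \<rho>\<close> of lags; it is below 1 since \<open>\<theta> < B\<close>.\<close>
  define \<nu> where "\<nu> = log (real B) \<theta>"
  have "\<nu> < 1" using \<theta> \<theta>_less by (simp add: \<nu>_def)
  moreover have "1 + real B / (\<theta> - 1) \<ge> 0" using \<theta> by simp
  moreover have "(\<Sum>r<B^\<rho>. norm (cyclic_corr F (B ^ l) r)) \<le> (1 + real B / (\<theta> - 1)) * real (B^\<rho>) powr \<nu>"
    if "\<rho> \<le> l" for \<rho> l
  proof -
    have "real (B ^ \<rho>) powr \<nu> = (real B powr \<nu>) ^ \<rho>"
      using B by (simp add: powr_powr mult.commute flip: powr_realpow)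
    also have "real B powr \<nu> = \<theta>" using \<theta> B by (simp add: \<nu>_def)
    finally show ?thesis
      using sum_cyclic_corr_le[OF _ one B \<eta>(1,2) gain that] digit_char_power_mult_add[OF assms(1), of _ 2]
      by (simp add: \<theta>_def F_def B_def)
  qed
  ultimately show ?thesis unfolding F_def B_def by blast
qed

text \<open>When the addition does not carry past position \<open>l\<close>, the higher digits of
  \<open>m\<close> and \<open>m + r\<close> are the same and their factors cancel.\<close>

lemma digit_char_shift:
  assumes "q \<ge> 2" "m mod q ^ l + r < q ^ l"
  shows "digit_char q \<alpha> (m + r) * cnj (digit_char q \<alpha> m) =
    digit_char q \<alpha> ((m + r) mod q ^ l) * cnj (digit_char q \<alpha> (m mod q ^ l))"
proof -
  define n i where "n = m div q ^ l" and "i = m mod q ^ l"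
  have i: "i < q ^ l" "i + r < q ^ l" using assms by (auto simp: i_def)
  have m: "m = q ^ l * n + i" "m + r = q ^ l * n + (i + r)" by (simp_all add: n_def i_def)
  have "(m + r) mod q ^ l = i + r" unfolding m(2) using i by simp
  moreover have "digit_char q \<alpha> n * cnj (digit_char q \<alpha> n) = 1"
    by (simp flip: complex_norm_square)
  moreover have "digit_char q \<alpha> (m + r) * cnj (digit_char q \<alpha> m) =
     (digit_char q \<alpha> n * cnj (digit_char q \<alpha> n)) * (digit_char q \<alpha> (i + r) * cnj (digit_char q \<alpha> i))"
    unfolding m(2) digit_char_power_mult_add[OF assms(1) i(2)]
    by (subst m(1), subst digit_char_power_mult_add[OF assms(1) i(1)]) (simp add: mult_ac)
  ultimately show ?thesis by (simp add: i_def)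
qed

section \<open>Counting carries; sums over complete periods\<close>

lemma card_residue_class_le:
  assumes "P > 0"
  shows "card {m\<in>{a..<a+L}. m mod P = t} \<le> L div P + 1"
proof -
  have "card {m\<in>{a..<a+L}. m mod P = t} \<le> card {0..L div P}"
  proof (rule card_inj_on_le[of "\<lambda>m. (m - a) div P"])
    show "inj_on (\<lambda>m. (m - a) div P) {m\<in>{a..<a+L}. m mod P = t}"
    proof (rule inj_onI)
      fix m m' assume *: "m \<in> {m\<in>{a..<a+L}. m mod P = t}" "m' \<in> {m\<in>{a..<a+L}. m mod P = t}"
        and d: "(m - a) div P = (m' - a) div P"
      have "[(m - a) + a = (m' - a) + a] (mod P)" using * by (auto simp: cong_def)
      then have "(m - a) mod P = (m' - a) mod P" unfolding cong_add_rcancel_nat by (simp add: cong_def)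
      then have "m - a = m' - a" using d by (metis div_mult_mod_eq)
      then show "m = m'" using * by auto
    qed
    show "(\<lambda>m. (m - a) div P) ` {m\<in>{a..<a+L}. m mod P = t} \<subseteq> {0..L div P}"
      by (auto intro!: div_le_mono)
  qed simp
  then show ?thesis by simp
qed

text \<open>A carry forces \<open>m\<close> into one of the last \<open>r\<close> residue classes
  modulo \<open>P\<close>.\<close>

lemma card_mod_carry_le:
  assumes "P > 0"
  shows "real (card {m\<in>{a..<a+L}. P \<le> m mod P + r}) \<le> real r * (real L / real P + 1)"
proof -
  have "{m\<in>{a..<a+L}. P \<le> m mod P + r} \<subseteq> (\<Union>t\<in>{P-r..<P}. {m\<in>{a..<a+L}. m mod P = t})"
    using assms by auto
  then have "card {m\<in>{a..<a+L}. P \<le> m mod P + r} \<le> card (\<Union>t\<in>{P-r..<P}. {m\<in>{a..<a+L}. m mod P = t})"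
    by (intro card_mono) auto
  also have "\<dots> \<le> (\<Sum>t\<in>{P-r..<P}. card {m\<in>{a..<a+L}. m mod P = t})"
    by (rule card_UN_le) simp
  also have "\<dots> \<le> (\<Sum>t\<in>{P-r..<P}. L div P + 1)"
    by (intro sum_mono card_residue_class_le assms)
  also have "\<dots> = (P - (P - r)) * (L div P + 1)" by simp
  also have "\<dots> \<le> r * (L div P + 1)" by (intro mult_le_mono1) simp
  finally have "real (card {m\<in>{a..<a+L}. P \<le> m mod P + r}) \<le> real (r * (L div P + 1))"
    by (simp only: of_nat_le_iff)
  also have "\<dots> = real r * (real (L div P) + 1)" by (simp add: algebra_simps)
  also have "\<dots> \<le> real r * (real L / real P + 1)"
    by (intro mult_left_mono add_right_mono of_nat_div_le_of_nat) auto
  finally show ?thesis .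
qed

text \<open>Two ways to use complete periods. The first bound gives up \<open>g\<close> and keeps
  the oscillation of \<open>y\<close> along each class modulo \<open>Q\<close>; the second, without
  a twist, keeps the cancellation of \<open>g\<close> over one period. The incomplete last period
  costs at most \<open>Q\<close> in both.\<close>

lemma sum_periodic_mult_le:
  fixes g y :: "nat \<Rightarrow> complex"
  assumes per: "\<And>m k. g (m + Q * k) = g m" and g: "\<And>m. norm (g m) \<le> 1"
    and y: "\<And>m. norm (y m) \<le> 1" and "Q > 0"
  shows "norm (\<Sum>m\<in>{a..<a+n}. g m * y m) \<le>
    real Q + (\<Sum>b<Q. norm (\<Sum>k<n div Q. y (a + b + Q * k)))"
    and "norm (\<Sum>m\<in>{a..<a+n}. g m) \<le> real Q + real n / real Q * norm (\<Sum>b<Q. g (a + b))"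
proof -
  define K where "K = n div Q"
  have K: "Q * K \<le> n" "n - Q * K < Q"
    using assms(4) by (auto simp: K_def minus_mult_div_eq_mod)
  have main: "norm (\<Sum>m\<in>{a..<a+n}. g m * w m) \<le>
     real Q + norm (\<Sum>b<Q. g (a + b) * (\<Sum>k<K. w (a + b + Q * k)))" if w: "\<And>m. norm (w m) \<le> 1" for w :: "nat \<Rightarrow> complex"
  proof -
    have "(\<Sum>m\<in>{a..<a+n}. g m * w m) = (\<Sum>m<n. g (a + m) * w (a + m))"
      by (rule sum.reindex_bij_witness[of _ "\<lambda>m. a + m" "\<lambda>m. m - a"]) auto
    also have "\<dots> = (\<Sum>m<Q*K. g (a + m) * w (a + m)) + (\<Sum>m\<in>{Q*K..<n}. g (a + m) * w (a + m))"
    proof -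
      have "{..<n} = {..<Q*K} \<union> {Q*K..<n}" using K by auto
      moreover have "{..<Q*K} \<inter> {Q*K..<n} = {}" by auto
      ultimately show ?thesis by (simp only: sum.union_disjoint[OF finite_lessThan finite_atLeastLessThan])
    qed
    also have "(\<Sum>m<Q*K. g (a + m) * w (a + m)) = (\<Sum>b<Q. g (a + b) * (\<Sum>k<K. w (a + b + Q * k)))"
      unfolding sum_lessThan_mult sum_distrib_left
    proof (intro sum.cong refl)
      fix b k
      show "g (a + (Q * k + b)) * w (a + (Q * k + b)) = g (a + b) * w (a + b + Q * k)"
        using per[of "a + b" k] by (simp add: add_ac)
    qed
    finally have eq: "(\<Sum>m\<in>{a..<a+n}. g m * w m) =
       (\<Sum>b<Q. g (a + b) * (\<Sum>k<K. w (a + b + Q * k))) + (\<Sum>m\<in>{Q*K..<n}. g (a + m) * w (a + m))" .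
    have "norm (\<Sum>m\<in>{Q*K..<n}. g (a + m) * w (a + m)) \<le> (\<Sum>m\<in>{Q*K..<n}. 1)"
      by (intro sum_norm_le) (simp add: norm_mult mult_le_one g w)
    also have "\<dots> \<le> real Q" using K(2) by simp
    finally show ?thesis
      unfolding eq by (intro order_trans[OF norm_triangle_ineq]) simp
  qed
  have "norm (\<Sum>b<Q. g (a + b) * (\<Sum>k<K. y (a + b + Q * k))) \<le> (\<Sum>b<Q. norm (\<Sum>k<K. y (a + b + Q * k)))"
    by (intro sum_norm_le) (simp add: norm_mult mult_left_le_one_le g)
  then show "norm (\<Sum>m\<in>{a..<a+n}. g m * y m) \<le> real Q + (\<Sum>b<Q. norm (\<Sum>k<n div Q. y (a + b + Q * k)))"
    using main[of y, OF y] by (simp add: K_def)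
  have "norm (\<Sum>m\<in>{a..<a+n}. g m) \<le> real Q + norm (\<Sum>b<Q. g (a + b) * of_nat K)"
    using main[of "\<lambda>_. 1"] by simp
  also have "norm (\<Sum>b<Q. g (a + b) * of_nat K) = real K * norm (\<Sum>b<Q. g (a + b))"
    by (simp add: norm_mult flip: sum_distrib_right)
  also have "\<dots> \<le> real n / real Q * norm (\<Sum>b<Q. g (a + b))"
    unfolding K_def by (intro mult_right_mono of_nat_div_le_of_nat) auto
  finally show "norm (\<Sum>m\<in>{a..<a+n}. g m) \<le> real Q + real n / real Q * norm (\<Sum>b<Q. g (a + b))" by simp
qed

text \<open>Chinese remainder theorem: \<open>h\<close> is injective between sets of the same size.
  The offset \<open>a\<close> is carried along because blocks need not start at a multiple of the
  period.\<close>

lemma sum_mod_coprime_product: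
  fixes g1 g2 :: "nat \<Rightarrow> 'a::comm_semiring_1"
  assumes "coprime P1 P2" "P1 > 0" "P2 > 0"
  shows "(\<Sum>b<P1*P2. g1 ((a + b) mod P1) * g2 ((a + b) mod P2)) = (\<Sum>i<P1. g1 i) * (\<Sum>j<P2. g2 j)"
proof -
  define h where "h b = ((a + b) mod P1, (a + b) mod P2)" for b
  have inj: "inj_on h {..<P1*P2}"
  proof (rule inj_onI)
    fix b b' assume *: "b \<in> {..<P1*P2}" "b' \<in> {..<P1*P2}" "h b = h b'"
    then have "[a + b = a + b'] (mod P1)" "[a + b = a + b'] (mod P2)"
      by (auto simp: h_def cong_def)
    then have "[b = b'] (mod P1)" "[b = b'] (mod P2)" by (simp_all only: cong_add_lcancel_nat)
    then have "[b = b'] (mod P1 * P2)" using assms(1) by (rule coprime_cong_mult_nat)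
    then show "b = b'" using * by (simp add: cong_def)
  qed
  have "h ` {..<P1*P2} = {..<P1} \<times> {..<P2}"
  proof (rule card_subset_eq)
    show "h ` {..<P1*P2} \<subseteq> {..<P1} \<times> {..<P2}" using assms by (auto simp: h_def)
    show "card (h ` {..<P1*P2}) = card ({..<P1} \<times> {..<P2})" by (simp add: card_image[OF inj])
  qed simp
  then have "(\<Sum>(i,j)\<in>{..<P1}\<times>{..<P2}. g1 i * g2 j) = (\<Sum>b<P1*P2. (\<lambda>(i,j). g1 i * g2 j) (h b))"
    using sum.reindex[OF inj, of "\<lambda>(i,j). g1 i * g2 j"] by simp
  then show ?thesis by (simp add: h_def sum_product sum.cartesian_product)
qed

text \<open>Periodic substitute for \<open>F (m + r) * cnj (F m)\<close>: for a digit character,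
  with \<open>P\<close> a power of its base, the two agree unless adding \<open>r\<close> carries
  past \<open>P\<close>.\<close>

definition trunc_corr :: "(nat \<Rightarrow> complex) \<Rightarrow> nat \<Rightarrow> nat \<Rightarrow> nat \<Rightarrow> complex" where
  "trunc_corr F P r m = F ((m + r) mod P) * cnj (F (m mod P))"

lemma norm_trunc_corr_digit_char [simp]: "norm (trunc_corr (digit_char q \<alpha>) P r m) = 1"
  by (simp add: trunc_corr_def norm_mult)

lemma trunc_corr_cong:
  assumes "m mod P = m' mod P"
  shows "trunc_corr F P r m = trunc_corr F P r m'"
  using mod_add_left_eq[of m P r] mod_add_left_eq[of m' P r] assms by (simp add: trunc_corr_def)

lemma sum_trunc_corr: "P > 0 \<Longrightarrow> (\<Sum>m<P. trunc_corr F P r m) = of_nat P * cyclic_corr F P r"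
  by (simp add: trunc_corr_def cyclic_corr_def)

text \<open>Common core of the untwisted and the twisted estimate: \<open>z\<close> is any
  unimodular twist and \<open>E\<close> any bound for the correlations after truncation. Passing to
  the periodic correlations costs the last term, quadratic in \<open>R\<close> because about
  \<open>r\<close> carries per period are counted for every lag below \<open>R\<close>.\<close>

lemma van_der_Corput_digit_char:
  fixes q1 q2 l1 l2 :: nat
  defines "P1 \<equiv> q1 ^ l1" and "P2 \<equiv> q2 ^ l2"
  assumes q: "q1 \<ge> 2" "q2 \<ge> 2" and z: "\<And>m. norm (z m) = 1"
    and E: "\<And>r. r \<in> {1..<R} \<Longrightarrow> norm (\<Sum>m\<in>{a..<a+(L-r)}. (trunc_corr (digit_char q1 \<alpha>1) P1 r m *
        trunc_corr (digit_char q2 \<alpha>2) P2 r m) * (z (m + r) * cnj (z m))) \<le> E r"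
  shows "real R * norm (\<Sum>m\<in>{a..<a+L}. digit_char q1 \<alpha>1 m * digit_char q2 \<alpha>2 m * z m) ^ 2 \<le>
    real (L + R) * (real L + 2 * (\<Sum>r\<in>{1..<R}. E r) + 4 * real R ^ 2 * (real L / real P1 + real L / real P2 + 2))"
proof -
  have P: "P1 > 0" "P2 > 0" using q by (auto simp: P1_def P2_def)
  define u where "u m = digit_char q1 \<alpha>1 m * digit_char q2 \<alpha>2 m * z m" for m
  define g where "g r m = trunc_corr (digit_char q1 \<alpha>1) P1 r m * trunc_corr (digit_char q2 \<alpha>2) P2 r m" for r m
  define X where "X = real L / real P1 + real L / real P2 + 2"
  have "X \<ge> 0" by (simp add: X_def)
  have u: "norm (u m) = 1" for m by (simp add: u_def norm_mult z)
  have corr: "norm (\<Sum>m\<in>{a..<a+L-r}. u (m + r) * cnj (u m)) \<le> E r + 2 * (real R * X)" if r: "r \<in> {1..<R}" for r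
  \<comment> \<open>Beyond \<open>L\<close> the correlation is an empty sum; otherwise
    \<open>a + L - r\<close> may be read as \<open>a + (L - r)\<close>.\<close>
  proof (cases "r \<le> L")
    case True
    define I where "I = {a..<a+(L-r)}"
    define bad where "bad = {m\<in>I. P1 \<le> m mod P1 + r} \<union> {m\<in>I. P2 \<le> m mod P2 + r}"
    have good: "u (m + r) * cnj (u m) = g r m * (z (m + r) * cnj (z m))" if "m \<in> I - bad" for m
    proof -
      have m: "m mod q1 ^ l1 + r < q1 ^ l1" "m mod q2 ^ l2 + r < q2 ^ l2"
        using that by (auto simp: bad_def P1_def P2_def)
      have "u (m + r) * cnj (u m) = (digit_char q1 \<alpha>1 (m + r) * cnj (digit_char q1 \<alpha>1 m)) *
         (digit_char q2 \<alpha>2 (m + r) * cnj (digit_char q2 \<alpha>2 m)) * (z (m + r) * cnj (z m))"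
        by (simp add: u_def mult_ac)
      then show ?thesis
        unfolding digit_char_shift[OF q(1) m(1)] digit_char_shift[OF q(2) m(2)]
        by (simp add: g_def trunc_corr_def P1_def P2_def)
    qed
    have "(\<Sum>m\<in>I. u (m + r) * cnj (u m)) - (\<Sum>m\<in>I. g r m * (z (m + r) * cnj (z m))) =
       (\<Sum>m\<in>I. u (m + r) * cnj (u m) - g r m * (z (m + r) * cnj (z m)))"
      by (simp add: sum_subtractf)
    also have "\<dots> = (\<Sum>m\<in>bad. u (m + r) * cnj (u m) - g r m * (z (m + r) * cnj (z m)))"
      using good by (intro sum.mono_neutral_right) (auto simp: bad_def I_def)
    also have "norm \<dots> \<le> (\<Sum>m\<in>bad. 2)"
      by (intro sum_norm_le order_trans[OF norm_triangle_ineq4]) (simp add: norm_mult u z g_def)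
    also have "\<dots> = 2 * real (card bad)" by simp
    also have "real (card bad) \<le> real (card {m\<in>I. P1 \<le> m mod P1 + r}) + real (card {m\<in>I. P2 \<le> m mod P2 + r})"
      unfolding bad_def of_nat_add[symmetric] of_nat_le_iff by (rule card_Un_le)
    also have "\<dots> \<le> real r * (real (L - r) / real P1 + 1) + real r * (real (L - r) / real P2 + 1)"
      unfolding I_def by (intro add_mono card_mod_carry_le P)
    also have "\<dots> = real r * (real (L - r) / real P1 + real (L - r) / real P2 + 2)" by (simp add: algebra_simps)
    also have "\<dots> \<le> real R * X"
      unfolding X_def using r by (intro mult_mono add_mono divide_right_mono) auto
    finally have "norm ((\<Sum>m\<in>I. u (m + r) * cnj (u m)) - (\<Sum>m\<in>I. g r m * (z (m + r) * cnj (z m)))) \<le> 2 * (real R * X)"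
      by simp
    from order_trans[OF norm_triangle_ineq2 this]
    have "norm (\<Sum>m\<in>I. u (m + r) * cnj (u m)) \<le> norm (\<Sum>m\<in>I. g r m * (z (m + r) * cnj (z m))) + 2 * (real R * X)"
      by simp
    also have "norm (\<Sum>m\<in>I. g r m * (z (m + r) * cnj (z m))) \<le> E r"
      using E[OF r] by (simp add: g_def I_def)
    finally show ?thesis using True by (simp add: I_def)
  next
    case False
    have "E r \<ge> 0" using E[OF r] norm_ge_zero order_trans by blast
    then show ?thesis using False \<open>X \<ge> 0\<close> by simp
  qed
  have "real R * norm (\<Sum>m\<in>{a..<a+L}. u m) ^ 2 \<le> real (L + R) *
    ((\<Sum>m\<in>{a..<a+L}. norm (u m) ^ 2) +
     2 * (\<Sum>r\<in>{1..<R}. norm (\<Sum>m\<in>{a..<a+L-r}. u (m + r) * cnj (u m))))"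
    by (rule van_der_Corput)
  also have "\<dots> \<le> real (L + R) * (real L + 2 * (\<Sum>r\<in>{1..<R}. E r + 2 * (real R * X)))"
    using corr by (intro mult_left_mono add_mono sum_mono) (simp_all add: u)
  also have "\<dots> \<le> real (L + R) * (real L + 2 * (\<Sum>r\<in>{1..<R}. E r) + 4 * real R ^ 2 * X)"
  proof -
    have "(\<Sum>r\<in>{1..<R}. 2 * (real R * X)) \<le> 2 * real R ^ 2 * X"
    proof -
      have "(\<Sum>r\<in>{1..<R}. 2 * (real R * X)) = real (R - 1) * (2 * (real R * X))" by simp
      also have "\<dots> \<le> real R * (2 * (real R * X))" using \<open>X \<ge> 0\<close> by (intro mult_right_mono) auto
      finally show ?thesis by (simp add: power2_eq_square mult_ac)
    qed
    then show ?thesis unfolding sum.distrib by (intro mult_left_mono) (auto simp: algebra_simps)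
  qed
  finally show ?thesis unfolding u_def X_def .
qed

text \<open>Twist 1: over a full period \<open>P1 * P2\<close> the truncated correlation factors
  into two cyclic correlations, and an incomplete period costs \<open>P1 * P2\<close> for each lag.
  The sum is extended to lag 0 to match the form of the correlation estimate.\<close>

lemma digit_char_mean_square_le:
  fixes q1 q2 l1 l2 :: nat
  defines "P1 \<equiv> q1 ^ l1" and "P2 \<equiv> q2 ^ l2"
  assumes q: "q1 \<ge> 2" "q2 \<ge> 2" "coprime q1 q2"
  shows "real R * norm (\<Sum>m\<in>{a..<a+L}. digit_char q1 \<alpha>1 m * digit_char q2 \<alpha>2 m) ^ 2 \<le>
    real (L + R) * (real L + 2 * (real R * (real P1 * real P2)) +
      2 * real L * (\<Sum>r<R. norm (cyclic_corr (digit_char q1 \<alpha>1) P1 r) * norm (cyclic_corr (digit_char q2 \<alpha>2) P2 r))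
      + 4 * real R ^ 2 * (real L / real P1 + real L / real P2 + 2))"
proof -
  have P: "P1 > 0" "P2 > 0" using q by (auto simp: P1_def P2_def)
  define c where "c r = norm (cyclic_corr (digit_char q1 \<alpha>1) P1 r) * norm (cyclic_corr (digit_char q2 \<alpha>2) P2 r)" for r
  define E where "E r = real P1 * real P2 + real L * c r" for r
  have "norm (\<Sum>m\<in>{a..<a+(L-r)}. (trunc_corr (digit_char q1 \<alpha>1) P1 r m *
        trunc_corr (digit_char q2 \<alpha>2) P2 r m)) \<le> E r" for r
  proof -
    define g where "g m = trunc_corr (digit_char q1 \<alpha>1) P1 r m * trunc_corr (digit_char q2 \<alpha>2) P2 r m" for m
    have per: "g (m + P1 * P2 * k) = g m" for m k
    proof -
      have "m + P1 * P2 * k = m + P1 * (P2 * k)" "m + P1 * P2 * k = m + P2 * (P1 * k)"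
        by algebra+
      then have "(m + P1 * P2 * k) mod P1 = m mod P1" "(m + P1 * P2 * k) mod P2 = m mod P2"
        by (metis mod_mult_self2)+
      then show ?thesis
        unfolding g_def by (intro arg_cong2[where f = "(*)"] trunc_corr_cong)
    qed
    have 1: "norm (\<Sum>m\<in>{a..<a+(L-r)}. g m) \<le> real (P1 * P2) + real (L - r) / real (P1 * P2) * norm (\<Sum>b<P1*P2. g (a + b))"
    proof (rule sum_periodic_mult_le(2)[where y = "\<lambda>_. 1"])
      show "g (m + P1 * P2 * k) = g m" for m k by (rule per)
    qed (use P in \<open>simp_all add: g_def norm_mult\<close>)
    have "(\<Sum>b<P1*P2. g (a + b)) = (\<Sum>b<P1*P2. trunc_corr (digit_char q1 \<alpha>1) P1 r ((a + b) mod P1) *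
        trunc_corr (digit_char q2 \<alpha>2) P2 r ((a + b) mod P2))"
      unfolding g_def by (intro sum.cong refl arg_cong2[where f = "(*)"] trunc_corr_cong) simp_all
    also have "\<dots> = (\<Sum>i<P1. trunc_corr (digit_char q1 \<alpha>1) P1 r i) * (\<Sum>j<P2. trunc_corr (digit_char q2 \<alpha>2) P2 r j)"
      using q P by (intro sum_mod_coprime_product) (auto simp: P1_def P2_def)
    finally have "norm (\<Sum>b<P1*P2. g (a + b)) = real (P1 * P2) * c r"
      using P by (simp add: sum_trunc_corr norm_mult c_def)
    then have "real (L - r) / real (P1 * P2) * norm (\<Sum>b<P1*P2. g (a + b)) = real (L - r) * c r"
      using P by simp
    also have "\<dots> \<le> real L * c r" by (intro mult_right_mono) (auto simp: c_def)
    finally show ?thesis using 1 unfolding g_def E_def by simp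
  qed
  then have "real R * norm (\<Sum>m\<in>{a..<a+L}. digit_char q1 \<alpha>1 m * digit_char q2 \<alpha>2 m * 1) ^ 2 \<le>
    real (L + R) * (real L + 2 * (\<Sum>r\<in>{1..<R}. E r) + 4 * real R ^ 2 * (real L / real P1 + real L / real P2 + 2))"
    using van_der_Corput_digit_char[OF q(1,2), where z = "\<lambda>_. 1" and R = R and a = a and L = L and ?l1.0 = l1 and ?l2.0 = l2 and ?\<alpha>1.0 = \<alpha>1 and ?\<alpha>2.0 = \<alpha>2 and E = E] by (simp add: P1_def P2_def)
  also have "\<dots> \<le> real (L + R) * (real L + (2 * (real R * (real P1 * real P2)) + 2 * real L * (\<Sum>r<R. c r))
      + 4 * real R ^ 2 * (real L / real P1 + real L / real P2 + 2))"
  proof -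
    have "(\<Sum>r\<in>{1..<R}. E r) \<le> (\<Sum>r<R. E r)"
      by (intro sum_mono2) (auto simp: E_def c_def)
    also have "\<dots> = real R * (real P1 * real P2) + real L * (\<Sum>r<R. c r)"
      by (simp add: E_def sum.distrib sum_distrib_left)
    finally show ?thesis by (intro mult_left_mono add_mono) auto
  qed
  finally show ?thesis by (simp add: c_def add.assoc)
qed

section \<open>Digit characters twisted by a power\<close>

text \<open>Convexity of the power with exponent \<open>g - 1\<close>; it makes the derivative of
  the first difference of \<open>x powr g\<close> nondecreasing.\<close>

lemma powr_increment_mono:
  fixes g r x y :: real
  assumes "0 < g" "g < 1" "0 \<le> r" "0 < x" "x \<le> y"
  shows "(x + r) powr (g - 1) - x powr (g - 1) \<le> (y + r) powr (g - 1) - y powr (g - 1)"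
proof (rule DERIV_nonneg_imp_nondecreasing[OF assms(5)])
  fix t assume t: "x \<le> t" "t \<le> y"
  have "((\<lambda>t. (t + r) powr (g - 1) - t powr (g - 1)) has_real_derivative
      (g - 1) * ((t + r) powr (g - 2) - t powr (g - 2))) (at t)"
    using t assms by (auto intro!: derivative_eq_intros simp: algebra_simps)
  moreover have "(t + r) powr (g - 2) \<le> t powr (g - 2)"
    using t assms by (intro powr_mono2') auto
  then have "(g - 1) * ((t + r) powr (g - 2) - t powr (g - 2)) \<ge> 0"
    using assms by (intro mult_nonpos_nonpos) auto
  ultimately show "\<exists>D. ((\<lambda>t. (t + r) powr (g - 1) - t powr (g - 1)) has_real_derivative D) (at t) \<and> 0 \<le> D"
    by blast
qed

text \<open>Two applications of the mean value theorem, in steps \<open>Q\<close> and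
  \<open>r\<close>, turn the mixed second difference into a second derivative at a point between
  \<open>x\<close> and \<open>x + Q + r\<close>. The third part supplies the monotonicity that the
  Kusmin-Landau inequality requires.\<close>

lemma powr_second_difference:
  fixes g r Q :: real
  defines "\<psi> \<equiv> \<lambda>x. (x + r) powr g - x powr g"
  assumes g: "0 < g" "g < 1" and rQ: "0 < r" "0 < Q" and "0 < x"
  shows "g * (1 - g) * r * Q * (x + Q + r) powr (g - 2) \<le> \<psi> x - \<psi> (x + Q)"
    and "\<psi> x - \<psi> (x + Q) \<le> g * (1 - g) * r * Q * x powr (g - 2)"
    and "x \<le> y \<Longrightarrow> \<psi> y - \<psi> (y + Q) \<le> \<psi> x - \<psi> (x + Q)"
proof -
  define \<psi>' where "\<psi>' x = g * ((x + r) powr (g - 1) - x powr (g - 1))" for x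
  have der: "(\<psi> has_real_derivative \<psi>' t) (at t)" if "t > 0" for t
    unfolding \<psi>_def \<psi>'_def using that rQ by (auto intro!: derivative_eq_intros simp: algebra_simps)
  obtain z where z: "x < z" "z < x + Q" "\<psi> (x + Q) - \<psi> x = (x + Q - x) * \<psi>' z"
    using MVT2[of x "x + Q" \<psi> \<psi>'] der assms by (auto simp del: add_diff_cancel_left')
  have "\<exists>w>z. w < z + r \<and> (z + r) powr (g - 1) - z powr (g - 1) = (z + r - z) * ((g - 1) * w powr (g - 2))"
  proof (rule MVT2)
    fix t assume "z \<le> t" "t \<le> z + r"
    then show "((\<lambda>t. t powr (g - 1)) has_real_derivative (g - 1) * t powr (g - 2)) (at t)"
      using z assms by (auto intro!: derivative_eq_intros simp: algebra_simps)
  qed (use rQ in auto)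
  then obtain w where w: "z < w" "w < z + r" "(z + r) powr (g - 1) - z powr (g - 1) = r * ((g - 1) * w powr (g - 2))"
    by auto
  have eq: "\<psi> x - \<psi> (x + Q) = g * (1 - g) * r * Q * w powr (g - 2)"
    using z(3) unfolding \<psi>'_def w(3) by (simp add: algebra_simps)
  have c: "g * (1 - g) * r * Q \<ge> 0" using g rQ by simp
  have w': "0 < w" "x \<le> w" "w \<le> x + Q + r" using w z assms by auto
  show "g * (1 - g) * r * Q * (x + Q + r) powr (g - 2) \<le> \<psi> x - \<psi> (x + Q)"
    unfolding eq using w' g by (intro mult_left_mono c powr_mono2') auto
  show "\<psi> x - \<psi> (x + Q) \<le> g * (1 - g) * r * Q * x powr (g - 2)"
    unfolding eq using w' g assms by (intro mult_left_mono c powr_mono2') auto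
  assume "x \<le> y"
  then show "\<psi> y - \<psi> (y + Q) \<le> \<psi> x - \<psi> (x + Q)"
  proof (rule DERIV_nonpos_imp_nonincreasing)
    fix t assume t: "x \<le> t" "t \<le> y"
    have "((\<lambda>t. \<psi> t - \<psi> (t + Q)) has_real_derivative \<psi>' t - \<psi>' (t + Q)) (at t)"
      using DERIV_shift[of \<psi> "\<psi>' (t + Q)" t Q] der[of t] der[of "t + Q"] t assms(6) rQ
      by (intro derivative_intros) auto
    moreover have "\<psi>' t \<le> \<psi>' (t + Q)"
      unfolding \<psi>'_def using g rQ t assms(6) by (intro mult_left_mono powr_increment_mono) auto
    ultimately show "\<exists>D. ((\<lambda>t. \<psi> t - \<psi> (t + Q)) has_real_derivative D) (at t) \<and> D \<le> 0"
      by (intro exI[of _ "\<psi>' t - \<psi>' (t + Q)"]) auto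
  qed
qed

lemma sum_inverse_le_ln:
  assumes "R \<ge> 1"
  shows "(\<Sum>r\<in>{1..<R}. 1 / real r) \<le> 1 + ln (real R)"
proof -
  have "(\<Sum>r\<in>{1..R}. 1 / real r) \<le> 1 + ln (real R)"
    using assms
  proof (induction R rule: dec_induct)
    case (step n)
    have "ln (real n / real (Suc n)) \<le> real n / real (Suc n) - 1"
      using step by (intro ln_le_minus_one) auto
    also have "\<dots> = - (1 / real (Suc n))" by (simp add: field_simps)
    also have "ln (real n / real (Suc n)) = ln (real n) - ln (real (Suc n))"
      using step by (simp add: ln_div)
    finally show ?case using step by simp
  qed simp
  moreover have "(\<Sum>r\<in>{1..<R}. 1 / real r) \<le> (\<Sum>r\<in>{1..R}. 1 / real r)"
    by (intro sum_mono2) auto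
  ultimately show ?thesis by linarith
qed

text \<open>The size condition keeps all points between \<open>a\<close> and \<open>4 * a\<close>,
  where the second derivative of the phase varies by a factor of at most 16. The condition
  \<open>h * r * Q \<le> a\<close> keeps the phase increments at most 1/2, so that 0 is the only
  integer they can approach.\<close>

lemma norm_sum_unit_exp_powr_progression_le:
  fixes a h r Q :: nat and g :: real
  assumes g: "0 < g" "g < 1" and "1 \<le> h" "1 \<le> r" "1 \<le> Q" "1 \<le> a"
    and size: "a + b + Q * n + Q + r \<le> 4 * a" and hrQ: "h * r * Q \<le> a"
  shows "norm (\<Sum>k<n. unit_exp (real h * (real (a + b + Q * k + r) powr g - real (a + b + Q * k) powr g)))
    \<le> 16 * real a powr (2 - g) / (g * (1 - g) * real r * real Q)"
proof -
  define \<psi> where "\<psi> x = (x + real r) powr g - x powr g" for x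
  define x where "x k = real (a + b + Q * k)" for k
  \<comment> \<open>The first difference \<open>\<psi>\<close> is decreasing and convex, so the
    minus sign makes the increments positive and nonincreasing; conjugation undoes it later.\<close>
  define F where "F k = - (real h * \<psi> (x k))" for k
  define d where "d = real h * (g * (1 - g) * real r * real Q * real a powr (g - 2) / 16)"
  have xS: "x (Suc k) = x k + real Q" for k by (simp add: x_def)
  have diff: "F (Suc k) - F k = real h * (\<psi> (x k) - \<psi> (x k + real Q))" for k
    by (simp add: F_def xS algebra_simps)
  have xa: "real a \<le> x k" for k by (simp add: x_def)
  have x0: "0 < x k" for k using xa[of k] assms by linarith
  have pos: "0 < real r" "0 < real Q" using assms by auto
  have c: "g * (1 - g) * real r * real Q > 0" using g pos by simp
  note sd = powr_second_difference[OF g pos, folded \<psi>_def]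
  have lo: "d \<le> F (Suc k) - F k" if "k \<le> n" for k
  proof -
    have "x k + real Q + real r \<le> real (a + b + Q * n + Q + r)"
      unfolding x_def using that by (simp add: mult_left_mono)
    also have "\<dots> \<le> real (4 * a)" using size by (simp only: of_nat_le_iff)
    finally have le: "x k + real Q + real r \<le> 4 * real a" by simp
    have "real a powr (g - 2) / 16 = (4 powr (-2)) * real a powr (g - 2)" by (simp add: powr_minus powr_numeral)
    also have "\<dots> \<le> 4 powr (g - 2) * real a powr (g - 2)"
      using g by (intro mult_right_mono powr_mono) auto
    also have "\<dots> = (4 * real a) powr (g - 2)" by (simp add: powr_mult)
    also have "\<dots> \<le> (x k + real Q + real r) powr (g - 2)"
      using le g x0[of k] pos by (intro powr_mono2') auto
    finally have "g * (1 - g) * real r * real Q * (real a powr (g - 2) / 16) \<le>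
        g * (1 - g) * real r * real Q * (x k + real Q + real r) powr (g - 2)"
      using c by (intro mult_left_mono) auto
    also have "\<dots> \<le> \<psi> (x k) - \<psi> (x k + real Q)" using sd(1)[OF x0] .
    finally show ?thesis unfolding d_def diff by (intro mult_left_mono) auto
  qed
  have hi: "F (Suc k) - F k \<le> 1 / 2" for k
  proof -
    have "real h * (\<psi> (x k) - \<psi> (x k + real Q)) \<le> real h * (g * (1 - g) * real r * real Q * x k powr (g - 2))"
      by (intro mult_left_mono sd(2)[OF x0]) auto
    also have "\<dots> = (g * (1 - g)) * (real (h * r * Q) * x k powr (g - 2))" by simp
    also have "\<dots> \<le> (1 / 2) * (real a * (1 / real a))"
    proof (intro mult_mono)
      have "0 \<le> (g - 1/2) ^ 2" by simp
      then show "g * (1 - g) \<le> 1 / 2" by (simp add: power2_eq_square algebra_simps)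
      show "real (h * r * Q) \<le> real a" using hrQ by (simp only: of_nat_le_iff)
      have "x k powr (g - 2) \<le> real a powr (g - 2)" using xa g assms by (intro powr_mono2') auto
      also have "\<dots> \<le> real a powr (-1)" using g assms by (intro powr_mono) auto
      also have "\<dots> = 1 / real a" using assms by (simp add: powr_minus field_simps)
      finally show "x k powr (g - 2) \<le> 1 / real a" .
    qed (use g in auto)
    finally show ?thesis unfolding diff using assms by simp
  qed
  have mono: "F (Suc (Suc k)) - F (Suc k) \<le> F (Suc k) - F k" for k
    unfolding diff by (intro mult_left_mono sd(3)[OF x0]) (auto simp: xS)
  have d0: "d > 0" using c assms by (simp add: d_def)
  have "norm (\<Sum>k<n. unit_exp (F k)) \<le> 1 / d"
    by (rule Kusmin_Landau) (use lo hi mono d0 in auto)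
  also have "(\<Sum>k<n. unit_exp (F k)) = cnj (\<Sum>k<n. unit_exp (real h * \<psi> (x k)))"
    by (simp add: F_def cnj_unit_exp)
  finally have "norm (\<Sum>k<n. unit_exp (real h * \<psi> (x k))) \<le> 1 / d" by (simp only: complex_mod_cnj)
  \<comment> \<open>Only \<open>h \<ge> 1\<close> is used, so the bound is uniform in the
    frequency.\<close>
  also have "1 / d \<le> 1 / (g * (1 - g) * real r * real Q * real a powr (g - 2) / 16)"
  proof (rule divide_left_mono)
    have "1 * (g * (1 - g) * real r * real Q * real a powr (g - 2) / 16) \<le> d"
      unfolding d_def using c assms by (intro mult_right_mono) auto
    then show "g * (1 - g) * real r * real Q * real a powr (g - 2) / 16 \<le> d" by simp
    show "0 < d * (g * (1 - g) * real r * real Q * real a powr (g - 2) / 16)"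
      using d0 c assms by (intro mult_pos_pos) auto
  qed simp
  also have "\<dots> = 16 * real a powr (2 - g) / (g * (1 - g) * real r * real Q)"
    using powr_minus[of "real a" "g - 2"] c by (simp add: field_simps)
  finally show ?thesis by (simp add: \<psi>_def x_def)
qed

text \<open>Only the oscillation of the phase is used: each of the \<open>P1 * P2\<close> classes
  contributes a Kusmin-Landau bound proportional to 1 / (r P1 P2), the classes together give 1 / r,
  and the lags add up to the logarithm.\<close>

lemma digit_char_powr_mean_square_le:
  fixes q1 q2 l1 l2 a h R L :: nat and g :: real
  defines "P1 \<equiv> q1 ^ l1" and "P2 \<equiv> q2 ^ l2"
  assumes q: "q1 \<ge> 2" "q2 \<ge> 2" and g: "0 < g" "g < 1"
    and "1 \<le> h" "1 \<le> R" "1 \<le> a"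
    and size: "L + 2 * (P1 * P2) + R \<le> 3 * a" and hRQ: "h * R * (P1 * P2) \<le> a"
  shows "real R * norm (\<Sum>m\<in>{a..<a+L}. digit_char q1 \<alpha>1 m * digit_char q2 \<alpha>2 m * unit_exp (real h * real m powr g)) ^ 2 \<le>
    real (L + R) * (real L + 2 * (real R * (real P1 * real P2)) +
      32 / (g * (1 - g)) * real a powr (2 - g) * (1 + ln (real R))
      + 4 * real R ^ 2 * (real L / real P1 + real L / real P2 + 2))"
proof -
  define Q where "Q = P1 * P2"
  have P: "P1 > 0" "P2 > 0" using q by (auto simp: P1_def P2_def)
  then have Q: "Q \<ge> 1" by (simp add: Q_def Suc_leI)
  define z where "z m = unit_exp (real h * real m powr g)" for m
  define A where "A = 16 / (g * (1 - g)) * real a powr (2 - g)"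
  define E where "E r = real Q + A * (1 / real r)" for r
  have A: "A \<ge> 0" using g by (simp add: A_def)
  have "norm (\<Sum>m\<in>{a..<a+(L-r)}. (trunc_corr (digit_char q1 \<alpha>1) P1 r m *
        trunc_corr (digit_char q2 \<alpha>2) P2 r m) * (z (m + r) * cnj (z m))) \<le> E r" if r: "r \<in> {1..<R}" for r
  proof -
    define G where "G m = trunc_corr (digit_char q1 \<alpha>1) P1 r m * trunc_corr (digit_char q2 \<alpha>2) P2 r m" for m
    define y where "y m = z (m + r) * cnj (z m)" for m
    have per: "G (m + Q * k) = G m" for m k
    proof -
      have "m + Q * k = m + P1 * (P2 * k)" "m + Q * k = m + P2 * (P1 * k)"
        unfolding Q_def by algebra+
      then have "(m + Q * k) mod P1 = m mod P1" "(m + Q * k) mod P2 = m mod P2"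
        by (metis mod_mult_self2)+
      then show ?thesis
        unfolding G_def by (intro arg_cong2[where f = "(*)"] trunc_corr_cong)
    qed
    have 1: "norm (\<Sum>m\<in>{a..<a+(L-r)}. G m * y m) \<le> real Q + (\<Sum>b<Q. norm (\<Sum>k<(L - r) div Q. y (a + b + Q * k)))"
    proof (rule sum_periodic_mult_le(1))
      show "G (m + Q * k) = G m" for m k by (rule per)
    qed (use Q in \<open>simp_all add: G_def y_def z_def norm_mult\<close>)
    have yeq: "y m = unit_exp (real h * (real (m + r) powr g - real m powr g))" for m
      by (simp add: y_def z_def right_diff_distrib unit_exp_diff)
    have inner: "norm (\<Sum>k<(L - r) div Q. y (a + b + Q * k)) \<le> 16 * real a powr (2 - g) / (g * (1 - g) * real r * real Q)"
      if "b < Q" for b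
      unfolding yeq
    proof (rule norm_sum_unit_exp_powr_progression_le)
      have "Q * ((L - r) div Q) \<le> L" by (meson diff_le_self order_trans times_div_less_eq_dividend)
      then show "a + b + Q * ((L - r) div Q) + Q + r \<le> 4 * a"
        using size that r unfolding Q_def[symmetric] by auto
      have "h * r * Q \<le> h * R * Q" using r by (intro mult_le_mono) auto
      then show "h * r * Q \<le> a" using hRQ unfolding Q_def[symmetric] by (rule order_trans)
    qed (use g assms r Q in auto)
    have "(\<Sum>b<Q. norm (\<Sum>k<(L - r) div Q. y (a + b + Q * k))) \<le> (\<Sum>b<Q. 16 * real a powr (2 - g) / (g * (1 - g) * real r * real Q))"
      by (intro sum_mono inner) auto
    also have "\<dots> = A * (1 / real r)" using Q by (simp add: A_def)
    finally show ?thesis using 1 unfolding E_def G_def y_def by linarith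
  qed
  then have "real R * norm (\<Sum>m\<in>{a..<a+L}. digit_char q1 \<alpha>1 m * digit_char q2 \<alpha>2 m * z m) ^ 2 \<le>
    real (L + R) * (real L + 2 * (\<Sum>r\<in>{1..<R}. E r) + 4 * real R ^ 2 * (real L / real P1 + real L / real P2 + 2))"
    using van_der_Corput_digit_char[OF q(1,2), where z = z and R = R and a = a and L = L and ?l1.0 = l1 and ?l2.0 = l2
      and ?\<alpha>1.0 = \<alpha>1 and ?\<alpha>2.0 = \<alpha>2 and E = E] by (simp add: P1_def P2_def z_def)
  also have "\<dots> \<le> real (L + R) * (real L + (2 * (real R * (real P1 * real P2)) + 2 * A * (1 + ln (real R)))
      + 4 * real R ^ 2 * (real L / real P1 + real L / real P2 + 2))"
  proof -
    have "(\<Sum>r\<in>{1..<R}. E r) = real (R - 1) * real Q + A * (\<Sum>r\<in>{1..<R}. 1 / real r)"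
      by (simp add: E_def sum.distrib sum_distrib_left)
    also have "\<dots> \<le> real R * real Q + A * (1 + ln (real R))"
      using sum_inverse_le_ln[OF \<open>1 \<le> R\<close>] A by (intro add_mono mult_left_mono mult_right_mono) auto
    finally show ?thesis by (intro mult_left_mono add_mono) (auto simp: Q_def algebra_simps)
  qed
  finally show ?thesis by (simp add: z_def A_def add.assoc mult.assoc)
qed

section \<open>A nonnegative trigonometric majorant\<close>

text \<open>Orthogonality of the additive characters modulo \<open>N\<close>; it serves both the
  grid averages of the kernel and the detection of residue classes.\<close>

lemma sum_unit_exp_grid:
  fixes d :: int
  assumes "N > 0"
  shows "(\<Sum>j<N. unit_exp (- (of_int d * (real j / real N)))) = (if int N dvd d then of_nat N else 0)"
proof -
  define w where "w = unit_exp (- (of_int d / real N))"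
  have wj: "unit_exp (- (of_int d * (real j / real N))) = w ^ j" for j
    unfolding w_def unit_exp_of_nat_mult[symmetric] by (simp add: mult_ac)
  show ?thesis
  proof (cases "int N dvd d")
    case True
    then obtain e where "d = int N * e" by auto
    then have "- (of_int d / real N) = of_int (- e)" using assms by simp
    then have "w = 1" unfolding w_def by (simp only: unit_exp_of_int)
    then show ?thesis using True unfolding wj by simp
  next
    case False
    have "w \<noteq> 1"
    proof
      assume "w = 1"
      then have "- (of_int d / real N) \<in> \<int>" unfolding w_def unit_exp_eq_1_iff .
      then have "of_int d / real N \<in> \<int>" by simp
      then obtain e where "of_int d / real N = of_int e" by (auto elim: Ints_cases)
      then have "of_int d = (of_int (e * int N) :: real)" using assms by (simp add: field_simps)
      then have "d = e * int N" by (simp only: of_int_eq_iff)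
      then show False using False by simp
    qed
    moreover have "w ^ N = 1"
    proof -
      have "w ^ N = unit_exp (of_int (- d))"
        unfolding w_def unit_exp_of_nat_mult[symmetric] using assms by simp
      then show ?thesis by (simp only: unit_exp_of_int)
    qed
    ultimately show ?thesis using False unfolding wj by (simp add: geometric_sum)
  qed
qed

definition dirichlet_sum :: "nat \<Rightarrow> real \<Rightarrow> complex" where
  "dirichlet_sum P t = (\<Sum>j<P. unit_exp (real j * t))"

lemma norm_dirichlet_sum_le:
  assumes "\<And>z::int. \<Delta> \<le> \<bar>u - of_int z\<bar>" "\<Delta> > 0"
  shows "norm (dirichlet_sum P u) \<le> 1 / (2 * \<Delta>)"
proof -
  define f where "f = u - of_int (round u)"
  have f: "\<Delta> \<le> \<bar>f\<bar>" "\<bar>f\<bar> \<le> 1 / 2"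
    using assms(1)[of "round u"] of_int_round_abs_le[of u] by (auto simp: f_def abs_minus_commute)
  have "u = f + of_int (round u)" by (simp add: f_def)
  then have eu: "unit_exp u = unit_exp f" by (metis unit_exp_add_of_int)
  have "norm (unit_exp u - 1) = norm (unit_exp \<bar>f\<bar> - 1)"
    unfolding eu norm_unit_exp_minus_1 by (cases "f \<ge> 0") auto
  also have "\<dots> \<ge> 4 * \<bar>f\<bar>" using f by (intro norm_unit_exp_minus_1_ge) auto
  finally have ge: "norm (unit_exp u - 1) \<ge> 4 * \<Delta>" using f by linarith
  then have "unit_exp u \<noteq> 1" using assms(2) by auto
  then have "dirichlet_sum P u = (unit_exp u ^ P - 1) / (unit_exp u - 1)"
    unfolding dirichlet_sum_def unit_exp_of_nat_mult by (rule geometric_sum)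
  then have "norm (dirichlet_sum P u) = norm (unit_exp u ^ P - 1) / norm (unit_exp u - 1)"
    by (simp add: norm_divide)
  also have "\<dots> \<le> 2 / (4 * \<Delta>)"
    using norm_triangle_ineq4[of "unit_exp u ^ P" 1] ge assms(2)
    by (intro frac_le) (auto simp: norm_power)
  finally show ?thesis by simp
qed

section \<open>Powers of the Dirichlet kernel and their Fourier coefficients\<close>

definition tuples :: "nat \<Rightarrow> nat \<Rightarrow> (nat \<Rightarrow> nat) set" where
  "tuples k P = (\<Pi>\<^sub>E i\<in>{..<k}. {..<P})"

definition tuple_sum :: "nat \<Rightarrow> (nat \<Rightarrow> nat) \<Rightarrow> nat" where
  "tuple_sum k v = (\<Sum>i<k. v i)"

text \<open>The constant Fourier coefficient of \<open>norm (dirichlet_sum P t) ^ (2 * k)\<close>,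
  as that kernel is a sum of one exponential for each pair of tuples.\<close>

definition collisions :: "nat \<Rightarrow> nat \<Rightarrow> nat" where
  "collisions k P = card {(v, w) \<in> tuples k P \<times> tuples k P. tuple_sum k v = tuple_sum k w}"

lemma finite_tuples [simp]: "finite (tuples k P)"
  by (simp add: tuples_def finite_PiE)

lemma card_tuples: "card (tuples k P) = P ^ k"
  by (simp add: tuples_def card_PiE)

lemma tuple_sum_less:
  assumes "k \<ge> 1" "v \<in> tuples k P"
  shows "tuple_sum k v < k * P"
proof -
  have "(\<Sum>i<k. v i) < (\<Sum>i<k. P)"
    using assms by (intro sum_strict_mono) (auto simp: tuples_def PiE_iff lessThan_empty_iff)
  then show ?thesis by (simp add: tuple_sum_def)
qed

lemma dirichlet_sum_power:
  "dirichlet_sum P t ^ k = (\<Sum>v\<in>tuples k P. unit_exp (real (tuple_sum k v) * t))"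
proof -
  have "dirichlet_sum P t ^ k = (\<Prod>i<k. \<Sum>j<P. unit_exp (real j * t))"
    by (simp add: dirichlet_sum_def)
  also have "\<dots> = (\<Sum>v\<in>tuples k P. \<Prod>i<k. unit_exp (real (v i) * t))"
    unfolding tuples_def by (rule prod_sum_PiE) auto
  also have "\<dots> = (\<Sum>v\<in>tuples k P. unit_exp (real (tuple_sum k v) * t))"
    unfolding unit_exp_of_nat_mult tuple_sum_def power_sum ..
  finally show ?thesis .
qed

lemma dirichlet_sum_power_square:
  "complex_of_real (norm (dirichlet_sum P t) ^ (2 * k)) =
    (\<Sum>(v, w)\<in>tuples k P \<times> tuples k P. unit_exp (of_int (int (tuple_sum k v) - int (tuple_sum k w)) * t))"
proof -
  have "complex_of_real (norm (dirichlet_sum P t) ^ (2 * k)) = of_real (norm (dirichlet_sum P t ^ k) ^ 2)"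
    by (simp add: norm_power power_mult[symmetric] mult.commute)
  also have "\<dots> = (\<Sum>v\<in>tuples k P. unit_exp (real (tuple_sum k v) * t)) * cnj (\<Sum>v\<in>tuples k P. unit_exp (real (tuple_sum k v) * t))"
    unfolding complex_norm_square dirichlet_sum_power ..
  also have "\<dots> = (\<Sum>v\<in>tuples k P. \<Sum>w\<in>tuples k P. unit_exp (real (tuple_sum k v) * t) * cnj (unit_exp (real (tuple_sum k w) * t)))"
    by (simp add: sum_product)
  also have "\<dots> = (\<Sum>(v, w)\<in>tuples k P \<times> tuples k P. unit_exp (real (tuple_sum k v) * t) * cnj (unit_exp (real (tuple_sum k w) * t)))"
    by (rule sum.cartesian_product)
  also have "\<dots> = (\<Sum>(v, w)\<in>tuples k P \<times> tuples k P. unit_exp (of_int (int (tuple_sum k v) - int (tuple_sum k w)) * t))"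
    by (intro sum.cong refl) (auto simp: left_diff_distrib unit_exp_diff)
  finally show ?thesis .
qed

text \<open>Cauchy-Schwarz over the at most \<open>k * P\<close> values of the tuple sum. This lower
  bound for the normalising constant is what makes the tails of the normalised kernel small.\<close>

lemma collisions_ge:
  assumes "k \<ge> 1"
  shows "(real P ^ k) ^ 2 \<le> real (k * P) * real (collisions k P)"
proof -
  define d where "d i = {v\<in>tuples k P. tuple_sum k v = i}" for i
  have un: "tuples k P = (\<Union>i<k*P. d i)" using tuple_sum_less[OF assms] by (auto simp: d_def)
  have "card (tuples k P) = (\<Sum>i<k*P. card (d i))"
    unfolding un by (rule card_UN_disjoint) (auto simp: d_def)
  then have 1: "real P ^ k = (\<Sum>i<k*P. 1 * real (card (d i)))"
    by (simp add: card_tuples flip: of_nat_power of_nat_sum)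
  have "{(v, w) \<in> tuples k P \<times> tuples k P. tuple_sum k v = tuple_sum k w} = (\<Union>i<k*P. d i \<times> d i)"
    using tuple_sum_less[OF assms] by (auto simp: d_def)
  then have "collisions k P = card (\<Union>i<k*P. d i \<times> d i)" by (simp add: collisions_def)
  also have "\<dots> = (\<Sum>i<k*P. card (d i \<times> d i))"
    by (rule card_UN_disjoint) (auto simp: d_def)
  finally have 2: "real (collisions k P) = (\<Sum>i<k*P. real (card (d i)) ^ 2)"
    by (simp add: card_cartesian_product power2_eq_square)
  have "(\<Sum>i<k*P. 1 * real (card (d i))) ^ 2 \<le> (\<Sum>i<k*P. 1 ^ 2) * (\<Sum>i<k*P. real (card (d i)) ^ 2)"
    by (rule Cauchy_Schwarz_ineq_sum)
  then show ?thesis unfolding 1 2 by simp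
qed

text \<open>All frequencies are differences of tuple sums, hence below \<open>k * P\<close> in
  absolute value, and the grid kills every one but zero; so the sum does not depend on
  \<open>t\<close>.\<close>

lemma sum_dirichlet_power_grid:
  assumes "k \<ge> 1" "P \<ge> 1"
  shows "(\<Sum>j<k*P. norm (dirichlet_sum P (t - real j / real (k * P))) ^ (2 * k)) = real (k * P) * real (collisions k P)"
proof -
  define N where "N = k * P"
  have N: "N > 0" using assms by (simp add: N_def)
  define dd where "dd v w = int (tuple_sum k v) - int (tuple_sum k w)" for v w
  have "complex_of_real (\<Sum>j<N. norm (dirichlet_sum P (t - real j / real N)) ^ (2 * k)) =
    (\<Sum>j<N. \<Sum>(v, w)\<in>tuples k P \<times> tuples k P. unit_exp (of_int (dd v w) * (t - real j / real N)))"
    unfolding of_real_sum dirichlet_sum_power_square dd_def ..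
  also have "\<dots> = (\<Sum>(v, w)\<in>tuples k P \<times> tuples k P. \<Sum>j<N. unit_exp (of_int (dd v w) * (t - real j / real N)))"
    by (subst sum.swap) (simp add: case_prod_unfold)
  also have "\<dots> = (\<Sum>(v, w)\<in>tuples k P \<times> tuples k P. if tuple_sum k v = tuple_sum k w then of_nat N else 0)"
  proof (intro sum.cong refl, clarify)
    fix v w assume vw: "v \<in> tuples k P" "w \<in> tuples k P"
    have "\<bar>dd v w\<bar> < int N"
      using tuple_sum_less[OF assms(1) vw(1)] tuple_sum_less[OF assms(1) vw(2)] unfolding dd_def N_def by linarith
    then have dvd: "int N dvd dd v w \<longleftrightarrow> tuple_sum k v = tuple_sum k w"
      using zdvd_imp_le[of "int N" "\<bar>dd v w\<bar>"] by (auto simp: dd_def)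
    have "(\<Sum>j<N. unit_exp (of_int (dd v w) * (t - real j / real N))) =
       unit_exp (of_int (dd v w) * t) * (\<Sum>j<N. unit_exp (- (of_int (dd v w) * (real j / real N))))"
      unfolding sum_distrib_left unit_exp_add[symmetric] by (simp add: algebra_simps)
    also have "\<dots> = (if tuple_sum k v = tuple_sum k w then of_nat N else 0)"
      unfolding sum_unit_exp_grid[OF N] dvd by (auto simp: dd_def)
    finally show "(\<Sum>j<N. unit_exp (of_int (dd v w) * (t - real j / real N))) =
       (if tuple_sum k v = tuple_sum k w then of_nat N else 0)" .
  qed
  also have "\<dots> = (\<Sum>(v, w)\<in>{(v, w) \<in> tuples k P \<times> tuples k P. tuple_sum k v = tuple_sum k w}. of_nat N)"
    by (intro sum.mono_neutral_cong_right) (auto split: if_splits)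
  also have "\<dots> = complex_of_real (real N * real (collisions k P))"
    by (simp add: collisions_def case_prod_unfold)
  finally show ?thesis unfolding N_def[symmetric] of_real_eq_iff .
qed

text \<open>
The kernel \<open>norm (dirichlet_sum P t) ^ (2 * k)\<close> is averaged over the points \<open>j / N\<close> near the interval. Since its
degree is below \<open>N\<close>, averages over the grid are exact, and no Fourier integrals are needed.
\<close>

lemma periodic_majorant_exists:
  fixes \<delta> \<Delta> :: real and k P :: nat
  assumes k: "k \<ge> 1" "P \<ge> 1" and \<delta>: "\<delta> \<ge> 0" "\<Delta> > 0"
  defines "N \<equiv> k * P"
  shows "\<exists>W a0. (\<forall>t::real. W t \<ge> 0) \<and> 0 \<le> a0 \<and> a0 \<le> \<delta> + 2 * \<Delta> + 1 / real N \<and>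
    (\<forall>t (n::int). of_int n - \<delta> \<le> t \<and> t \<le> of_int n \<longrightarrow> 1 \<le> W t + real N / (2 * \<Delta> * real P) ^ (2 * k)) \<and>
    (\<forall>I (u::nat \<Rightarrow> complex) \<theta> B. finite I \<longrightarrow> 0 \<le> B \<longrightarrow>
      (\<forall>d::int. d \<noteq> 0 \<and> \<bar>d\<bar> < int N \<longrightarrow> norm (\<Sum>m\<in>I. u m * unit_exp (of_int d * \<theta> m)) \<le> B) \<longrightarrow>
      norm ((\<Sum>m\<in>I. u m * of_real (W (\<theta> m))) - of_real a0 * (\<Sum>m\<in>I. u m)) \<le> a0 * real N * B)"
proof -
  have N: "N > 0" using k by (simp add: N_def)
  define \<kappa> where "\<kappa> = real (collisions k P)"
  have \<kappa>ge: "(real P ^ k) ^ 2 \<le> real N * \<kappa>" unfolding N_def \<kappa>_def by (rule collisions_ge[OF k(1)])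
  have "(real P ^ k) ^ 2 > 0" using k by simp
  then have \<kappa>: "\<kappa> > 0" using \<kappa>ge N by (metis less_le_trans of_nat_0_less_iff zero_less_mult_pos)
  define K where "K t = norm (dirichlet_sum P t) ^ (2 * k)" for t
  have K0: "K t \<ge> 0" for t by (simp add: K_def)
  \<comment> \<open>Numerators of the grid points within \<open>\<Delta>\<close> of the interval
    from \<open>- \<delta>\<close> to 0; \<open>J\<close> folds them modulo 1.\<close>
  define lo hi where "lo = \<lceil>- (real N * (\<delta> + \<Delta>))\<rceil>" and "hi = \<lfloor>real N * \<Delta>\<rfloor>"
  define J where "J = (\<lambda>i. nat (i mod int N)) ` {lo..hi}"
  define a0 where "a0 = real (card J) / real N"
  \<comment> \<open>Over the whole grid this sum would be 1 for every \<open>t\<close>, so on the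
    interval \<open>W t\<close> misses 1 only by kernel values at distance at least
    \<open>\<Delta>\<close> from the integers.\<close>
  define W where "W t = (\<Sum>j\<in>J. K (t - real j / real N)) / (real N * \<kappa>)" for t
  have finJ: "finite J" by (simp add: J_def)
  have JN: "J \<subseteq> {..<N}" using N by (auto simp: J_def nat_less_iff)
  have a0: "a0 \<le> \<delta> + 2 * \<Delta> + 1 / real N"
  proof -
    have "card J \<le> card {lo..hi}" unfolding J_def by (rule card_image_le) simp
    then have "real (card J) \<le> real (nat (hi - lo + 1))" by simp
    also have "\<dots> \<le> real N * (\<delta> + 2 * \<Delta>) + 1"
    proof -
      have "real_of_int hi \<le> real N * \<Delta>" unfolding hi_def by (rule of_int_floor_le)
      moreover have "real_of_int lo \<ge> - (real N * (\<delta> + \<Delta>))" unfolding lo_def by (rule le_of_int_ceiling)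
      ultimately have "real_of_int (hi - lo + 1) \<le> real N * (\<delta> + 2 * \<Delta>) + 1"
        by (simp add: algebra_simps)
      moreover have "real N * (\<delta> + 2 * \<Delta>) + 1 \<ge> 0" using \<delta> by simp
      ultimately show ?thesis by (cases "hi - lo + 1 \<ge> 0") (auto simp: of_nat_nat)
    qed
    finally show ?thesis using N unfolding a0_def by (simp add: field_simps)
  qed
  have W0: "W t \<ge> 0" for t unfolding W_def using \<kappa> K0 by (intro divide_nonneg_nonneg sum_nonneg) auto
  have maj: "1 \<le> W t + real N / (2 * \<Delta> * real P) ^ (2 * k)" if t: "of_int n - \<delta> \<le> t" "t \<le> of_int n" for t and n :: int
  proof -
    have far: "K (t - real j / real N) \<le> (1 / (2 * \<Delta>)) ^ (2 * k)" if j: "j \<in> {..<N} - J" for j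
      unfolding K_def
    proof (intro power_mono norm_dirichlet_sum_le \<delta>)
      fix z :: int
      show "\<Delta> \<le> \<bar>t - real j / real N - of_int z\<bar>"
      proof (rule ccontr)
        assume "\<not> \<Delta> \<le> \<bar>t - real j / real N - of_int z\<bar>"
        then have *: "\<bar>t - real j / real N - of_int z\<bar> < \<Delta>" by simp
        \<comment> \<open>The representative of \<open>j\<close> modulo \<open>N\<close> whose grid
          point \<open>i / N\<close> lies near \<open>t - n\<close>, hence near the
          interval.\<close>
        define i where "i = int j + int N * (z - n)"
        have i: "real_of_int i = real N * (real j / real N + of_int z - of_int n)"
          using N by (simp add: i_def field_simps)
        have "real_of_int i \<le> real N * \<Delta>"
          unfolding i using * t by (intro mult_left_mono) auto
        then have "i \<le> hi" by (simp add: hi_def le_floor_iff)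
        moreover have "- (real N * (\<delta> + \<Delta>)) \<le> real_of_int i"
        proof -
          have "real N * (- (\<delta> + \<Delta>)) \<le> real_of_int i"
            unfolding i using * t by (intro mult_left_mono) auto
          then show ?thesis by (simp only: mult_minus_right)
        qed
        then have "lo \<le> i" by (simp add: lo_def ceiling_le_iff)
        moreover have "nat (i mod int N) = j" using j by (simp add: i_def)
        ultimately have "j \<in> J" unfolding J_def by (metis atLeastAtMost_iff image_eqI)
        then show False using j by simp
      qed
    qed simp
    have "real N * \<kappa> = (\<Sum>j<N. K (t - real j / real N))"
      unfolding K_def \<kappa>_def N_def using sum_dirichlet_power_grid[OF k] by simp
    also have "\<dots> = (\<Sum>j\<in>{..<N} - J. K (t - real j / real N)) + (\<Sum>j\<in>J. K (t - real j / real N))"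
      using JN by (rule sum.subset_diff) simp
    also have "(\<Sum>j\<in>J. K (t - real j / real N)) = (real N * \<kappa>) * W t"
      using N \<kappa> by (simp add: W_def)
    finally have "real N * \<kappa> * (1 - W t) = (\<Sum>j\<in>{..<N} - J. K (t - real j / real N))"
      unfolding right_diff_distrib by linarith
    also have "\<dots> \<le> (\<Sum>j\<in>{..<N} - J. (1 / (2 * \<Delta>)) ^ (2 * k))"
      by (intro sum_mono far)
    also have "\<dots> \<le> real N * (1 / (2 * \<Delta>)) ^ (2 * k)"
    proof -
      have "card ({..<N} - J) \<le> card {..<N}" by (intro card_mono) auto
      then show ?thesis using \<delta> by (auto intro!: mult_right_mono)
    qed
    finally have "\<kappa> * (1 - W t) \<le> (1 / (2 * \<Delta>)) ^ (2 * k)"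
      using N by (simp add: mult.assoc)
    then have "1 - W t \<le> (1 / (2 * \<Delta>)) ^ (2 * k) / \<kappa>"
      using \<kappa> by (simp only: pos_le_divide_eq mult.commute)
    also have "\<dots> \<le> (1 / (2 * \<Delta>)) ^ (2 * k) * (real N / (real P ^ k) ^ 2)"
    proof -
      have "1 / \<kappa> \<le> real N / (real P ^ k) ^ 2" using \<kappa> \<kappa>ge k by (simp add: field_simps)
      then have "(1 / (2 * \<Delta>)) ^ (2 * k) * (1 / \<kappa>) \<le> (1 / (2 * \<Delta>)) ^ (2 * k) * (real N / (real P ^ k) ^ 2)"
        using \<delta> by (intro mult_left_mono) auto
      then show ?thesis by simp
    qed
    also have "\<dots> = real N / (2 * \<Delta> * real P) ^ (2 * k)"
      by (simp add: power_mult_distrib power_divide power_mult[symmetric] mult.commute)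
    finally show ?thesis by simp
  qed
  \<comment> \<open>\<open>a0\<close> is the constant Fourier coefficient of \<open>W\<close>. The
    other frequencies come from pairs with different tuple sums; there are at most
    \<open>P ^ (2 * k)\<close> of these, which \<open>collisions_ge\<close> bounds by
    \<open>N * \<kappa>\<close>.\<close>
  have approx: "norm ((\<Sum>m\<in>I. u m * of_real (W (\<theta> m))) - of_real a0 * (\<Sum>m\<in>I. u m)) \<le> a0 * real N * B"
    if I: "finite I" and B0: "0 \<le> B" and B: "\<forall>d::int. d \<noteq> 0 \<and> \<bar>d\<bar> < int N \<longrightarrow> norm (\<Sum>m\<in>I. u m * unit_exp (of_int d * \<theta> m)) \<le> B"
    for I :: "nat set" and u :: "nat \<Rightarrow> complex" and \<theta> B
  proof -
    define dd where "dd v w = int (tuple_sum k v) - int (tuple_sum k w)" for v w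
    define VV where "VV = tuples k P \<times> tuples k P"
    define eq where "eq = {(v, w) \<in> VV. tuple_sum k v = tuple_sum k w}"
    define T where "T d = (\<Sum>m\<in>I. u m * unit_exp (of_int d * \<theta> m))" for d :: int
    define c where "c = complex_of_real (real N * \<kappa>)"
    have c: "c \<noteq> 0" using N \<kappa> by (simp add: c_def)
    have finVV: "finite VV" "eq \<subseteq> VV" by (auto simp: VV_def eq_def)
    define t where "t j vw = (case vw of (v, w) \<Rightarrow> unit_exp (- (of_int (dd v w) * (real j / real N))) * T (dd v w))" for j :: nat and vw
    have Kexp: "complex_of_real (K (\<theta> m - real j / real N)) =
       (\<Sum>(v, w)\<in>VV. unit_exp (- (of_int (dd v w) * (real j / real N))) * unit_exp (of_int (dd v w) * \<theta> m))" for m j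
      unfolding K_def dirichlet_sum_power_square VV_def dd_def unit_exp_add[symmetric]
      by (intro sum.cong refl) (auto simp: algebra_simps)
    have cW: "c * of_real (W x) = (\<Sum>j\<in>J. complex_of_real (K (x - real j / real N)))" for x
      using N \<kappa> unfolding of_real_sum[symmetric] c_def of_real_mult[symmetric] by (simp add: W_def)
    have "c * (\<Sum>m\<in>I. u m * of_real (W (\<theta> m))) = (\<Sum>m\<in>I. u m * (c * of_real (W (\<theta> m))))"
      unfolding sum_distrib_left by (intro sum.cong refl mult.left_commute)
    also have "\<dots> = (\<Sum>m\<in>I. \<Sum>j\<in>J. u m * complex_of_real (K (\<theta> m - real j / real N)))"
      unfolding cW sum_distrib_left ..
    also have "\<dots> = (\<Sum>j\<in>J. \<Sum>m\<in>I. u m * complex_of_real (K (\<theta> m - real j / real N)))"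
      by (rule sum.swap)
    also have "\<dots> = (\<Sum>j\<in>J. \<Sum>vw\<in>VV. t j vw)"
    proof (intro sum.cong refl)
      fix j
      have "(\<Sum>m\<in>I. u m * complex_of_real (K (\<theta> m - real j / real N))) =
         (\<Sum>m\<in>I. \<Sum>(v, w)\<in>VV. unit_exp (- (of_int (dd v w) * (real j / real N))) * (u m * unit_exp (of_int (dd v w) * \<theta> m)))"
        unfolding Kexp sum_distrib_left by (intro sum.cong refl) (auto simp: mult_ac)
      also have "\<dots> = (\<Sum>vw\<in>VV. \<Sum>m\<in>I. case vw of (v, w) \<Rightarrow> unit_exp (- (of_int (dd v w) * (real j / real N))) * (u m * unit_exp (of_int (dd v w) * \<theta> m)))"
        by (rule sum.swap)
      also have "\<dots> = (\<Sum>vw\<in>VV. t j vw)"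
        unfolding t_def T_def by (intro sum.cong refl) (auto simp: sum_distrib_left)
      finally show "(\<Sum>m\<in>I. u m * complex_of_real (K (\<theta> m - real j / real N))) = (\<Sum>vw\<in>VV. t j vw)" .
    qed
    also have "\<dots> = (\<Sum>j\<in>J. (\<Sum>vw\<in>VV - eq. t j vw) + (\<Sum>vw\<in>eq. t j vw))"
      by (intro sum.cong refl sum.subset_diff finVV)
    also have "\<dots> = (\<Sum>j\<in>J. \<Sum>vw\<in>VV - eq. t j vw) + (\<Sum>j\<in>J. \<Sum>vw\<in>eq. t j vw)"
      by (rule sum.distrib)
    also have "(\<Sum>j\<in>J. \<Sum>vw\<in>eq. t j vw) = (\<Sum>j\<in>J. \<Sum>vw\<in>eq. T 0)"
      by (intro sum.cong refl) (auto simp: t_def eq_def dd_def)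
    also have "\<dots> = c * (of_real a0 * (\<Sum>m\<in>I. u m))"
      using N by (simp add: c_def a0_def T_def \<kappa>_def collisions_def eq_def VV_def)
    finally have "c * ((\<Sum>m\<in>I. u m * of_real (W (\<theta> m))) - of_real a0 * (\<Sum>m\<in>I. u m)) = (\<Sum>j\<in>J. \<Sum>vw\<in>VV - eq. t j vw)"
      by (simp add: algebra_simps)
    then have "norm c * norm ((\<Sum>m\<in>I. u m * of_real (W (\<theta> m))) - of_real a0 * (\<Sum>m\<in>I. u m)) = norm (\<Sum>j\<in>J. \<Sum>vw\<in>VV - eq. t j vw)"
      by (simp only: norm_mult[symmetric])
    also have "\<dots> \<le> (\<Sum>j\<in>J. \<Sum>vw\<in>VV - eq. B)"
    proof (intro sum_norm_le)
      fix j vw assume "vw \<in> VV - eq"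
      then obtain v w where vw: "vw = (v, w)" "v \<in> tuples k P" "w \<in> tuples k P" "tuple_sum k v \<noteq> tuple_sum k w"
        by (auto simp: VV_def eq_def)
      have "dd v w \<noteq> 0 \<and> \<bar>dd v w\<bar> < int N"
        using tuple_sum_less[OF k(1) vw(2)] tuple_sum_less[OF k(1) vw(3)] vw(4) unfolding dd_def N_def by linarith
      then have "norm (T (dd v w)) \<le> B" using B unfolding T_def by blast
      then show "norm (t j vw) \<le> B" by (simp add: t_def vw norm_mult)
    qed
    also have "\<dots> \<le> real (card J) * ((real P ^ k) ^ 2 * B)"
    proof -
      have "card (VV - eq) \<le> card VV" using finVV by (intro card_mono) auto
      then have "real (card (VV - eq)) \<le> real (card VV)" by simp
      also have "\<dots> = (real P ^ k) ^ 2"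
        by (simp add: VV_def card_cartesian_product card_tuples power2_eq_square)
      finally show ?thesis using B0 by (simp add: mult_left_mono mult_right_mono)
    qed
    also have "\<dots> \<le> real (card J) * ((real N * \<kappa>) * B)"
      using B0 \<kappa>ge by (intro mult_left_mono mult_right_mono) auto
    also have "\<dots> = norm c * (a0 * real N * B)"
      using N \<kappa> by (simp add: c_def a0_def norm_mult)
    finally show ?thesis using c by (subst (asm) mult_le_cancel_left_pos) auto
  qed
  show ?thesis using W0 a0 maj approx by (intro exI[of _ W] exI[of _ a0]) (auto simp: a0_def)
qed

text \<open>On \<open>I\<close>, the indicator of \<open>S\<close> is \<open>W + \<tau>\<close>
  minus a nonnegative defect. In the sum of \<open>u\<close> the defect costs at most its total
  mass, which is where \<open>- card S\<close> comes from: in the application it nearly cancels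
  \<open>\<delta> * card I\<close>. This replaces a minorant.\<close>

lemma norm_sum_subset_le:
  fixes u :: "nat \<Rightarrow> complex" and \<theta> :: "nat \<Rightarrow> real" and \<delta> \<Delta> B :: real and k P :: nat
  defines "N \<equiv> k * P"
  assumes I: "finite I" "S \<subseteq> I" and u: "\<And>m. norm (u m) \<le> 1"
    and near: "\<And>m. m \<in> S \<Longrightarrow> \<exists>n::int. of_int n - \<delta> \<le> \<theta> m \<and> \<theta> m \<le> of_int n"
    and \<delta>: "\<delta> \<ge> 0" "\<Delta> > 0" and k: "k \<ge> 1" "P \<ge> 1" and "B \<ge> 0"
    and T: "\<And>h. h \<in> {1..<N} \<Longrightarrow> norm (\<Sum>m\<in>I. u m * unit_exp (real h * \<theta> m)) \<le> B"
      "\<And>h. h \<in> {1..<N} \<Longrightarrow> norm (\<Sum>m\<in>I. cnj (u m) * unit_exp (real h * \<theta> m)) \<le> B"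
      "\<And>h. h \<in> {1..<N} \<Longrightarrow> norm (\<Sum>m\<in>I. unit_exp (real h * \<theta> m)) \<le> B"
  shows "norm (\<Sum>m\<in>S. u m) \<le>
    (\<delta> + 2 * \<Delta> + 1 / real N) * (norm (\<Sum>m\<in>I. u m) + 2 * real N * B + real (card I)) +
    2 * (real N / (2 * \<Delta> * real P) ^ (2 * k)) * real (card I) - real (card S)"
proof -
  define \<tau> where "\<tau> = real N / (2 * \<Delta> * real P) ^ (2 * k)"
  have \<tau>: "\<tau> \<ge> 0" using \<delta> by (simp add: \<tau>_def)
  obtain W a0 where W0: "\<forall>t::real. W t \<ge> 0" and a0: "0 \<le> a0" "a0 \<le> \<delta> + 2 * \<Delta> + 1 / real N"
    and maj: "\<forall>t (n::int). of_int n - \<delta> \<le> t \<and> t \<le> of_int n \<longrightarrow> 1 \<le> W t + \<tau>"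
    and approx: "\<forall>I (u::nat \<Rightarrow> complex) \<theta> B. finite I \<longrightarrow> 0 \<le> B \<longrightarrow>
      (\<forall>d::int. d \<noteq> 0 \<and> \<bar>d\<bar> < int N \<longrightarrow> norm (\<Sum>m\<in>I. u m * unit_exp (of_int d * \<theta> m)) \<le> B) \<longrightarrow>
      norm ((\<Sum>m\<in>I. u m * of_real (W (\<theta> m))) - of_real a0 * (\<Sum>m\<in>I. u m)) \<le> a0 * real N * B"
    using periodic_majorant_exists[OF k \<delta>, folded N_def, folded \<tau>_def] by (elim exE conjE) (rule that; assumption)
  note W0 = W0[rule_format] and maj = maj[rule_format] and approx = approx[rule_format]
  \<comment> \<open>A negative frequency is a positive one for the conjugated coefficients; hence
    the separate hypothesis for \<open>cnj (u m)\<close>.\<close>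
  have int_T: "norm (\<Sum>m\<in>I. w m * unit_exp (of_int d * \<theta> m)) \<le> B"
    if d: "d \<noteq> 0 \<and> \<bar>d\<bar> < int N" and w: "\<And>h. h \<in> {1..<N} \<Longrightarrow> norm (\<Sum>m\<in>I. w m * unit_exp (real h * \<theta> m)) \<le> B"
      "\<And>h. h \<in> {1..<N} \<Longrightarrow> norm (\<Sum>m\<in>I. cnj (w m) * unit_exp (real h * \<theta> m)) \<le> B" for d :: int and w
  proof (cases "d \<ge> 0")
    case True
    then obtain e where e: "d = int e" by (rule nonneg_int_cases)
    then have "e \<in> {1..<N}" using d by auto
    then show ?thesis using w(1)[of e] unfolding e by simp
  next
    case False
    define e where "e = nat (- d)"
    have e: "int e = - d" using False by (simp add: e_def)
    then have "real_of_int d = - real e" by (metis of_int_minus of_int_of_nat_eq minus_minus)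
    moreover have "1 \<le> e" "e < N" using e d False by linarith+
    ultimately have n: "real_of_int d = - real e" "e \<in> {1..<N}" by auto
    have "(\<Sum>m\<in>I. w m * unit_exp (of_int d * \<theta> m)) = cnj (\<Sum>m\<in>I. cnj (w m) * unit_exp (real e * \<theta> m))"
      unfolding n(1) by (simp add: cnj_unit_exp)
    then have "norm (\<Sum>m\<in>I. w m * unit_exp (of_int d * \<theta> m)) = norm (\<Sum>m\<in>I. cnj (w m) * unit_exp (real e * \<theta> m))"
      by (simp only: complex_mod_cnj)
    then show ?thesis using w(2)[OF n(2)] by simp
  qed
  define V where "V m = W (\<theta> m) + \<tau>" for m
  define ind where "ind m = (if m \<in> S then 1 else 0 :: real)" for m
  have Vind: "0 \<le> V m - ind m" for m
    using W0[of "\<theta> m"] \<tau> near[of m] maj by (auto simp: V_def ind_def)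
  have au: "norm ((\<Sum>m\<in>I. u m * of_real (W (\<theta> m))) - of_real a0 * (\<Sum>m\<in>I. u m)) \<le> a0 * real N * B"
    by (rule approx[OF I(1) \<open>B \<ge> 0\<close>], rule int_T) (use T in auto)
  have "norm ((\<Sum>m\<in>I. 1 * of_real (W (\<theta> m))) - of_real a0 * (\<Sum>m\<in>I. 1 :: complex)) \<le> a0 * real N * B"
    by (rule approx[OF I(1) \<open>B \<ge> 0\<close>], rule int_T) (use T in auto)
  then have "norm (complex_of_real ((\<Sum>m\<in>I. W (\<theta> m)) - a0 * real (card I))) \<le> a0 * real N * B" by simp
  then have a1: "(\<Sum>m\<in>I. W (\<theta> m)) \<le> a0 * real (card I) + a0 * real N * B"
    by (simp only: norm_of_real)
  have sumu: "norm (\<Sum>m\<in>I. u m) \<le> real (card I)"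
    using sum_norm_le[of I u "\<lambda>_. 1"] u by simp
  have "(\<Sum>m\<in>S. u m) = (\<Sum>m\<in>I. u m * of_real (ind m))"
    using I by (intro sum.mono_neutral_cong_left) (auto simp: ind_def)
  also have "\<dots> = ((\<Sum>m\<in>I. u m * of_real (W (\<theta> m))) - of_real a0 * (\<Sum>m\<in>I. u m)) + of_real a0 * (\<Sum>m\<in>I. u m)
     + of_real \<tau> * (\<Sum>m\<in>I. u m) - (\<Sum>m\<in>I. u m * of_real (V m - ind m))"
    by (simp add: V_def algebra_simps sum.distrib sum_subtractf sum_distrib_left sum_distrib_right)
  finally have eqS: "(\<Sum>m\<in>S. u m) = ((\<Sum>m\<in>I. u m * of_real (W (\<theta> m))) - of_real a0 * (\<Sum>m\<in>I. u m)) + of_real a0 * (\<Sum>m\<in>I. u m)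
     + of_real \<tau> * (\<Sum>m\<in>I. u m) - (\<Sum>m\<in>I. u m * of_real (V m - ind m))" .
  have tri: "norm (a + b + c - d) \<le> norm a + norm b + norm c + norm d" for a b c d :: complex
    using norm_triangle_ineq4[of "a + b + c" d] norm_triangle_ineq[of "a + b" c] norm_triangle_ineq[of a b] by linarith
  have "norm (\<Sum>m\<in>S. u m) \<le> norm ((\<Sum>m\<in>I. u m * of_real (W (\<theta> m))) - of_real a0 * (\<Sum>m\<in>I. u m)) +
      norm (of_real a0 * (\<Sum>m\<in>I. u m)) + norm (of_real \<tau> * (\<Sum>m\<in>I. u m)) + norm (\<Sum>m\<in>I. u m * of_real (V m - ind m))"
    unfolding eqS by (rule tri)
  moreover have "norm (of_real a0 * (\<Sum>m\<in>I. u m)) = a0 * norm (\<Sum>m\<in>I. u m)"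
    using a0 by (simp add: norm_mult)
  moreover have "norm (of_real \<tau> * (\<Sum>m\<in>I. u m)) \<le> \<tau> * real (card I)"
    using sumu \<tau> by (simp add: norm_mult mult_left_mono)
  moreover have "norm (\<Sum>m\<in>I. u m * of_real (V m - ind m)) \<le> (\<Sum>m\<in>I. V m - ind m)"
  proof (rule sum_norm_le)
    fix m
    have "norm (u m * of_real (V m - ind m)) = norm (u m) * (V m - ind m)"
      using Vind[of m] by (simp only: norm_mult norm_of_real abs_of_nonneg)
    also have "\<dots> \<le> V m - ind m" using Vind[of m] u[of m] by (intro mult_left_le_one_le) auto
    finally show "norm (u m * of_real (V m - ind m)) \<le> V m - ind m" .
  qed
  moreover have "(\<Sum>m\<in>I. V m - ind m) = (\<Sum>m\<in>I. W (\<theta> m)) + \<tau> * real (card I) - real (card S)"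
  proof -
    have "(\<Sum>m\<in>I. ind m) = real (card S)"
      using I by (simp add: ind_def sum.If_cases Int_absorb1)
    then show ?thesis by (simp add: V_def sum.distrib sum_subtractf)
  qed
  ultimately have "norm (\<Sum>m\<in>S. u m) \<le> a0 * (norm (\<Sum>m\<in>I. u m) + 2 * real N * B + real (card I)) + 2 * \<tau> * real (card I) - real (card S)"
    using au a1 by (simp add: algebra_simps)
  also have "\<dots> \<le> (\<delta> + 2 * \<Delta> + 1 / real N) * (norm (\<Sum>m\<in>I. u m) + 2 * real N * B + real (card I)) + 2 * \<tau> * real (card I) - real (card S)"
    using a0 \<open>B \<ge> 0\<close> by (intro diff_right_mono add_right_mono mult_right_mono) auto
  finally show ?thesis by (simp add: \<tau>_def)
qed

section \<open>Piatetski-Shapiro numbers in short blocks\<close>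

definition ps_range :: "real \<Rightarrow> nat set" where
  "ps_range c = {nat \<lfloor>real n powr c\<rfloor> | n::nat. n \<ge> 1}"

lemma powr_less_base_iff:
  fixes x y p :: real
  assumes "0 \<le> x" "0 \<le> y" "0 < p"
  shows "x powr p < y powr p \<longleftrightarrow> x < y"
  using assms powr_less_mono2[of p x y] powr_mono2[of p y x] by linarith

lemma nat_floor_powr_eq_iff:
  assumes "c > 0" "n \<ge> 1"
  shows "nat \<lfloor>real n powr c\<rfloor> = m \<longleftrightarrow> real m powr (1 / c) \<le> real n \<and> real n < real (m + 1) powr (1 / c)"
proof -
  have "nat \<lfloor>real n powr c\<rfloor> = m \<longleftrightarrow> \<lfloor>real n powr c\<rfloor> = int m" by auto
  also have "\<dots> \<longleftrightarrow> real m \<le> real n powr c \<and> real n powr c < real (m + 1)"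
    by (simp add: floor_eq_iff add.commute)
  also have "real m \<le> real n powr c \<longleftrightarrow> real m powr (1 / c) \<le> real n"
  proof -
    have "real m \<le> real n powr c \<longleftrightarrow> real m powr (1 / c) \<le> (real n powr c) powr (1 / c)"
      using assms powr_less_base_iff[of "real n powr c" "real m" "1 / c"] by auto
    then show ?thesis using assms by (simp add: powr_powr)
  qed
  also have "real n powr c < real (m + 1) \<longleftrightarrow> real n < real (m + 1) powr (1 / c)"
  proof -
    have "real n powr c < real (m + 1) \<longleftrightarrow> (real n powr c) powr (1 / c) < real (m + 1) powr (1 / c)"
      using assms by (intro powr_less_base_iff[symmetric]) auto
    then show ?thesis using assms by (simp add: powr_powr)
  qed
  finally show ?thesis .
qed

text \<open>For \<open>c \<ge> 1\<close> the mean value theorem gives a gap of at least 1 between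
  the powers of distinct positive integers, so even the floors differ.\<close>

lemma inj_on_nat_floor_powr:
  assumes "c \<ge> 1"
  shows "inj_on (\<lambda>n::nat. nat \<lfloor>real n powr c\<rfloor>) {1..}"
proof (rule linorder_inj_onI')
  fix i j :: nat assume ij: "i \<in> {1..}" "j \<in> {1..}" "i < j"
  have "real i powr c + 1 \<le> real j powr c"
  proof -
    have "\<exists>z. real i < z \<and> z < real j \<and> real j powr c - real i powr c = (real j - real i) * (c * z powr (c - 1))"
      using ij by (intro MVT2) (auto intro!: derivative_eq_intros)
    then obtain z where z: "real i < z" "real j powr c - real i powr c = (real j - real i) * (c * z powr (c - 1))"
      by auto
    have "1 * (1 * 1) \<le> (real j - real i) * (c * z powr (c - 1))"
      using ij assms z by (intro mult_mono ge_one_powr_ge_zero) auto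
    then show ?thesis using z by linarith
  qed
  then have "\<lfloor>real i powr c\<rfloor> < \<lfloor>real j powr c\<rfloor>" by linarith
  moreover have "0 \<le> \<lfloor>real i powr c\<rfloor>" by simp
  ultimately have "nat \<lfloor>real i powr c\<rfloor> < nat \<lfloor>real j powr c\<rfloor>" by linarith
  then show "nat \<lfloor>real i powr c\<rfloor> \<noteq> nat \<lfloor>real j powr c\<rfloor>" by (rule less_imp_neq)
qed

lemma powr_diff_bounds:
  fixes g x y :: real
  assumes "0 < g" "g < 1" "0 < x" "x \<le> y"
  shows "g * (y - x) * y powr (g - 1) \<le> y powr g - x powr g"
    and "y powr g - x powr g \<le> g * (y - x) * x powr (g - 1)"
    and "x powr (g - 1) - y powr (g - 1) \<le> (y - x) * x powr (g - 2)"
proof -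
  show "g * (y - x) * y powr (g - 1) \<le> y powr g - x powr g"
    and "y powr g - x powr g \<le> g * (y - x) * x powr (g - 1)"
  proof -
    have "g * (y - x) * y powr (g - 1) \<le> y powr g - x powr g \<and> y powr g - x powr g \<le> g * (y - x) * x powr (g - 1)"
    proof (cases "x = y")
      case False
      then have "\<exists>z>x. z < y \<and> y powr g - x powr g = (y - x) * (g * z powr (g - 1))"
        using assms by (intro MVT2) (auto intro!: derivative_eq_intros)
      then obtain z where z: "x < z" "z < y" "y powr g - x powr g = g * (y - x) * z powr (g - 1)"
        by (auto simp: mult_ac)
      show ?thesis unfolding z(3) using z assms by (auto intro!: mult_left_mono powr_mono2')
    qed simp
    then show "g * (y - x) * y powr (g - 1) \<le> y powr g - x powr g" "y powr g - x powr g \<le> g * (y - x) * x powr (g - 1)"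
      by auto
  qed
  show "x powr (g - 1) - y powr (g - 1) \<le> (y - x) * x powr (g - 2)"
  proof (cases "x = y")
    case False
    then have "\<exists>z>x. z < y \<and> y powr (g - 1) - x powr (g - 1) = (y - x) * ((g - 1) * z powr (g - 1 - 1))"
      using assms by (intro MVT2) (auto intro!: derivative_eq_intros)
    then obtain z where z: "x < z" "z < y" "y powr (g - 1) - x powr (g - 1) = (y - x) * ((g - 1) * z powr (g - 2))"
      by auto
    have "x powr (g - 1) - y powr (g - 1) = (y - x) * ((1 - g) * z powr (g - 2))" using z(3) by (simp add: algebra_simps)
    also have "\<dots> \<le> (y - x) * (1 * x powr (g - 2))"
      using z assms by (intro mult_left_mono mult_mono powr_mono2') auto
    finally show ?thesis by simp
  qed simp
qed

text \<open>A lower bound is enough because the cardinality enters \<open>norm_sum_subset_le\<close>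
  with a minus sign. Each integer from \<open>a powr (1 / c)\<close> up to, but excluding,
  \<open>(a + L) powr (1 / c)\<close> yields its own element of the block; rounding costs 1.\<close>

lemma card_ps_range_block_ge:
  assumes "c > 1" "a \<ge> 1"
  shows "real (a + L) powr (1 / c) - real a powr (1 / c) - 1 \<le> real (card (ps_range c \<inter> {a..<a+L}))"
proof -
  define x y where "x = real a powr (1 / c)" and "y = real (a + L) powr (1 / c)"
  have x1: "x \<ge> 1" unfolding x_def using assms by (intro ge_one_powr_ge_zero) auto
  define M where "M = {nat \<lceil>x\<rceil>..<nat \<lceil>y\<rceil>}"
  have M: "n \<ge> 1 \<and> x \<le> real n \<and> real n < y" if "n \<in> M" for n
  proof -
    have "nat \<lceil>x\<rceil> \<le> n" "n < nat \<lceil>y\<rceil>" using that unfolding M_def by (simp_all only: atLeastLessThan_iff)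
    then have "\<lceil>x\<rceil> \<le> int n" "int n < \<lceil>y\<rceil>" by linarith+
    then have "x \<le> real n" "real n < y" by (simp_all add: ceiling_le_iff less_ceiling_iff)
    then show ?thesis using x1 by auto
  qed
  have sub: "(\<lambda>n. nat \<lfloor>real n powr c\<rfloor>) ` M \<subseteq> ps_range c \<inter> {a..<a+L}"
  proof
    fix m assume "m \<in> (\<lambda>n. nat \<lfloor>real n powr c\<rfloor>) ` M"
    then obtain n where n: "n \<in> M" "m = nat \<lfloor>real n powr c\<rfloor>" by auto
    then have n1: "n \<ge> 1" "x \<le> real n" "real n < y" using M by auto
    have mn: "real m powr (1 / c) \<le> real n" "real n < real (m + 1) powr (1 / c)"
      using nat_floor_powr_eq_iff[of c n m] n n1 assms by auto
    have "real m powr (1 / c) < real (a + L) powr (1 / c)" using mn n1 unfolding y_def by linarith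
    then have "m < a + L" using assms by (subst (asm) powr_less_base_iff) auto
    moreover have "real a powr (1 / c) < real (m + 1) powr (1 / c)" using mn n1 unfolding x_def by linarith
    then have "a < m + 1" using assms by (subst (asm) powr_less_base_iff) auto
    moreover have "m \<in> ps_range c" using n n1 by (auto simp: ps_range_def)
    ultimately show "m \<in> ps_range c \<inter> {a..<a+L}" by auto
  qed
  have "inj_on (\<lambda>n::nat. nat \<lfloor>real n powr c\<rfloor>) M"
    by (rule inj_on_subset[OF inj_on_nat_floor_powr]) (use assms M in auto)
  then have "card M \<le> card (ps_range c \<inter> {a..<a+L})"
    using sub by (intro card_inj_on_le) auto
  moreover have "y - x - 1 \<le> real (card M)"
    unfolding M_def using x1 by simp linarith
  ultimately show ?thesis unfolding x_def y_def by linarith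
qed

text \<open>The interval length is frozen at \<open>\<delta> = g * a powr (g - 1)\<close>, an upper
  bound for the lengths on the block. Then \<open>\<delta> * L\<close> nearly cancels against the
  number of elements, and the term with \<open>L ^ 2\<close> is the drift of the length across the
  block.\<close>

lemma norm_sum_ps_range_block_le:
  fixes u :: "nat \<Rightarrow> complex" and c \<Delta> B :: real and a L k P :: nat
  defines "N \<equiv> k * P" and "g \<equiv> 1 / c"
  assumes c: "c > 1" and a: "a \<ge> 1" and u: "\<And>m. norm (u m) \<le> 1"
    and \<Delta>: "\<Delta> > 0" and k: "k \<ge> 1" "P \<ge> 1" and "B \<ge> 0"
    and T: "\<And>h. h \<in> {1..<N} \<Longrightarrow> norm (\<Sum>m\<in>{a..<a+L}. u m * unit_exp (real h * real m powr g)) \<le> B"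
      "\<And>h. h \<in> {1..<N} \<Longrightarrow> norm (\<Sum>m\<in>{a..<a+L}. cnj (u m) * unit_exp (real h * real m powr g)) \<le> B"
      "\<And>h. h \<in> {1..<N} \<Longrightarrow> norm (\<Sum>m\<in>{a..<a+L}. unit_exp (real h * real m powr g)) \<le> B"
  shows "norm (\<Sum>m\<in>ps_range c \<inter> {a..<a+L}. u m) \<le>
    (real a powr (g - 1) + 2 * \<Delta> + 1 / real N) * (norm (\<Sum>m\<in>{a..<a+L}. u m) + 2 * real N * B) +
    (2 * \<Delta> + 1 / real N + 2 * (real N / (2 * \<Delta> * real P) ^ (2 * k))) * real L + real L ^ 2 * real a powr (g - 2) + 1"
proof -
  define S where "S = ps_range c \<inter> {a..<a+L}"
  define \<delta> where "\<delta> = g * real a powr (g - 1)"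
  have g: "0 < g" "g < 1" using c by (auto simp: g_def)
  have \<delta>: "0 \<le> \<delta>" "\<delta> \<le> real a powr (g - 1)" using g by (auto simp: \<delta>_def intro!: mult_left_le_one_le)
  have near: "\<exists>n::int. of_int n - \<delta> \<le> real m powr g \<and> real m powr g \<le> of_int n" if "m \<in> S" for m
  proof -
    have "m \<in> ps_range c" using that by (simp add: S_def)
    then obtain n where n: "n \<ge> 1" "m = nat \<lfloor>real n powr c\<rfloor>" by (auto simp: ps_range_def)
    have m: "a \<le> m" using that by (auto simp: S_def)
    have mn: "real m powr g \<le> real n" "real n < real (m + 1) powr g"
      using nat_floor_powr_eq_iff[of c n m] n c unfolding g_def by auto
    have "real (m + 1) powr g - real m powr g \<le> g * (real (m + 1) - real m) * real m powr (g - 1)"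
      using g m a by (intro powr_diff_bounds) auto
    also have "\<dots> = g * real m powr (g - 1)" by simp
    also have "\<dots> \<le> \<delta>" unfolding \<delta>_def using g m a by (intro mult_left_mono powr_mono2') auto
    finally have "real_of_int (int n) - \<delta> \<le> real m powr g \<and> real m powr g \<le> of_int (int n)" using mn by simp
    then show ?thesis by blast
  qed
  have "norm (\<Sum>m\<in>S. u m) \<le>
    (\<delta> + 2 * \<Delta> + 1 / real N) * (norm (\<Sum>m\<in>{a..<a+L}. u m) + 2 * real N * B + real (card {a..<a+L})) +
    2 * (real N / (2 * \<Delta> * real P) ^ (2 * k)) * real (card {a..<a+L}) - real (card S)"
    unfolding N_def using near \<Delta> \<delta> k \<open>B \<ge> 0\<close> T u
    by (intro norm_sum_subset_le[where \<theta> = "\<lambda>m. real m powr g"]) (auto simp: S_def N_def)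
  moreover have "\<delta> * real L - real (card S) \<le> real L ^ 2 * real a powr (g - 2) + 1"
  proof -
    have "real (a + L) powr g - real a powr g - 1 \<le> real (card S)"
      unfolding S_def g_def by (rule card_ps_range_block_ge[OF c a])
    moreover have "g * (real (a + L) - real a) * real (a + L) powr (g - 1) \<le> real (a + L) powr g - real a powr g"
      using g a by (intro powr_diff_bounds) auto
    ultimately have "\<delta> * real L - real (card S) \<le> g * real L * (real a powr (g - 1) - real (a + L) powr (g - 1)) + 1"
      by (simp add: \<delta>_def algebra_simps)
    also have "\<dots> \<le> 1 * real L * (real L * real a powr (g - 2)) + 1"
    proof -
      have "real a powr (g - 1) - real (a + L) powr (g - 1) \<le> (real (a + L) - real a) * real a powr (g - 2)"
        using g a by (intro powr_diff_bounds) auto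
      moreover have "0 \<le> real a powr (g - 1) - real (a + L) powr (g - 1)"
        using g a by (simp add: powr_mono2')
      ultimately show ?thesis using g by (intro add_right_mono mult_mono) auto
    qed
    finally show ?thesis by (simp add: power2_eq_square mult.assoc)
  qed
  moreover have "(\<delta> + 2 * \<Delta> + 1 / real N) * (norm (\<Sum>m\<in>{a..<a+L}. u m) + 2 * real N * B) \<le>
      (real a powr (g - 1) + 2 * \<Delta> + 1 / real N) * (norm (\<Sum>m\<in>{a..<a+L}. u m) + 2 * real N * B)"
    using \<delta> \<open>B \<ge> 0\<close> by (intro mult_right_mono) auto
  ultimately show ?thesis unfolding S_def by (simp add: algebra_simps)
qed

section \<open>Choice of parameters\<close>

lemma eventually_const_mult_powr_le:
  fixes C u v :: real
  assumes "u < v"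
  shows "eventually (\<lambda>a::nat. C * real a powr u \<le> real a powr v) sequentially"
proof -
  have "filterlim (\<lambda>a::nat. real a powr (v - u)) at_top sequentially"
    using assms by (intro filterlim_compose[OF real_powr_at_top] filterlim_real_sequentially) auto
  then have "eventually (\<lambda>a::nat. C \<le> real a powr (v - u)) sequentially"
    by (simp add: filterlim_at_top)
  then show ?thesis
  proof eventually_elim
    case (elim a)
    then have "C * real a powr u \<le> real a powr (v - u) * real a powr u"
      by (intro mult_right_mono) auto
    then show ?case by (simp flip: powr_add)
  qed
qed

lemma power_between:
  fixes x :: real and b :: nat
  assumes "x \<ge> 1" "b \<ge> 2"
  shows "\<exists>n. x \<le> real (b ^ n) \<and> real (b ^ n) \<le> real b * x"
proof -
  have "\<exists>n. x \<le> real (b ^ n)"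
    using real_arch_pow[of "real b" x] assms by (auto intro: less_imp_le)
  then have n: "x \<le> real (b ^ (LEAST n. x \<le> real (b ^ n)))" by (rule LeastI_ex)
  define n where "n = (LEAST n. x \<le> real (b ^ n))"
  have "real (b ^ n) \<le> real b * x"
  proof (cases n)
    case 0
    have "1 * 1 \<le> real b * x" using assms by (intro mult_mono) auto
    then show ?thesis using 0 by simp
  next
    case (Suc m)
    then have "\<not> x \<le> real (b ^ m)" using not_less_Least[of m "\<lambda>n. x \<le> real (b ^ n)"] by (auto simp: n_def)
    then have "real b * real (b ^ m) \<le> real b * x" by (intro mult_left_mono) auto
    then show ?thesis using Suc by simp
  qed
  then show ?thesis using n unfolding n_def by blast
qed

text \<open>Exponent bookkeeping shared by both estimates: \<open>w\<close> is the saving wanted for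
  the squared sum, \<open>E\<close> the contribution peculiar to the case. Each term of the bracket
  has to be at most a constant times \<open>R * x powr (1 - \<epsilon> - w)\<close>.\<close>

lemma mean_square_error_le:
  fixes x \<epsilon> s \<eta> b1 b2 L R Q P1 P2 S Y w :: real
  assumes x: "x \<ge> 1" and b: "b1 \<ge> 1" "b2 \<ge> 1" "Y \<ge> 0"
    and par: "0 < s" "18 * s < 1" "0 < \<epsilon>" "\<epsilon> \<le> s / 20" "w \<ge> 0" "w \<le> 5/2 * s"
    and L: "0 \<le> L" "L \<le> x powr (1 - \<epsilon>)"
    and R: "x powr (18/5 * s) \<le> R" "R \<le> b1 * x powr (18/5 * s)" "R \<le> x powr (1 - \<epsilon>)"
    and P: "x powr (31/5 * s) \<le> P1" "x powr (31/5 * s) \<le> P2" "P1 * P2 \<le> b2 * x powr (62/5 * s)"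
    and E: "E \<le> R * (Y * x powr (1 - \<epsilon> - w))"
    and main: "R * S ^ 2 \<le> (L + R) * (L + 2 * (R * (P1 * P2)) + E + 4 * R ^ 2 * (L / P1 + L / P2 + 2))"
  shows "S ^ 2 \<le> (2 * (1 + 2 * b2 + Y + 16 * b1)) * x powr (2 * (1 - \<epsilon> - w / 2))"
proof -
  define X where "X e = x powr e" for e
  have X1: "X e \<ge> 0" for e by (simp add: X_def)
  have X2: "X d * X e = X (d + e)" for d e by (simp add: X_def powr_add)
  have X3: "d \<le> e \<Longrightarrow> X d \<le> X e" for d e unfolding X_def using x by (intro powr_mono) auto
  have X0: "X 0 = 1" using x by (simp add: X_def)
  have Rp: "R > 0" using R(1) x powr_gt_zero[of x "18/5 * s"] by linarith
  have Pp: "P1 > 0" "P2 > 0" using P(1,2) x powr_gt_zero[of x "31/5 * s"] by linarith+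
  define t where "t = 1 - \<epsilon> - w"
  have LR: "L + R \<le> 2 * X (1 - \<epsilon>)" using L R by (simp add: X_def)
  have "L \<le> R * X t"
  proof -
    have "L \<le> X (1 - \<epsilon>)" using L by (simp add: X_def)
    also have "\<dots> \<le> X (18/5 * s + t)" using par by (intro X3) (simp add: t_def)
    also have "\<dots> = X (18/5 * s) * X t" by (simp only: X2)
    also have "\<dots> \<le> R * X t" using R X1 by (intro mult_right_mono) (auto simp: X_def)
    finally show ?thesis .
  qed
  \<comment> \<open>Periods: 62/5 + 1/20 + 5/2 is below 18, so \<open>18 * s < 1\<close>
    suffices.\<close>
  moreover have "2 * (R * (P1 * P2)) \<le> R * (2 * b2 * X t)"
  proof -
    have "P1 * P2 \<le> b2 * X (62/5 * s)" using P by (simp add: X_def)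
    also have "\<dots> \<le> b2 * X t" using par b by (intro mult_left_mono X3) (auto simp: t_def)
    finally have "R * (P1 * P2) \<le> R * (b2 * X t)" using Rp by (intro mult_left_mono) auto
    then show ?thesis by (simp add: algebra_simps)
  qed
  \<comment> \<open>Carries: period against shift range leaves 31/5 - 18/5 = 13/5, just above the
    largest saving 5/2.\<close>
  moreover have "4 * R ^ 2 * (L / P1 + L / P2 + 2) \<le> R * (16 * b1 * X t)"
  proof -
    have LP: "L / p \<le> X (1 - \<epsilon> - 31/5 * s)" if "x powr (31/5 * s) \<le> p" "p > 0" for p
    proof -
      have "L / p \<le> X (1 - \<epsilon>) / X (31/5 * s)"
        using L that X1 x by (intro frac_le) (auto simp: X_def)
      then show ?thesis by (simp add: X_def powr_diff)
    qed
    have "X 0 \<le> X (1 - \<epsilon> - 31/5 * s)" using par by (intro X3) simp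
    then have "L / P1 + L / P2 + 2 \<le> 4 * X (1 - \<epsilon> - 31/5 * s)"
      using LP[OF P(1) Pp(1)] LP[OF P(2) Pp(2)] X0 by linarith
    then have "R * (L / P1 + L / P2 + 2) \<le> (b1 * X (18/5 * s)) * (4 * X (1 - \<epsilon> - 31/5 * s))"
      using R Rp L Pp b X1 by (intro mult_mono) (auto simp: X_def)
    also have "\<dots> = 4 * b1 * (X (18/5 * s) * X (1 - \<epsilon> - 31/5 * s))" by (simp only: mult_ac)
    also have "\<dots> = 4 * b1 * X (18/5 * s + (1 - \<epsilon> - 31/5 * s))" by (simp only: X2)
    also have "\<dots> \<le> 4 * b1 * X t" using par b by (intro mult_left_mono X3) (auto simp: t_def)
    finally have "4 * R * (R * (L / P1 + L / P2 + 2)) \<le> 4 * R * (4 * b1 * X t)"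
      using Rp by (intro mult_left_mono) auto
    then show ?thesis by (simp add: power2_eq_square algebra_simps)
  qed
  moreover have "E \<le> R * (Y * X t)" using E by (simp add: X_def t_def)
  ultimately have br: "L + 2 * (R * (P1 * P2)) + E + 4 * R ^ 2 * (L / P1 + L / P2 + 2) \<le> R * ((1 + 2 * b2 + Y + 16 * b1) * X t)"
    by (simp add: algebra_simps)
  have "R * S ^ 2 \<le> (L + R) * (R * ((1 + 2 * b2 + Y + 16 * b1) * X t))"
    using br L Rp by (intro order_trans[OF main] mult_left_mono) auto
  also have "\<dots> \<le> (2 * X (1 - \<epsilon>)) * (R * ((1 + 2 * b2 + Y + 16 * b1) * X t))"
    using LR Rp b X1[of t] by (intro mult_right_mono mult_nonneg_nonneg) auto
  also have "\<dots> = R * ((2 * (1 + 2 * b2 + Y + 16 * b1)) * (X (1 - \<epsilon>) * X t))" by (simp add: algebra_simps)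
  finally have "S ^ 2 \<le> (2 * (1 + 2 * b2 + Y + 16 * b1)) * (X (1 - \<epsilon>) * X t)"
    using Rp by (subst (asm) mult_le_cancel_left_pos) auto
  also have "X (1 - \<epsilon>) * X t = X (2 * (1 - \<epsilon> - w / 2))" unfolding X2 by (simp add: t_def algebra_simps)
  finally show ?thesis by (simp add: X_def)
qed

lemma le_of_square_le_powr:
  fixes S C x e :: real
  assumes "S ^ 2 \<le> C * x powr (2 * e)" "x > 0" "C \<ge> 0"
  shows "S \<le> sqrt C * x powr e"
proof -
  have "(sqrt C * x powr e) ^ 2 = C * (x powr e) ^ 2" using assms by (simp add: power_mult_distrib)
  also have "(x powr e) ^ 2 = x powr (2 * e)" by (simp add: power2_eq_square flip: powr_add)
  finally have "S ^ 2 \<le> (sqrt C * x powr e) ^ 2" using assms by simp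
  then show ?thesis by (rule power2_le_imp_le) (use assms(3) in simp)
qed

text \<open>The base \<open>b\<close> with a nontrivial character is part of the result: decay is
  known for lag ranges that are powers of its square, so the shift range has to be chosen
  accordingly.\<close>

lemma sum_corr_product_le:
  assumes q: "q1 \<ge> 2" "q2 \<ge> 2"
    and nontriv: "real (q1 - 1) * \<alpha>1 \<notin> \<int> \<or> real (q2 - 1) * \<alpha>2 \<notin> \<int>"
  shows "\<exists>b\<in>{q1, q2}. \<exists>\<nu><1. \<exists>C\<ge>0. \<forall>\<rho> l1 l2. (b\<^sup>2) ^ \<rho> \<le> (q1\<^sup>2) ^ l1 \<longrightarrow> (b\<^sup>2) ^ \<rho> \<le> (q2\<^sup>2) ^ l2 \<longrightarrow>
    (\<Sum>r<(b\<^sup>2)^\<rho>. norm (cyclic_corr (digit_char q1 \<alpha>1) ((q1\<^sup>2) ^ l1) r) *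
      norm (cyclic_corr (digit_char q2 \<alpha>2) ((q2\<^sup>2) ^ l2) r)) \<le> C * real ((b\<^sup>2)^\<rho>) powr \<nu>"
proof -
  have le1: "norm (cyclic_corr (digit_char q \<alpha>) P r) \<le> 1" for q \<alpha> P r
    by (intro norm_cyclic_corr_le_1) simp
  have ex: "\<rho> \<le> l" if "(q\<^sup>2) ^ \<rho> \<le> (q\<^sup>2) ^ l" "q \<ge> 2" for q \<rho> l :: nat
  proof (rule power_le_imp_le_exp[OF _ that(1)])
    show "1 < q\<^sup>2" using that(2) by (intro one_less_power) auto
  qed
  show ?thesis using nontriv
  proof
    assume "real (q1 - 1) * \<alpha>1 \<notin> \<int>"
    then obtain \<nu> C where \<nu>: "\<nu> < 1" "C \<ge> 0" and C: "\<And>\<rho> l. \<rho> \<le> l \<Longrightarrow>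
      (\<Sum>r<(q1\<^sup>2)^\<rho>. norm (cyclic_corr (digit_char q1 \<alpha>1) ((q1\<^sup>2) ^ l) r)) \<le> C * real ((q1\<^sup>2)^\<rho>) powr \<nu>"
      using sum_digit_char_corr_le[OF q(1)] by metis
    have "(\<Sum>r<(q1\<^sup>2)^\<rho>. norm (cyclic_corr (digit_char q1 \<alpha>1) ((q1\<^sup>2) ^ l1) r) *
      norm (cyclic_corr (digit_char q2 \<alpha>2) ((q2\<^sup>2) ^ l2) r)) \<le> C * real ((q1\<^sup>2)^\<rho>) powr \<nu>"
      if "(q1\<^sup>2) ^ \<rho> \<le> (q1\<^sup>2) ^ l1" for \<rho> l1 l2
      by (rule order_trans[OF sum_mono C[OF ex[OF that q(1)]]]) (simp add: mult_right_le_one_le le1)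
    then show ?thesis using \<nu> by blast
  next
    assume "real (q2 - 1) * \<alpha>2 \<notin> \<int>"
    then obtain \<nu> C where \<nu>: "\<nu> < 1" "C \<ge> 0" and C: "\<And>\<rho> l. \<rho> \<le> l \<Longrightarrow>
      (\<Sum>r<(q2\<^sup>2)^\<rho>. norm (cyclic_corr (digit_char q2 \<alpha>2) ((q2\<^sup>2) ^ l) r)) \<le> C * real ((q2\<^sup>2)^\<rho>) powr \<nu>"
      using sum_digit_char_corr_le[OF q(2)] by metis
    have "(\<Sum>r<(q2\<^sup>2)^\<rho>. norm (cyclic_corr (digit_char q1 \<alpha>1) ((q1\<^sup>2) ^ l1) r) *
      norm (cyclic_corr (digit_char q2 \<alpha>2) ((q2\<^sup>2) ^ l2) r)) \<le> C * real ((q2\<^sup>2)^\<rho>) powr \<nu>"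
      if "(q2\<^sup>2) ^ \<rho> \<le> (q2\<^sup>2) ^ l2" for \<rho> l1 l2
      by (rule order_trans[OF sum_mono C[OF ex[OF that q(2)]]]) (simp add: mult_left_le_one_le le1)
    then show ?thesis using \<nu> by blast
  qed
qed

text \<open>
With \<open>1 - \<gamma> < s < 1/18\<close>: frequencies up to about \<open>a powr (6/5 s)\<close> occur, so the squared sums must save more than
\<open>12/5 s\<close>; a shift range \<open>18/5 s\<close> pays in addition for the Kusmin-Landau loss \<open>s\<close>, and periods \<open>31/5 s\<close> keep
carries rare. The constraint is \<open>h R P\<^sub>1 P\<^sub>2 \<le> a\<close>, that is \<open>(6 + 18 + 62)/5 s = 86/5 s < 1\<close>.
\<close>

definition admissible_params :: "real \<Rightarrow> real \<Rightarrow> real \<Rightarrow> real \<Rightarrow> nat \<Rightarrow> nat \<Rightarrow> nat \<Rightarrow> nat \<Rightarrow> nat \<Rightarrow> bool" where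
  "admissible_params s \<epsilon> b1 b2 a L R P1 P2 \<longleftrightarrow>
     real L \<le> real a powr (1 - \<epsilon>) \<and>
     real a powr (18/5 * s) \<le> real R \<and> real R \<le> b1 * real a powr (18/5 * s) \<and>
     real a powr (31/5 * s) \<le> real P1 \<and> real a powr (31/5 * s) \<le> real P2 \<and>
     real P1 * real P2 \<le> b2 * real a powr (62/5 * s)"

text \<open>Uniformity in \<open>\<alpha>1\<close> and \<open>\<alpha>2\<close> lets the bound apply
  to a product of digit characters, to its conjugate and to the constant 1. The saving 5/4 s exceeds
  the exponent 6/5 s of the number of frequencies by s/20.\<close>

lemma digit_char_powr_sum_bound:
  fixes q1 q2 :: nat and g s \<epsilon> b1 b2 :: real
  assumes q: "q1 \<ge> 2" "q2 \<ge> 2" and g: "0 < g" "g < 1" and s: "s = 1 - g + \<epsilon>"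
    and par: "18 * s < 1" "0 < \<epsilon>" "\<epsilon> \<le> s / 20" and b: "b1 \<ge> 1" "b2 \<ge> 1"
  shows "\<exists>C\<ge>0. eventually (\<lambda>a. \<forall>L R l1 l2 h \<alpha>1 \<alpha>2.
    admissible_params s \<epsilon> b1 b2 a L R (q1 ^ l1) (q2 ^ l2) \<longrightarrow> 1 \<le> h \<longrightarrow> real h \<le> 12 * real a powr (6/5 * s) \<longrightarrow>
    norm (\<Sum>m\<in>{a..<a+L}. digit_char q1 \<alpha>1 m * digit_char q2 \<alpha>2 m * unit_exp (real h * real m powr g))
      \<le> C * real a powr (1 - \<epsilon> - 5/4 * s)) sequentially"
proof -
  define A where "A = 32 / (g * (1 - g))"
  have A: "A \<ge> 0" using g by (simp add: A_def)
  define Y where "Y = A * (37 * b1)"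
  define C where "C = sqrt (2 * (1 + 2 * b2 + Y + 16 * b1))"
  have Y: "Y \<ge> 0" using A b by (simp add: Y_def)
  have s0: "s > 0" using par g s by simp
  have "eventually (\<lambda>a::nat. (12 * b1 * b2) * real a powr (86/5 * s) \<le> real a powr 1) sequentially"
    using par by (intro eventually_const_mult_powr_le) simp
  moreover have "eventually (\<lambda>a::nat. (2 * b2) * real a powr (62/5 * s) \<le> real a powr 1) sequentially"
    using par by (intro eventually_const_mult_powr_le) simp
  moreover have "eventually (\<lambda>a::nat. b1 * real a powr (18/5 * s) \<le> real a powr (1 - \<epsilon>)) sequentially"
    using par s0 by (intro eventually_const_mult_powr_le) simp
  ultimately have "eventually (\<lambda>a. \<forall>L R l1 l2 h \<alpha>1 \<alpha>2.
    admissible_params s \<epsilon> b1 b2 a L R (q1 ^ l1) (q2 ^ l2) \<longrightarrow> 1 \<le> h \<longrightarrow> real h \<le> 12 * real a powr (6/5 * s) \<longrightarrow>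
    norm (\<Sum>m\<in>{a..<a+L}. digit_char q1 \<alpha>1 m * digit_char q2 \<alpha>2 m * unit_exp (real h * real m powr g))
      \<le> C * real a powr (1 - \<epsilon> - 5/4 * s)) sequentially"
    using eventually_ge_at_top[of 1]
  proof eventually_elim
    case (elim a)
    show ?case
    proof (intro allI impI)
      fix L R l1 l2 h :: nat and \<alpha>1 \<alpha>2 :: real
      assume adm: "admissible_params s \<epsilon> b1 b2 a L R (q1 ^ l1) (q2 ^ l2)"
        and h: "1 \<le> h" "real h \<le> 12 * real a powr (6/5 * s)"
      define x where "x = real a"
      define P1 P2 where "P1 = q1 ^ l1" and "P2 = q2 ^ l2"
      have x: "x \<ge> 1" using elim by (simp add: x_def)
      have L: "real L \<le> x powr (1 - \<epsilon>)" and R: "x powr (18/5 * s) \<le> real R" "real R \<le> b1 * x powr (18/5 * s)"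
        and P: "x powr (31/5 * s) \<le> real P1" "x powr (31/5 * s) \<le> real P2" "real P1 * real P2 \<le> b2 * x powr (62/5 * s)"
        using adm unfolding admissible_params_def x_def P1_def P2_def by blast+
      have RL: "real R \<le> x powr (1 - \<epsilon>)" using R(2) elim by (simp add: x_def)
      have "x powr (18/5 * s) \<ge> 1" using x s0 by (intro ge_one_powr_ge_zero) auto
      then have R1: "1 \<le> R" using R(1) by linarith
      have x1: "x powr (1 - \<epsilon>) \<le> x" using x par powr_mono[of "1 - \<epsilon>" 1 x] by simp
      have "real (L + 2 * (P1 * P2) + R) \<le> x + x + x"
        using L RL x1 P(3) elim by (simp add: x_def)
      then have "real (L + 2 * (P1 * P2) + R) \<le> real (3 * a)" by (simp add: x_def)
      then have size: "L + 2 * (P1 * P2) + R \<le> 3 * a" by (simp only: of_nat_le_iff)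
      have "real (h * R * (P1 * P2)) = real h * real R * (real P1 * real P2)" by simp
      also have "\<dots> \<le> (12 * x powr (6/5 * s)) * (b1 * x powr (18/5 * s)) * (b2 * x powr (62/5 * s))"
        by (intro mult_mono[OF mult_mono[OF h(2)[folded x_def] R(2)] P(3)]) (use b in auto)
      also have "\<dots> = (12 * b1 * b2) * (x powr (6/5 * s) * x powr (18/5 * s) * x powr (62/5 * s))" by (simp only: mult_ac)
      also have "x powr (6/5 * s) * x powr (18/5 * s) * x powr (62/5 * s) = x powr (86/5 * s)"
        by (simp flip: powr_add)
      also have "(12 * b1 * b2) * x powr (86/5 * s) \<le> x" using elim by (simp add: x_def)
      finally have hRQ: "h * R * (P1 * P2) \<le> a" unfolding x_def of_nat_le_iff .
      define S where "S = norm (\<Sum>m\<in>{a..<a+L}. digit_char q1 \<alpha>1 m * digit_char q2 \<alpha>2 m * unit_exp (real h * real m powr g))"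
      have main: "real R * S ^ 2 \<le> (real L + real R) * (real L + 2 * (real R * (real P1 * real P2)) +
          A * x powr (2 - g) * (1 + ln (real R)) + 4 * real R ^ 2 * (real L / real P1 + real L / real P2 + 2))"
        using digit_char_powr_mean_square_le[OF q g h(1) R1 _ size[unfolded P1_def P2_def] hRQ[unfolded P1_def P2_def]] elim(4)
        unfolding S_def A_def x_def P1_def P2_def by simp
      \<comment> \<open>The logarithm costs s/10, from 18/5 s divided by 36. As 2 - g = 1 -
        \<epsilon> + s, the total s + s/10 equals 18/5 s - 5/2 s: this fixes the saving 5/2 s of the
        squared sum.\<close>
      have E: "A * x powr (2 - g) * (1 + ln (real R)) \<le> real R * (Y * x powr (1 - \<epsilon> - 5/2 * s))"
      proof -
        have "ln (real R) \<le> real R powr (1/36) / (1/36)" using R1 by (intro ln_powr_bound) auto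
        also have "\<dots> = 36 * real R powr (1/36)" by simp
        also have "real R powr (1/36) \<le> (b1 * x powr (18/5 * s)) powr (1/36)" using R by (intro powr_mono2) auto
        also have "\<dots> = b1 powr (1/36) * x powr (s/10)" using b by (simp add: powr_mult powr_powr)
        also have "\<dots> \<le> b1 * x powr (s/10)"
          using b powr_mono[of "1/36" 1 b1] by (intro mult_right_mono) auto
        finally have "ln (real R) \<le> 36 * (b1 * x powr (s/10))" by simp
        moreover have "1 * 1 \<le> b1 * x powr (s/10)" using b x s0 by (intro mult_mono ge_one_powr_ge_zero) auto
        ultimately have "1 + ln (real R) \<le> 37 * (b1 * x powr (s/10))" by simp
        then have "A * x powr (2 - g) * (1 + ln (real R)) \<le> A * x powr (2 - g) * (37 * (b1 * x powr (s/10)))"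
          using A by (intro mult_left_mono) auto
        also have "\<dots> = Y * (x powr (2 - g) * x powr (s/10))" by (simp add: Y_def)
        also have "x powr (2 - g) * x powr (s/10) = x powr (18/5 * s) * x powr (1 - \<epsilon> - 5/2 * s)"
        proof -
          have "2 - g + s/10 = 18/5 * s + (1 - \<epsilon> - 5/2 * s)" using s by linarith
          then show ?thesis by (simp only: powr_add[symmetric])
        qed
        also have "Y * (x powr (18/5 * s) * x powr (1 - \<epsilon> - 5/2 * s)) \<le> Y * (real R * x powr (1 - \<epsilon> - 5/2 * s))"
          using R Y by (intro mult_left_mono mult_right_mono) auto
        finally show ?thesis by (simp add: mult_ac)
      qed
      have "S ^ 2 \<le> (2 * (1 + 2 * b2 + Y + 16 * b1)) * x powr (2 * (1 - \<epsilon> - (5/2 * s) / 2))"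
        by (rule mean_square_error_le[OF x b Y s0 par _ _ _ L R RL P E main]) (use s0 in auto)
      then have "S \<le> C * x powr (1 - \<epsilon> - (5/2 * s) / 2)"
        unfolding C_def using x b Y by (intro le_of_square_le_powr) auto
      then show "norm (\<Sum>m\<in>{a..<a+L}. digit_char q1 \<alpha>1 m * digit_char q2 \<alpha>2 m * unit_exp (real h * real m powr g))
        \<le> C * real a powr (1 - \<epsilon> - 5/4 * s)" by (simp add: S_def x_def)
    qed
  qed
  moreover have "C \<ge> 0" unfolding C_def using b Y by simp
  ultimately show ?thesis by blast
qed

lemma digit_char_sum_bound:
  fixes q1 q2 :: nat and s \<epsilon> b1 b2 \<nu> D :: real
  assumes q: "q1 \<ge> 2" "q2 \<ge> 2" "coprime q1 q2"
    and par: "0 < s" "18 * s < 1" "0 < \<epsilon>" "\<epsilon> \<le> s / 20" and b: "b1 \<ge> 1" "b2 \<ge> 1" and \<nu>: "\<nu> < 1" "D \<ge> 0"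
  shows "\<exists>\<eta>>0. \<exists>C\<ge>0. eventually (\<lambda>a. \<forall>L R l1 l2 \<alpha>1 \<alpha>2.
    admissible_params s \<epsilon> b1 b2 a L R (q1 ^ l1) (q2 ^ l2) \<longrightarrow>
    (\<Sum>r<R. norm (cyclic_corr (digit_char q1 \<alpha>1) (q1 ^ l1) r) *
      norm (cyclic_corr (digit_char q2 \<alpha>2) (q2 ^ l2) r)) \<le> D * real R powr \<nu> \<longrightarrow>
    norm (\<Sum>m\<in>{a..<a+L}. digit_char q1 \<alpha>1 m * digit_char q2 \<alpha>2 m)
      \<le> C * real a powr (1 - \<epsilon> - \<eta>)) sequentially"
proof -
  \<comment> \<open>The average of the correlations over \<open>R\<close> lags saves
    \<open>R powr (1 - \<nu>)\<close>, and \<open>R\<close> is at least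
    \<open>a powr (18/5 * s)\<close>; the cap 5/2 s is what the other error terms allow.\<close>
  define w where "w = min (5/2 * s) (18/5 * s * (1 - \<nu>))"
  have w: "0 < w" "w \<le> 5/2 * s" "w \<le> 18/5 * s * (1 - \<nu>)" using par \<nu> by (auto simp: w_def)
  define Y where "Y = 2 * D"
  define C where "C = sqrt (2 * (1 + 2 * b2 + Y + 16 * b1))"
  have Y: "Y \<ge> 0" using \<nu> by (simp add: Y_def)
  have "eventually (\<lambda>a::nat. b1 * real a powr (18/5 * s) \<le> real a powr (1 - \<epsilon>)) sequentially"
    using par by (intro eventually_const_mult_powr_le) simp
  then have "eventually (\<lambda>a. \<forall>L R l1 l2 \<alpha>1 \<alpha>2.
    admissible_params s \<epsilon> b1 b2 a L R (q1 ^ l1) (q2 ^ l2) \<longrightarrow>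
    (\<Sum>r<R. norm (cyclic_corr (digit_char q1 \<alpha>1) (q1 ^ l1) r) *
      norm (cyclic_corr (digit_char q2 \<alpha>2) (q2 ^ l2) r)) \<le> D * real R powr \<nu> \<longrightarrow>
    norm (\<Sum>m\<in>{a..<a+L}. digit_char q1 \<alpha>1 m * digit_char q2 \<alpha>2 m)
      \<le> C * real a powr (1 - \<epsilon> - w / 2)) sequentially"
    using eventually_ge_at_top[of 1]
  proof eventually_elim
    case (elim a)
    show ?case
    proof (intro allI impI)
      fix L R l1 l2 :: nat and \<alpha>1 \<alpha>2 :: real
      assume adm: "admissible_params s \<epsilon> b1 b2 a L R (q1 ^ l1) (q2 ^ l2)"
      define x where "x = real a"
      define P1 P2 where "P1 = q1 ^ l1" and "P2 = q2 ^ l2"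
      define T where "T = (\<Sum>r<R. norm (cyclic_corr (digit_char q1 \<alpha>1) (q1 ^ l1) r) *
        norm (cyclic_corr (digit_char q2 \<alpha>2) (q2 ^ l2) r))"
      assume "(\<Sum>r<R. norm (cyclic_corr (digit_char q1 \<alpha>1) (q1 ^ l1) r) *
        norm (cyclic_corr (digit_char q2 \<alpha>2) (q2 ^ l2) r)) \<le> D * real R powr \<nu>"
      then have T: "T \<le> D * real R powr \<nu>" by (simp add: T_def)
      have x: "x \<ge> 1" using elim by (simp add: x_def)
      have L: "real L \<le> x powr (1 - \<epsilon>)" and R: "x powr (18/5 * s) \<le> real R" "real R \<le> b1 * x powr (18/5 * s)"
        and P: "x powr (31/5 * s) \<le> real P1" "x powr (31/5 * s) \<le> real P2" "real P1 * real P2 \<le> b2 * x powr (62/5 * s)"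
        using adm unfolding admissible_params_def x_def P1_def P2_def by blast+
      have RL: "real R \<le> x powr (1 - \<epsilon>)" using R(2) elim by (simp add: x_def)
      have "x powr (18/5 * s) \<ge> 1" using x par by (intro ge_one_powr_ge_zero) auto
      then have R1: "1 \<le> real R" using R(1) by linarith
      define S where "S = norm (\<Sum>m\<in>{a..<a+L}. digit_char q1 \<alpha>1 m * digit_char q2 \<alpha>2 m)"
      have main: "real R * S ^ 2 \<le> (real L + real R) * (real L + 2 * (real R * (real P1 * real P2)) +
          2 * real L * T + 4 * real R ^ 2 * (real L / real P1 + real L / real P2 + 2))"
        using digit_char_mean_square_le[OF q, where R = R and a = a and L = L and ?l1.0 = l1 and ?l2.0 = l2 and ?\<alpha>1.0 = \<alpha>1 and ?\<alpha>2.0 = \<alpha>2]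
        unfolding S_def x_def P1_def P2_def T_def by simp
      have E: "2 * real L * T \<le> real R * (Y * x powr (1 - \<epsilon> - w))"
      proof -
        have "real R powr \<nu> = real R * real R powr (\<nu> - 1)"
          using R1 by (simp add: powr_diff)
        also have "\<dots> \<le> real R * (x powr (18/5 * s)) powr (\<nu> - 1)"
          using R x \<nu> by (intro mult_left_mono powr_mono2') auto
        also have "\<dots> = real R * x powr (18/5 * s * (\<nu> - 1))" by (simp add: powr_powr)
        also have "\<dots> \<le> real R * x powr (- w)"
          using x w by (intro mult_left_mono powr_mono) (auto simp: algebra_simps)
        finally have "T \<le> D * (real R * x powr (- w))"
          using T mult_left_mono[OF _ \<nu>(2)] order_trans by blast
        then have "2 * real L * T \<le> 2 * x powr (1 - \<epsilon>) * (D * (real R * x powr (- w)))"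
          using L by (intro mult_mono) (auto simp: T_def intro!: sum_nonneg)
        also have "\<dots> = real R * (Y * (x powr (1 - \<epsilon>) * x powr (- w)))" by (simp add: Y_def)
        also have "x powr (1 - \<epsilon>) * x powr (- w) = x powr (1 - \<epsilon> - w)" by (simp flip: powr_add)
        finally show ?thesis .
      qed
      have "S ^ 2 \<le> (2 * (1 + 2 * b2 + Y + 16 * b1)) * x powr (2 * (1 - \<epsilon> - w / 2))"
        by (rule mean_square_error_le[OF x b Y par _ w(2) _ L R RL P E main]) (use w in auto)
      then have "S \<le> C * x powr (1 - \<epsilon> - w / 2)"
        unfolding C_def using x b Y by (intro le_of_square_le_powr) auto
      then show "norm (\<Sum>m\<in>{a..<a+L}. digit_char q1 \<alpha>1 m * digit_char q2 \<alpha>2 m)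
        \<le> C * real a powr (1 - \<epsilon> - w / 2)" by (simp add: S_def x_def)
    qed
  qed
  moreover have "C \<ge> 0" unfolding C_def using b Y by simp
  moreover have "w / 2 > 0" using w by simp
  ultimately show ?thesis by blast
qed

lemma cnj_digit_char: "cnj (digit_char q \<alpha> n) = digit_char q (- \<alpha>) n"
  by (simp add: digit_char_def cnj_unit_exp)

lemma digit_char_zero [simp]: "digit_char q 0 n = 1"
  by (simp add: digit_char_def)

lemma ps_range_block_bound:
  fixes q1 q2 :: nat and \<alpha>1 \<alpha>2 c :: real
  assumes q: "q1 \<ge> 2" "q2 \<ge> 2" "coprime q1 q2" and c: "1 < c" "c < 18 / 17"
    and nontriv: "real (q1 - 1) * \<alpha>1 \<notin> \<int> \<or> real (q2 - 1) * \<alpha>2 \<notin> \<int>"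
  shows "\<exists>\<epsilon>>0. \<exists>\<eta>>0. \<exists>C\<ge>0. \<epsilon> + \<eta> < 1 / c \<and> eventually (\<lambda>a. \<forall>L. real L \<le> real a powr (1 - \<epsilon>) \<longrightarrow>
    norm (\<Sum>m\<in>ps_range c \<inter> {a..<a+L}. digit_char q1 \<alpha>1 m * digit_char q2 \<alpha>2 m) \<le> C * real a powr (1 / c - \<epsilon> - \<eta>)) sequentially"
proof -
  define g where "g = 1 / c"
  have g: "17 / 18 < g" "g < 1" using c by (auto simp: g_def field_simps)
  \<comment> \<open>The first bound gives \<open>\<epsilon> \<le> s / 20\<close>; the second keeps
    \<open>s\<close> below 1/18, which is possible because \<open>c < 18 / 17\<close> means
    \<open>1 - g < 1 / 18\<close>.\<close>
  define \<epsilon> where "\<epsilon> = min ((1 - g) / 20) ((1 / 18 - (1 - g)) / 2)"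
  define s where "s = 1 - g + \<epsilon>"
  have "0 < \<epsilon>" using g by (simp add: \<epsilon>_def)
  moreover have "\<epsilon> \<le> (1 - g) / 20" unfolding \<epsilon>_def by (rule min.cobounded1)
  moreover have "\<epsilon> \<le> (1 / 18 - (1 - g)) / 2" unfolding \<epsilon>_def by (rule min.cobounded2)
  ultimately have \<epsilon>: "0 < \<epsilon>" "\<epsilon> \<le> (1 - g) / 20" "\<epsilon> \<le> (1 / 18 - (1 - g)) / 2" .
  have par: "18 * s < 1" "0 < \<epsilon>" "\<epsilon> \<le> s / 20" and s0: "0 < s"
    using \<epsilon> g unfolding s_def by (auto simp: field_simps)
  obtain b \<nu> D where b: "b \<in> {q1, q2}" and \<nu>: "\<nu> < 1" "D \<ge> 0" and corr: "\<And>\<rho> l1 l2. (b\<^sup>2) ^ \<rho> \<le> (q1\<^sup>2) ^ l1 \<Longrightarrow> (b\<^sup>2) ^ \<rho> \<le> (q2\<^sup>2) ^ l2 \<Longrightarrow>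
    (\<Sum>r<(b\<^sup>2)^\<rho>. norm (cyclic_corr (digit_char q1 \<alpha>1) ((q1\<^sup>2) ^ l1) r) *
      norm (cyclic_corr (digit_char q2 \<alpha>2) ((q2\<^sup>2) ^ l2) r)) \<le> D * real ((b\<^sup>2)^\<rho>) powr \<nu>"
    using sum_corr_product_le[OF q(1,2) nontriv]
    by (elim bexE exE conjE) (erule that, assumption, assumption, blast)
  have sq2: "2 \<le> n\<^sup>2" if "2 \<le> n" for n :: nat
    using that power_mono[of 2 n 2] by simp
  have b2: "2 \<le> b\<^sup>2" "2 \<le> q1\<^sup>2" "2 \<le> q2\<^sup>2" using b q sq2 by auto
  define b1' where "b1' = real (b\<^sup>2)"
  define b2' where "b2' = real (q1\<^sup>2) * real (q2\<^sup>2)"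
  have b': "b1' \<ge> 1" "b2' \<ge> 1"
  proof -
    show "b1' \<ge> 1" using b2(1) unfolding b1'_def by linarith
    have "1 * 1 \<le> real (q1\<^sup>2) * real (q2\<^sup>2)" using b2(2,3) by (intro mult_mono) linarith+
    then show "b2' \<ge> 1" by (simp add: b2'_def)
  qed
  obtain C1 where C1: "C1 \<ge> 0" and T: "eventually (\<lambda>a. \<forall>L R l1 l2 h \<alpha>1 \<alpha>2.
    admissible_params s \<epsilon> b1' b2' a L R (q1 ^ l1) (q2 ^ l2) \<longrightarrow> 1 \<le> h \<longrightarrow> real h \<le> 12 * real a powr (6/5 * s) \<longrightarrow>
    norm (\<Sum>m\<in>{a..<a+L}. digit_char q1 \<alpha>1 m * digit_char q2 \<alpha>2 m * unit_exp (real h * real m powr g))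
      \<le> C1 * real a powr (1 - \<epsilon> - 5/4 * s)) sequentially"
    using digit_char_powr_sum_bound[OF q(1,2) _ g(2) s_def par b'] g by auto
  obtain \<eta>0 C2 where \<eta>0: "\<eta>0 > 0" and C2: "C2 \<ge> 0" and S: "eventually (\<lambda>a. \<forall>L R l1 l2 \<alpha>1 \<alpha>2.
    admissible_params s \<epsilon> b1' b2' a L R (q1 ^ l1) (q2 ^ l2) \<longrightarrow>
    (\<Sum>r<R. norm (cyclic_corr (digit_char q1 \<alpha>1) (q1 ^ l1) r) *
      norm (cyclic_corr (digit_char q2 \<alpha>2) (q2 ^ l2) r)) \<le> D * real R powr \<nu> \<longrightarrow>
    norm (\<Sum>m\<in>{a..<a+L}. digit_char q1 \<alpha>1 m * digit_char q2 \<alpha>2 m)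
      \<le> C2 * real a powr (1 - \<epsilon> - \<eta>0)) sequentially"
    using digit_char_sum_bound[OF q s0 par b' \<nu>] by auto
  \<comment> \<open>Three limits: the saving of the untwisted sum, the margin 5/4 s - 6/5 s of the
    twisted sums, and \<open>\<epsilon>\<close> from the smoothing width and the drift of the
    interval length.\<close>
  define \<eta> where "\<eta> = min (min \<eta>0 (s / 20)) \<epsilon>"
  have \<eta>: "0 < \<eta>" "\<eta> \<le> \<eta>0" "\<eta> \<le> s / 20" "\<eta> \<le> \<epsilon>" using \<eta>0 s0 \<epsilon> by (auto simp: \<eta>_def)
  define C where "C = 4 * (C2 + 24 * C1) + 29"
  \<comment> \<open>Ensures that the shift range stays below both periods, as the correlation
    estimate demands.\<close>
  have "eventually (\<lambda>a::nat. b1' * real a powr (18/5 * s) \<le> real a powr (31/5 * s)) sequentially"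
    using s0 by (intro eventually_const_mult_powr_le) simp
  with T S have "eventually (\<lambda>a. \<forall>L. real L \<le> real a powr (1 - \<epsilon>) \<longrightarrow>
    norm (\<Sum>m\<in>ps_range c \<inter> {a..<a+L}. digit_char q1 \<alpha>1 m * digit_char q2 \<alpha>2 m) \<le> C * real a powr (g - \<epsilon> - \<eta>)) sequentially"
    using eventually_ge_at_top[of 1]
  proof eventually_elim
    case (elim a)
    show ?case
    proof (intro allI impI)
      fix L assume L: "real L \<le> real a powr (1 - \<epsilon>)"
      define x where "x = real a"
      have x: "x \<ge> 1" using elim by (simp add: x_def)
      define X where "X e = x powr e" for e
      have X1: "X e \<ge> 0" for e by (simp add: X_def)
      have X2: "X d * X e = X (d + e)" for d e by (simp add: X_def powr_add)
      have X3: "d \<le> e \<Longrightarrow> X d \<le> X e" for d e unfolding X_def using x by (intro powr_mono) auto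
      have X4: "1 \<le> X e" if "e \<ge> 0" for e unfolding X_def using x that by (intro ge_one_powr_ge_zero) auto
      obtain \<rho> where \<rho>: "X (18/5 * s) \<le> real ((b\<^sup>2) ^ \<rho>)" "real ((b\<^sup>2) ^ \<rho>) \<le> b1' * X (18/5 * s)"
        using power_between[OF X4 b2(1), of "18/5 * s"] s0 unfolding b1'_def by auto
      obtain l1 where l1: "X (31/5 * s) \<le> real ((q1\<^sup>2) ^ l1)" "real ((q1\<^sup>2) ^ l1) \<le> real (q1\<^sup>2) * X (31/5 * s)"
        using power_between[OF X4 b2(2), of "31/5 * s"] s0 by auto
      obtain l2 where l2: "X (31/5 * s) \<le> real ((q2\<^sup>2) ^ l2)" "real ((q2\<^sup>2) ^ l2) \<le> real (q2\<^sup>2) * X (31/5 * s)"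
        using power_between[OF X4 b2(3), of "31/5 * s"] s0 by auto
      define R where "R = (b\<^sup>2) ^ \<rho>"
      have pw: "(q1\<^sup>2) ^ l1 = q1 ^ (2 * l1)" "(q2\<^sup>2) ^ l2 = q2 ^ (2 * l2)" by (simp_all only: power_mult)
      have "real ((q1\<^sup>2) ^ l1) * real ((q2\<^sup>2) ^ l2) \<le> (real (q1\<^sup>2) * X (31/5 * s)) * (real (q2\<^sup>2) * X (31/5 * s))"
        using l1 l2 X1 by (intro mult_mono) auto
      also have "\<dots> = b2' * (X (31/5 * s) * X (31/5 * s))" by (simp only: b2'_def mult_ac)
      also have "X (31/5 * s) * X (31/5 * s) = X (62/5 * s)" unfolding X2 by simp
      finally have adm: "admissible_params s \<epsilon> b1' b2' a L R (q1 ^ (2 * l1)) (q2 ^ (2 * l2))"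
        using L \<rho> l1 l2 unfolding admissible_params_def R_def pw X_def x_def by blast
      have R31: "real R \<le> X (31/5 * s)"
        using \<rho>(2) elim(3) unfolding R_def X_def x_def by linarith
      have "real R \<le> real ((q1\<^sup>2) ^ l1)" "real R \<le> real ((q2\<^sup>2) ^ l2)" using R31 l1 l2 by linarith+
      then have Rle: "(b\<^sup>2) ^ \<rho> \<le> (q1\<^sup>2) ^ l1" "(b\<^sup>2) ^ \<rho> \<le> (q2\<^sup>2) ^ l2" by (simp_all only: R_def of_nat_le_iff)
      define P where "P = nat \<lceil>X (6/5 * s)\<rceil>"
      have "X (6/5 * s) \<ge> 1" using s0 by (intro X4) simp
      then have P: "X (6/5 * s) \<le> real P" "real P \<le> 2 * X (6/5 * s)" "P \<ge> 1"
        unfolding P_def by linarith+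
      define u where "u m = digit_char q1 \<alpha>1 m * digit_char q2 \<alpha>2 m" for m
      define B where "B = C1 * X (1 - \<epsilon> - 5/4 * s)"
      have B0: "B \<ge> 0" using C1 X1 by (simp add: B_def)
      have Tb: "norm (\<Sum>m\<in>{a..<a+L}. digit_char q1 \<beta>1 m * digit_char q2 \<beta>2 m * unit_exp (real h * real m powr g)) \<le> B"
        if "h \<in> {1..<6*P}" for h \<beta>1 \<beta>2
      proof -
        have "real h \<le> 6 * real P" using that by simp
        then have h: "1 \<le> h" "real h \<le> 12 * real a powr (6/5 * s)" using that P(2) unfolding X_def x_def by auto
        show ?thesis using elim(1) adm h unfolding B_def X_def x_def by blast
      qed
      have Sb: "norm (\<Sum>m\<in>{a..<a+L}. u m) \<le> C2 * X (1 - \<epsilon> - \<eta>0)"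
        using elim(2) adm corr[OF Rle] unfolding u_def X_def x_def pw R_def[symmetric] by blast
      define N where "N = 6 * P"
      \<comment> \<open>The smoothing width a^(-s) is finer than the interval length a^(g - 1) by
        a^(-\<epsilon>). Width times \<open>P\<close> is at least a^(s/5), and \<open>k = 6\<close>
        is the least power with 6/5 - 2 k/5 \<le> -1, so the tail is no larger in order than the
        smoothing error.\<close>
      define \<tau> where "\<tau> = real N / (2 * X (- s) * real P) ^ (2 * 6)"
      have N: "X s \<le> real N" "real N \<le> 12 * X (6/5 * s)" "real N > 0"
      proof -
        have "X s \<le> X (6/5 * s)" using s0 by (intro X3) simp
        then show "X s \<le> real N" using P by (simp add: N_def)
        show "real N \<le> 12 * X (6/5 * s)" "real N > 0" using P by (auto simp: N_def)
      qed
      have invN: "1 / real N \<le> X (- s)"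
      proof -
        have "1 / real N \<le> 1 / X s" using N x by (intro divide_left_mono) (auto simp: X_def)
        then show ?thesis by (simp add: X_def powr_minus field_simps)
      qed
      have \<tau>: "\<tau> \<le> 12 * X (- s)"
      proof -
        have "X (s / 5) = X (- s) * X (6/5 * s)" unfolding X2 by simp
        also have "\<dots> \<le> X (- s) * real P" using P X1 by (intro mult_left_mono) auto
        also have "\<dots> \<le> 2 * X (- s) * real P" using X1[of "- s"] by simp
        finally have "X (s / 5) ^ 12 \<le> (2 * X (- s) * real P) ^ 12" using X1 by (intro power_mono) auto
        moreover have "X (s / 5) ^ 12 = X (12/5 * s)"
        proof -
          have "X (s / 5) ^ 12 = (x powr (s / 5)) powr real 12"
            unfolding X_def using x by (intro powr_realpow[symmetric]) simp
          also have "\<dots> = x powr (s / 5 * real 12)" by (rule powr_powr)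
          also have "s / 5 * real 12 = 12/5 * s" by simp
          finally show ?thesis by (simp only: X_def)
        qed
        ultimately have le: "X (12/5 * s) \<le> (2 * X (- s) * real P) ^ 12" by simp
        have "\<tau> \<le> (12 * X (6/5 * s)) / X (12/5 * s)"
          unfolding \<tau>_def using N(2) le x X1 by (intro frac_le) (auto simp: X_def)
        also have "\<dots> = 12 * X (6/5 * s - 12/5 * s)" unfolding X_def powr_diff by simp
        also have "\<dots> \<le> 12 * X (- s)" using s0 by (intro mult_left_mono X3) auto
        finally show ?thesis .
      qed
      have "norm (\<Sum>m\<in>ps_range c \<inter> {a..<a+L}. u m) \<le>
        (real a powr (1 / c - 1) + 2 * X (- s) + 1 / real (6 * P)) * (norm (\<Sum>m\<in>{a..<a+L}. u m) + 2 * real (6 * P) * B) +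
        (2 * X (- s) + 1 / real (6 * P) + 2 * (real (6 * P) / (2 * X (- s) * real P) ^ (2 * 6))) * real L + real L ^ 2 * real a powr (1 / c - 2) + 1"
      proof (rule norm_sum_ps_range_block_le)
        fix h assume h: "h \<in> {1..<6*P}"
        show "norm (\<Sum>m\<in>{a..<a+L}. u m * unit_exp (real h * real m powr (1 / c))) \<le> B"
          using Tb[OF h, of \<alpha>1 \<alpha>2] by (simp add: u_def g_def)
        show "norm (\<Sum>m\<in>{a..<a+L}. cnj (u m) * unit_exp (real h * real m powr (1 / c))) \<le> B"
          using Tb[OF h, of "- \<alpha>1" "- \<alpha>2"] by (simp add: u_def g_def cnj_digit_char)
        show "norm (\<Sum>m\<in>{a..<a+L}. unit_exp (real h * real m powr (1 / c))) \<le> B"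
          using Tb[OF h, of 0 0] by (simp add: g_def)
      qed (use c elim P B0 x in \<open>auto simp: u_def norm_mult X_def\<close>)
      then have main: "norm (\<Sum>m\<in>ps_range c \<inter> {a..<a+L}. u m) \<le>
        (X (g - 1) + 2 * X (- s) + 1 / real N) * (norm (\<Sum>m\<in>{a..<a+L}. u m) + 2 * real N * B) +
        (2 * X (- s) + 1 / real N + 2 * \<tau>) * real L + real L ^ 2 * X (g - 2) + 1"
        by (simp only: N_def \<tau>_def X_def x_def g_def)
      define e where "e = g - \<epsilon> - \<eta>"
      have t1: "(X (g - 1) + 2 * X (- s) + 1 / real N) * (norm (\<Sum>m\<in>{a..<a+L}. u m) + 2 * real N * B) \<le> 4 * (C2 + 24 * C1) * X e"
      proof -
        have "X (- s) \<le> X (g - 1)" using \<epsilon> by (intro X3) (simp add: s_def)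
        then have "X (g - 1) + 2 * X (- s) + 1 / real N \<le> 4 * X (g - 1)" using invN by linarith
        moreover have "norm (\<Sum>m\<in>{a..<a+L}. u m) + 2 * real N * B \<le> (C2 + 24 * C1) * X (1 - \<epsilon> - \<eta>)"
        proof -
          have 1: "C2 * X (1 - \<epsilon> - \<eta>0) \<le> C2 * X (1 - \<epsilon> - \<eta>)" using C2 \<eta> by (intro mult_left_mono X3) auto
          have "real N * B \<le> (12 * X (6/5 * s)) * B" using N B0 by (intro mult_right_mono) auto
          also have "\<dots> = 12 * C1 * (X (6/5 * s) * X (1 - \<epsilon> - 5/4 * s))" by (simp add: B_def)
          also have "\<dots> \<le> 12 * C1 * X (1 - \<epsilon> - \<eta>)"
            unfolding X2 using C1 \<eta> by (intro mult_left_mono X3) auto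
          finally have 2: "real N * B \<le> 12 * C1 * X (1 - \<epsilon> - \<eta>)" .
          have "norm (\<Sum>m\<in>{a..<a+L}. u m) + 2 * real N * B = norm (\<Sum>m\<in>{a..<a+L}. u m) + 2 * (real N * B)" by simp
          also have "\<dots> \<le> C2 * X (1 - \<epsilon> - \<eta>) + 2 * (12 * C1 * X (1 - \<epsilon> - \<eta>))"
            using Sb 1 2 by linarith
          finally show ?thesis by (simp add: distrib_right)
        qed
        ultimately have "(X (g - 1) + 2 * X (- s) + 1 / real N) * (norm (\<Sum>m\<in>{a..<a+L}. u m) + 2 * real N * B) \<le>
          (4 * X (g - 1)) * ((C2 + 24 * C1) * X (1 - \<epsilon> - \<eta>))"
          using X1 B0 by (intro mult_mono) auto
        also have "\<dots> = 4 * (C2 + 24 * C1) * (X (g - 1) * X (1 - \<epsilon> - \<eta>))" by (simp only: mult_ac)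
        also have "X (g - 1) * X (1 - \<epsilon> - \<eta>) = X e"
          unfolding X2 by (rule arg_cong[where f = X]) (simp add: e_def algebra_simps)
        finally show ?thesis .
      qed
      have L': "real L \<le> X (1 - \<epsilon>)" using L by (simp add: X_def x_def)
      \<comment> \<open>27 is 2 + 1 + 24, and 1 - \<epsilon> - s equals g - 2 \<epsilon>, so
        \<open>\<eta> \<le> \<epsilon>\<close> finishes.\<close>
      have t2: "(2 * X (- s) + 1 / real N + 2 * \<tau>) * real L \<le> 27 * X e"
      proof -
        have "(2 * X (- s) + 1 / real N + 2 * \<tau>) * real L \<le> (27 * X (- s)) * X (1 - \<epsilon>)"
          using invN \<tau> L' X1 by (intro mult_mono) auto
        also have "\<dots> = 27 * X (- s + (1 - \<epsilon>))" by (simp only: X2 mult.assoc)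
        also have "\<dots> \<le> 27 * X e" using \<eta> by (intro mult_left_mono X3) (auto simp: e_def s_def)
        finally show ?thesis .
      qed
      have t3: "real L ^ 2 * X (g - 2) \<le> X e"
      proof -
        have "real L ^ 2 * X (g - 2) \<le> (X (1 - \<epsilon>) * X (1 - \<epsilon>)) * X (g - 2)"
          unfolding power2_eq_square using L' X1 by (intro mult_right_mono mult_mono) auto
        also have "\<dots> = X (1 - \<epsilon> + (1 - \<epsilon>) + (g - 2))" by (simp only: X2)
        also have "\<dots> \<le> X e" using \<eta> by (intro X3) (simp add: e_def)
        finally show ?thesis .
      qed
      have t4: "1 \<le> X e" using \<eta> \<epsilon> g par by (intro X4) (simp add: e_def)
      have "norm (\<Sum>m\<in>ps_range c \<inter> {a..<a+L}. u m) \<le> C * X e"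
        using main t1 t2 t3 t4 by (simp add: C_def algebra_simps)
      then show "norm (\<Sum>m\<in>ps_range c \<inter> {a..<a+L}. digit_char q1 \<alpha>1 m * digit_char q2 \<alpha>2 m) \<le> C * real a powr (g - \<epsilon> - \<eta>)"
        by (simp add: u_def X_def x_def e_def)
    qed
  qed
  moreover have "C \<ge> 0" using C1 C2 by (simp add: C_def)
  moreover have "\<epsilon> + \<eta> < g" using \<eta> \<epsilon> g by simp
  ultimately show ?thesis using \<epsilon>(1) \<eta>(1) unfolding g_def by blast
qed

section \<open>Summation and detection of residue classes\<close>

text \<open>
Induction peels off the topmost block: concavity of \<open>N powr (g - \<eta>)\<close> makes its increment over a block of length
\<open>N powr (1 - \<epsilon>)\<close> of the size of the block bound.
\<close>

lemma partial_sum_bound_of_blocks: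
  fixes u :: "nat \<Rightarrow> complex" and A :: "nat set" and g \<epsilon> \<eta> C :: real
  assumes u: "\<And>m. norm (u m) \<le> 1" and par: "0 < \<epsilon>" "0 < \<eta>" "\<epsilon> + \<eta> < g" "g \<le> 1" and C: "C \<ge> 0"
    and block: "eventually (\<lambda>a. \<forall>L. real L \<le> real a powr (1 - \<epsilon>) \<longrightarrow>
      norm (\<Sum>m\<in>A \<inter> {a..<a+L}. u m) \<le> C * real a powr (g - \<epsilon> - \<eta>)) sequentially"
  shows "\<exists>K\<ge>0. \<forall>N. norm (\<Sum>m\<in>A \<inter> {..<N}. u m) \<le> K * real N powr (g - \<eta>)"
proof -
  define \<kappa> where "\<kappa> = g - \<eta>"
  have \<kappa>: "0 < \<kappa>" "\<kappa> < 1" "\<epsilon> < \<kappa>" using par by (auto simp: \<kappa>_def)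
  obtain a0 where a0: "\<And>a L. a \<ge> a0 \<Longrightarrow> real L \<le> real a powr (1 - \<epsilon>) \<Longrightarrow>
      norm (\<Sum>m\<in>A \<inter> {a..<a+L}. u m) \<le> C * real a powr (\<kappa> - \<epsilon>)"
    using block unfolding eventually_sequentially \<kappa>_def by (auto simp: algebra_simps)
  have "eventually (\<lambda>a::nat. 4 * real a powr 0 \<le> real a powr (1 - \<epsilon>)) sequentially"
    using par by (intro eventually_const_mult_powr_le) simp
  then obtain a1 where a1: "\<And>a::nat. a \<ge> a1 \<Longrightarrow> 4 * real a powr 0 \<le> real a powr (1 - \<epsilon>)"
    unfolding eventually_sequentially by blast
  define N1 where "N1 = 2 * a0 + a1 + 2"
  \<comment> \<open>The first entry makes the increment of the bound outweigh one block; the second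
    covers \<open>N \<le> N1\<close> by the trivial estimate.\<close>
  define K where "K = max (4 * C / \<kappa>) (real N1)"
  have K: "4 * C / \<kappa> \<le> K" "real N1 \<le> K" by (auto simp: K_def)
  have K0: "K \<ge> 0" using K(2) by (meson of_nat_0_le_iff order_trans)
  have "norm (\<Sum>m\<in>A \<inter> {..<N}. u m) \<le> K * real N powr \<kappa>" for N
  proof (induction N rule: less_induct)
    case (less N)
    show ?case
    proof (cases "N \<le> N1")
      case True
      show ?thesis
      proof (cases "N = 0")
        case False
        have "norm (\<Sum>m\<in>A \<inter> {..<N}. u m) \<le> (\<Sum>m\<in>A \<inter> {..<N}. 1)" using u by (intro sum_norm_le) auto
        also have "\<dots> \<le> real N" using card_mono[of "{..<N}" "A \<inter> {..<N}"] by simp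
        also have "\<dots> \<le> K * 1" using True K by simp
        also have "\<dots> \<le> K * real N powr \<kappa>"
          using False \<kappa> K0 by (intro mult_left_mono ge_one_powr_ge_zero) auto
        finally show ?thesis .
      qed simp
    next
      case False
      \<comment> \<open>The block must be short relative to its lower end \<open>a = N - L\<close>,
        which depends on its length; measuring by \<open>N / 2 \<le> a\<close> avoids the
        circularity.\<close>
      define y where "y = (real N / 2) powr (1 - \<epsilon>)"
      define L where "L = nat \<lfloor>y\<rfloor>"
      define a where "a = N - L"
      have N: "N \<ge> 2 * a0" "N \<ge> a1" "N \<ge> 2" using False by (auto simp: N1_def)
      have e1: "1 - \<epsilon> > 0" "1 - \<epsilon> < 1" using par by auto
      have y1: "y \<ge> real N powr (1 - \<epsilon>) / 2"
      proof -
        have "real N powr (1 - \<epsilon>) / 2 = real N powr (1 - \<epsilon>) * (1 / 2) powr 1" by simp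
        also have "\<dots> \<le> real N powr (1 - \<epsilon>) * (1 / 2) powr (1 - \<epsilon>)"
          using e1 by (intro mult_left_mono powr_mono') auto
        also have "\<dots> = y" unfolding y_def by (simp add: powr_mult[symmetric])
        finally show ?thesis .
      qed
      \<comment> \<open>Makes \<open>y\<close> at least 2, so that rounding down to \<open>L\<close>
        loses at most half of it; this accounts for the 4 in \<open>K\<close>.\<close>
      moreover have "real N powr (1 - \<epsilon>) \<ge> 4" using a1[OF N(2)] N(3) by simp
      ultimately have y2: "y \<ge> 2" by simp
      have Ly: "real L \<le> y" "real L \<ge> y - 1" unfolding L_def using y2 by linarith+
      have "y \<le> (real N / 2) powr 1" unfolding y_def using e1 N by (intro powr_mono) auto
      then have yN: "y \<le> real N / 2" by simp
      then have L2: "2 * L \<le> N" using Ly by linarith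
      have L1: "L \<ge> 1" using Ly y2 by linarith
      have aL: "a + L = N" "a < N" "a \<ge> a0" "a \<ge> 1" "real a \<ge> real N / 2"
        using L2 L1 N by (auto simp: a_def)
      have La: "real L \<le> real a powr (1 - \<epsilon>)"
      proof -
        have "y \<le> real a powr (1 - \<epsilon>)" unfolding y_def using aL e1 by (intro powr_mono2) auto
        then show ?thesis using Ly by simp
      qed
      have un: "A \<inter> {..<N} = (A \<inter> {..<a}) \<union> (A \<inter> {a..<a+L})" using aL by auto
      have eq: "(\<Sum>m\<in>A \<inter> {..<N}. u m) = (\<Sum>m\<in>A \<inter> {..<a}. u m) + (\<Sum>m\<in>A \<inter> {a..<a+L}. u m)"
        unfolding un by (rule sum.union_disjoint) auto
      have "norm (\<Sum>m\<in>A \<inter> {..<N}. u m) \<le> norm (\<Sum>m\<in>A \<inter> {..<a}. u m) + norm (\<Sum>m\<in>A \<inter> {a..<a+L}. u m)"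
        unfolding eq by (rule norm_triangle_ineq)
      also have "\<dots> \<le> K * real a powr \<kappa> + C * real a powr (\<kappa> - \<epsilon>)"
        by (intro add_mono less.IH a0 aL La)
      also have "C * real a powr (\<kappa> - \<epsilon>) \<le> C * real N powr (\<kappa> - \<epsilon>)"
        using C aL \<kappa> by (intro mult_left_mono powr_mono2) auto
      also have "K * real a powr \<kappa> \<le> K * real N powr \<kappa> - C * real N powr (\<kappa> - \<epsilon>)"
      proof -
        have "\<kappa> * (real N - real a) * real N powr (\<kappa> - 1) \<le> real N powr \<kappa> - real a powr \<kappa>"
          using \<kappa> aL by (intro powr_diff_bounds) auto
        moreover have "\<kappa> * (real N powr (1 - \<epsilon>) / 4) * real N powr (\<kappa> - 1) \<le> \<kappa> * (real N - real a) * real N powr (\<kappa> - 1)"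
        proof -
          have "real N - real a = real L" using aL by simp
          then have "real N powr (1 - \<epsilon>) / 4 \<le> real N - real a" using Ly y1 y2 by simp
          then show ?thesis using \<kappa> by (intro mult_right_mono mult_left_mono) auto
        qed
        moreover have "\<kappa> * (real N powr (1 - \<epsilon>) / 4) * real N powr (\<kappa> - 1) = \<kappa> / 4 * real N powr (\<kappa> - \<epsilon>)"
        proof -
          have "real N powr (1 - \<epsilon>) * real N powr (\<kappa> - 1) = real N powr (\<kappa> - \<epsilon>)"
            by (simp flip: powr_add)
          then show ?thesis by simp
        qed
        ultimately have "\<kappa> / 4 * real N powr (\<kappa> - \<epsilon>) \<le> real N powr \<kappa> - real a powr \<kappa>" by linarith
        then have "K * (\<kappa> / 4 * real N powr (\<kappa> - \<epsilon>)) \<le> K * (real N powr \<kappa> - real a powr \<kappa>)"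
          using K0 by (intro mult_left_mono)
        moreover have "C * real N powr (\<kappa> - \<epsilon>) \<le> K * (\<kappa> / 4 * real N powr (\<kappa> - \<epsilon>))"
        proof -
          have "C \<le> K * (\<kappa> / 4)" using K(1) \<kappa> by (simp add: field_simps)
          then have "C * real N powr (\<kappa> - \<epsilon>) \<le> (K * (\<kappa> / 4)) * real N powr (\<kappa> - \<epsilon>)"
            by (intro mult_right_mono) auto
          then show ?thesis by (simp only: mult.assoc)
        qed
        ultimately show ?thesis by (simp add: algebra_simps)
      qed
      finally show ?thesis by simp
    qed
  qed
  then show ?thesis using K0 unfolding \<kappa>_def by blast
qed

text \<open>Reindexing by the injective increasing map from \<open>n\<close> to the floor of
  \<open>n powr c\<close> gives a sum over \<open>ps_range c\<close> up to about
  \<open>X powr c\<close>; the saving \<open>\<eta>\<close> there becomes \<open>c * \<eta>\<close>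
  in terms of \<open>X\<close>.\<close>

lemma ps_sum_bound:
  fixes q1 q2 :: nat and \<alpha>1 \<alpha>2 c :: real
  assumes q: "q1 \<ge> 2" "q2 \<ge> 2" "coprime q1 q2" and c: "1 < c" "c < 18 / 17"
    and nontriv: "real (q1 - 1) * \<alpha>1 \<notin> \<int> \<or> real (q2 - 1) * \<alpha>2 \<notin> \<int>"
  shows "\<exists>\<epsilon>>0. \<exists>K\<ge>0. \<forall>X\<ge>1. norm (\<Sum>n\<in>{1..X}. digit_char q1 \<alpha>1 (nat \<lfloor>real n powr c\<rfloor>) *
    digit_char q2 \<alpha>2 (nat \<lfloor>real n powr c\<rfloor>)) \<le> K * real X powr (1 - \<epsilon>)"
proof -
  define u where "u m = digit_char q1 \<alpha>1 m * digit_char q2 \<alpha>2 m" for m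
  obtain \<epsilon> \<eta> C where par: "\<epsilon> > 0" "\<eta> > 0" "C \<ge> 0" "\<epsilon> + \<eta> < 1 / c"
    and block: "eventually (\<lambda>a. \<forall>L. real L \<le> real a powr (1 - \<epsilon>) \<longrightarrow>
      norm (\<Sum>m\<in>ps_range c \<inter> {a..<a+L}. u m) \<le> C * real a powr (1 / c - \<epsilon> - \<eta>)) sequentially"
    using ps_range_block_bound[OF q c nontriv] unfolding u_def by auto
  have "1 / c \<le> 1" using c by simp
  then obtain K where K: "K \<ge> 0" "\<And>N. norm (\<Sum>m\<in>ps_range c \<inter> {..<N}. u m) \<le> K * real N powr (1 / c - \<eta>)"
    using partial_sum_bound_of_blocks[OF _ par(1,2,4) _ par(3) block] by (auto simp: u_def norm_mult)
  have \<kappa>: "0 < 1 / c - \<eta>" "1 / c - \<eta> \<le> 1" using par \<open>1 / c \<le> 1\<close> by auto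
  have "norm (\<Sum>n\<in>{1..X}. u (nat \<lfloor>real n powr c\<rfloor>)) \<le> 2 * K * real X powr (1 - c * \<eta>)" if X: "X \<ge> 1" for X :: nat
  proof -
    define \<phi> where "\<phi> n = nat \<lfloor>real n powr c\<rfloor>" for n :: nat
    have inj: "inj_on \<phi> {1..X}"
      unfolding \<phi>_def by (rule inj_on_subset[OF inj_on_nat_floor_powr]) (use c in auto)
    have mono: "\<phi> i \<le> \<phi> j" if "i \<le> j" for i j
      unfolding \<phi>_def using that c by (intro nat_mono floor_mono powr_mono2) auto
    have img: "\<phi> ` {1..X} = ps_range c \<inter> {..<Suc (\<phi> X)}"
    proof (intro equalityI subsetI)
      fix m assume "m \<in> \<phi> ` {1..X}"
      then obtain n where "n \<in> {1..X}" "m = \<phi> n" by auto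
      then show "m \<in> ps_range c \<inter> {..<Suc (\<phi> X)}" using mono[of n X] by (auto simp: ps_range_def \<phi>_def less_Suc_eq_le)
    next
      fix m assume m: "m \<in> ps_range c \<inter> {..<Suc (\<phi> X)}"
      then obtain n where n: "n \<ge> 1" "m = \<phi> n" by (auto simp: ps_range_def \<phi>_def)
      have "n \<le> X"
      proof (rule ccontr)
        assume "\<not> n \<le> X"
        then have "\<phi> X \<le> \<phi> n" "n \<noteq> X" using mono by auto
        moreover have "\<phi> n \<noteq> \<phi> X" using inj_onD[OF inj_on_nat_floor_powr[of c], of n X] n X c \<open>n \<noteq> X\<close> by (auto simp: \<phi>_def)
        ultimately show False using m n by auto
      qed
      then show "m \<in> \<phi> ` {1..X}" using n by auto
    qed
    have "(\<Sum>n\<in>{1..X}. u (\<phi> n)) = (\<Sum>m\<in>\<phi> ` {1..X}. u m)" using inj by (simp add: sum.reindex)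
    then have "norm (\<Sum>n\<in>{1..X}. u (\<phi> n)) \<le> K * real (Suc (\<phi> X)) powr (1 / c - \<eta>)"
      unfolding img using K(2)[of "Suc (\<phi> X)"] by (simp only:)
    also have "\<dots> \<le> K * (2 * real X powr c) powr (1 / c - \<eta>)"
    proof -
      have "real X powr c \<ge> 1" using X c by (intro ge_one_powr_ge_zero) auto
      moreover have "real (\<phi> X) \<le> real X powr c" unfolding \<phi>_def by simp
      ultimately have "real (Suc (\<phi> X)) \<le> 2 * real X powr c" by simp
      then show ?thesis using K \<kappa> by (intro mult_left_mono powr_mono2) auto
    qed
    also have "(2 * real X powr c) powr (1 / c - \<eta>) = 2 powr (1 / c - \<eta>) * real X powr (c * (1 / c - \<eta>))"
      by (simp add: powr_mult powr_powr)
    also have "c * (1 / c - \<eta>) = 1 - c * \<eta>" using c by (simp add: right_diff_distrib)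
    also have "K * (2 powr (1 / c - \<eta>) * real X powr (1 - c * \<eta>)) \<le> K * (2 * real X powr (1 - c * \<eta>))"
      using K \<kappa> powr_mono[of "1 / c - \<eta>" 1 2] by (intro mult_left_mono mult_right_mono) auto
    finally show ?thesis by (simp add: \<phi>_def)
  qed
  moreover have "c * \<eta> > 0" "2 * K \<ge> 0" using c par K by auto
  ultimately show ?thesis unfolding u_def by blast
qed

section \<open>Detection of the residue classes\<close>

lemma residue_indicator:
  fixes l :: int
  assumes "M \<ge> 1"
  shows "(\<Sum>j<M. unit_exp (- (of_int l * (real j / real M))) * digit_char q (real j / real M) m) =
    (if int (digit_sum q m) mod int M = l mod int M then of_nat M else 0)"
proof -
  have "(\<Sum>j<M. unit_exp (- (of_int l * (real j / real M))) * digit_char q (real j / real M) m) =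
     (\<Sum>j<M. unit_exp (- (of_int (l - int (digit_sum q m)) * (real j / real M))))"
    unfolding digit_char_def unit_exp_add[symmetric] by (intro sum.cong refl arg_cong[where f = unit_exp]) (simp add: algebra_simps)
  also have "\<dots> = (if int M dvd l - int (digit_sum q m) then of_nat M else 0)"
    using assms by (intro sum_unit_exp_grid) simp
  also have "int M dvd l - int (digit_sum q m) \<longleftrightarrow> int (digit_sum q m) mod int M = l mod int M"
    by (metis mod_eq_dvd_iff)
  finally show ?thesis .
qed

text \<open>This is where coprimality to \<open>q - 1\<close> enters: every nonzero frequency
  \<open>j / M\<close> gives a character whose correlations decay.\<close>

lemma coprime_imp_not_Ints:
  assumes "coprime M (q - 1)" "j < M" "j \<noteq> 0"
  shows "real (q - 1) * (real j / real M) \<notin> \<int>"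
proof
  assume "real (q - 1) * (real j / real M) \<in> \<int>"
  then obtain z :: int where "real (q - 1) * (real j / real M) = of_int z" by (auto elim: Ints_cases)
  then have "real_of_int (int ((q - 1) * j)) = of_int (z * int M)" using assms by (simp add: field_simps)
  then have "int ((q - 1) * j) = z * int M" by (simp only: of_int_eq_iff)
  then have "int M dvd int ((q - 1) * j)" by simp
  then have "M dvd (q - 1) * j" by (simp only: int_dvd_int_iff)
  then have "M dvd j" using assms(1) by (simp add: coprime_dvd_mult_right_iff)
  then show False using assms by (auto dest: dvd_imp_le)
qed

text \<open>The smallest saving serves all characters. The clause \<open>\<epsilon> \<le> 1\<close>
  keeps \<open>x powr (1 - \<epsilon>)\<close> at least 1, which later absorbs the replacement of
  \<open>x\<close> by its floor.\<close>

lemma finite_uniform_power_saving: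
  fixes F :: "'a \<Rightarrow> nat \<Rightarrow> real"
  assumes "finite J" "\<And>p. p \<in> J \<Longrightarrow> \<exists>\<epsilon>>0. \<exists>K\<ge>0. \<forall>X\<ge>1. F p X \<le> K * real X powr (1 - \<epsilon>)"
  shows "\<exists>\<epsilon>>0. \<epsilon> \<le> 1 \<and> (\<exists>K\<ge>0. \<forall>X\<ge>1. (\<Sum>p\<in>J. F p X) \<le> K * real X powr (1 - \<epsilon>))"
  using assms
proof (induction J rule: finite_induct)
  case empty
  then show ?case by (intro exI[of _ 1]) auto
next
  case (insert p J)
  obtain \<epsilon>1 K1 where 1: "\<epsilon>1 > 0" "\<epsilon>1 \<le> 1" "K1 \<ge> 0" "\<And>X. X \<ge> 1 \<Longrightarrow> (\<Sum>p\<in>J. F p X) \<le> K1 * real X powr (1 - \<epsilon>1)"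
    using insert.IH insert.prems by (metis insertCI)
  obtain \<epsilon>2 K2 where 2: "\<epsilon>2 > 0" "K2 \<ge> 0" "\<And>X. X \<ge> 1 \<Longrightarrow> F p X \<le> K2 * real X powr (1 - \<epsilon>2)"
    using insert.prems by (metis insertCI)
  define \<epsilon> where "\<epsilon> = min \<epsilon>1 \<epsilon>2"
  have "(\<Sum>p\<in>insert p J. F p X) \<le> (K1 + K2) * real X powr (1 - \<epsilon>)" if X: "X \<ge> 1" for X
  proof -
    have "K1 * real X powr (1 - \<epsilon>1) \<le> K1 * real X powr (1 - \<epsilon>)"
      using X 1 by (intro mult_left_mono powr_mono) (auto simp: \<epsilon>_def)
    moreover have "K2 * real X powr (1 - \<epsilon>2) \<le> K2 * real X powr (1 - \<epsilon>)"
      using X 2 by (intro mult_left_mono powr_mono) (auto simp: \<epsilon>_def)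
    ultimately show ?thesis using 1(4)[OF X] 2(3)[OF X] insert.hyps by (simp add: algebra_simps)
  qed
  moreover have "\<epsilon> > 0" "\<epsilon> \<le> 1" "K1 + K2 \<ge> 0" using 1 2 by (auto simp: \<epsilon>_def)
  ultimately show ?case by blast
qed

theorem theorem3:
  fixes q1 q2 m1 m2 :: nat and l1 l2 :: int and c :: real
  assumes "q1 \<ge> 2" "q2 \<ge> 2" "m1 \<ge> 1" "m2 \<ge> 1"
    and "coprime q1 q2" "coprime m1 (q1 - 1)" "coprime m2 (q2 - 1)"
    and "1 < c" "c < 18 / 17"
  shows "\<exists>\<epsilon>>0. \<exists>C. \<forall>x::real. x \<ge> 1 \<longrightarrow>
    \<bar>real (card {n::nat. 1 \<le> n \<and> real n \<le> x \<and>
        int (digit_sum q1 (nat \<lfloor>real n powr c\<rfloor>)) mod int m1 = l1 mod int m1 \<and>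
        int (digit_sum q2 (nat \<lfloor>real n powr c\<rfloor>)) mod int m2 = l2 mod int m2})
      - x / (real m1 * real m2)\<bar> \<le> C * x powr (1 - \<epsilon>)"
proof -
  define \<phi> where "\<phi> n = nat \<lfloor>real n powr c\<rfloor>" for n :: nat
  define w where "w = (\<lambda>(j, k). unit_exp (- (of_int l1 * (real j / real m1))) * unit_exp (- (of_int l2 * (real k / real m2))))"
  define T where "T = (\<lambda>(j, k) X. \<Sum>n\<in>{1..X}. digit_char q1 (real j / real m1) (\<phi> n) * digit_char q2 (real k / real m2) (\<phi> n))"
  \<comment> \<open>The pair \<open>(0, 0)\<close> is set aside because it yields the main
    term.\<close>
  define J where "J = ({..<m1} \<times> {..<m2}) - {(0, 0)}"
  have finJ: "finite J" by (simp add: J_def)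
  have "\<exists>\<epsilon>>0. \<exists>K\<ge>0. \<forall>X\<ge>1. norm (T p X) \<le> K * real X powr (1 - \<epsilon>)" if pJ: "p \<in> J" for p
  proof -
    obtain j k where "p = (j, k)" by (cases p)
    then have p: "p = (j, k)" "j < m1" "k < m2" "j \<noteq> 0 \<or> k \<noteq> 0" using pJ by (auto simp: J_def)
    have "real (q1 - 1) * (real j / real m1) \<notin> \<int> \<or> real (q2 - 1) * (real k / real m2) \<notin> \<int>"
      using p(4) coprime_imp_not_Ints[OF assms(6) p(2)] coprime_imp_not_Ints[OF assms(7) p(3)] by blast
    from ps_sum_bound[OF assms(1,2,5,8,9) this] show ?thesis by (simp add: T_def p \<phi>_def)
  qed
  from finite_uniform_power_saving[of J "\<lambda>p X. norm (T p X)", OF finJ this]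
  obtain \<epsilon> K where \<epsilon>: "\<epsilon> > 0" "\<epsilon> \<le> 1" and K: "K \<ge> 0" "\<And>X. X \<ge> 1 \<Longrightarrow> (\<Sum>p\<in>J. norm (T p X)) \<le> K * real X powr (1 - \<epsilon>)"
    by auto
  have "\<bar>real (card {n::nat. 1 \<le> n \<and> real n \<le> x \<and>
        int (digit_sum q1 (\<phi> n)) mod int m1 = l1 mod int m1 \<and>
        int (digit_sum q2 (\<phi> n)) mod int m2 = l2 mod int m2}) - x / (real m1 * real m2)\<bar> \<le> (1 + K) * x powr (1 - \<epsilon>)"
    if x: "x \<ge> 1" for x :: real
  proof -
    define X where "X = nat \<lfloor>x\<rfloor>"
    have X: "X \<ge> 1" "real X \<le> x" "x \<le> real X + 1" unfolding X_def using x by linarith+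
    define good where "good n \<longleftrightarrow> int (digit_sum q1 (\<phi> n)) mod int m1 = l1 mod int m1 \<and>
        int (digit_sum q2 (\<phi> n)) mod int m2 = l2 mod int m2" for n
    have set_eq: "{n::nat. 1 \<le> n \<and> real n \<le> x \<and> int (digit_sum q1 (\<phi> n)) mod int m1 = l1 mod int m1 \<and>
        int (digit_sum q2 (\<phi> n)) mod int m2 = l2 mod int m2} = {n\<in>{1..X}. good n}"
    proof -
      have *: "real n \<le> x \<longleftrightarrow> n \<le> X" for n
        using X(2) le_nat_floor[of n x] by (auto simp: X_def)
      show ?thesis unfolding good_def * by (simp only: atLeastAtMost_iff conj_assoc)
    qed
    define M where "M = real m1 * real m2"
    have "1 * 1 \<le> real m1 * real m2" using assms(3,4) by (intro mult_mono) auto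
    then have M: "M \<ge> 1" by (simp add: M_def)
    \<comment> \<open>The count is scaled by \<open>M\<close> so that orthogonality applies without
      division; \<open>M \<ge> 1\<close> allows the factor to be dropped at the end.\<close>
    have "of_real M * complex_of_real (real (card {n\<in>{1..X}. good n})) = (\<Sum>n\<in>{1..X}. if good n then of_real M else 0)"
      by (subst sum.inter_filter[symmetric]) (simp_all add: mult.commute)
    also have "\<dots> = (\<Sum>n\<in>{1..X}. \<Sum>p\<in>{..<m1} \<times> {..<m2}. w p * (case p of (j, k) \<Rightarrow>
        digit_char q1 (real j / real m1) (\<phi> n) * digit_char q2 (real k / real m2) (\<phi> n)))"
    proof (intro sum.cong refl)
      fix n
      have conj_if: "(if A \<and> B then y * z else 0) = (if A then y else 0) * (if B then z else 0)" for A B and y z :: complex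
        by simp
      have "(if good n then complex_of_real M else 0) =
        (if int (digit_sum q1 (\<phi> n)) mod int m1 = l1 mod int m1 then of_nat m1 else 0) *
        (if int (digit_sum q2 (\<phi> n)) mod int m2 = l2 mod int m2 then of_nat m2 else 0)"
        unfolding good_def M_def of_real_mult of_real_of_nat_eq by (rule conj_if)
      also have "\<dots> = (\<Sum>j<m1. unit_exp (- (of_int l1 * (real j / real m1))) * digit_char q1 (real j / real m1) (\<phi> n)) *
         (\<Sum>k<m2. unit_exp (- (of_int l2 * (real k / real m2))) * digit_char q2 (real k / real m2) (\<phi> n))"
        unfolding residue_indicator[OF assms(3)] residue_indicator[OF assms(4)] ..
      also have "\<dots> = (\<Sum>p\<in>{..<m1} \<times> {..<m2}. w p * (case p of (j, k) \<Rightarrow>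
        digit_char q1 (real j / real m1) (\<phi> n) * digit_char q2 (real k / real m2) (\<phi> n)))"
        unfolding sum_product sum.cartesian_product w_def by (intro sum.cong refl) (auto simp: mult_ac)
      finally show "(if good n then complex_of_real M else 0) = (\<Sum>p\<in>{..<m1} \<times> {..<m2}. w p * (case p of (j, k) \<Rightarrow>
        digit_char q1 (real j / real m1) (\<phi> n) * digit_char q2 (real k / real m2) (\<phi> n)))" .
    qed
    also have "\<dots> = (\<Sum>p\<in>{..<m1} \<times> {..<m2}. w p * T p X)"
      by (subst sum.swap) (intro sum.cong refl, auto simp: T_def sum_distrib_left)
    also have "\<dots> = w (0, 0) * T (0, 0) X + (\<Sum>p\<in>J. w p * T p X)"
      unfolding J_def using assms(3,4) by (intro sum.remove) auto
    also have "w (0, 0) * T (0, 0) X = of_real (real X)" by (simp add: w_def T_def)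
    finally have "complex_of_real (M * real (card {n\<in>{1..X}. good n}) - real X) = (\<Sum>p\<in>J. w p * T p X)"
      by (simp add: algebra_simps)
    then have "norm (complex_of_real (M * real (card {n\<in>{1..X}. good n}) - real X)) = norm (\<Sum>p\<in>J. w p * T p X)"
      by (rule arg_cong)
    also have "\<dots> \<le> (\<Sum>p\<in>J. norm (T p X))"
      by (intro sum_norm_le) (auto simp: w_def norm_mult)
    also have "\<dots> \<le> K * real X powr (1 - \<epsilon>)" using K X by simp
    also have "\<dots> \<le> K * x powr (1 - \<epsilon>)" using K X \<epsilon> by (intro mult_left_mono powr_mono2) auto
    finally have main: "\<bar>M * real (card {n\<in>{1..X}. good n}) - real X\<bar> \<le> K * x powr (1 - \<epsilon>)"
      by (simp only: norm_of_real)
    have one: "1 \<le> x powr (1 - \<epsilon>)" using x \<epsilon> by (intro ge_one_powr_ge_zero) auto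
    define Z where "Z = real (card {n\<in>{1..X}. good n}) - x / M"
    have "M * Z = M * real (card {n\<in>{1..X}. good n}) - x" using M by (simp add: Z_def right_diff_distrib)
    then have "\<bar>M * Z\<bar> \<le> (1 + K) * x powr (1 - \<epsilon>)"
      using main one X by (simp add: algebra_simps abs_le_iff)
    moreover have "\<bar>Z\<bar> \<le> \<bar>M * Z\<bar>" using M by (simp add: abs_mult mult_left_mono mult_le_cancel_right1)
    ultimately show ?thesis unfolding set_eq by (simp add: Z_def M_def)
  qed
  then show ?thesis using \<epsilon>(1) unfolding \<phi>_def by blast
qed

end
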